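(* Let $i\in\{0,1\}$. The quantum affine algebra $U_q(\widehat{sl}_2)$ is realized on the Fock space $\Lambda\otimes \mathbb C[\mathbb Z\alpha]e^{i\alpha/2}$ of symmetric functions by the following action of the components $X_n^{\pm}$ ($n\in\mathbb Z$) on the Schur basis. For every partition $\mu$ and every $m\in\mathbb Z$, $$X_n^+ s_{\mu}e^{m\alpha}e^{i\alpha/2}=\Bigl(\sum_{j=0}^{l(\mu)-2m-n-1-i} q^{-2m-n-1-i-2j}\, \mathrm{sgn}(-2m-n-1-i-j,\mu)\sum_{\lambda\in\mathcal H_j}s_\lambda\Bigr)e^{(m+1)\alpha}e^{i\alpha/2},$$ where $\mathcal H_j$ is the set of partitions $\lambda$ such that $\lambda-\pi(-2m-n-1-i-j,\mu)$ is a horizontal $j$-strip; and $$X_n^- s_{\mu}e^{m\alpha}e^{i\alpha/2}=(-1)^{n+1+i}\Bigl(\sum_{j=0}^{\mu_1+2m-n-1+i} q^{2j}\, \mathrm{sgn}(2m-n-1-j+i,\mu')\sum_{\lambda\in\mathcal V_j}s_\lambda\Bigr)e^{(m-1)\alpha}e^{i\alpha/2},$$ where $\mathcal V_j$ is the set of partitions $\lambda$ such that $\lambda-\pi(2m-n-1-j+i,\mu')'$ is a vertical $j$-strip. (A sum over $j$ whose upper limit is negative is zero, and a term whose sign is $0$ is zero.)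
   Context: Quantum affine algebra: $U_q(\widehat{sl}_2)$ is generated by $e_i,f_i,K_i^{\pm1}$ ($i=0,1$) and $q^{\pm d}$ with the usual Drinfeld-Jimbo relations for the Cartan matrix $\begin{pmatrix}2&-2\\-2&2\end{pmatrix}$: the $K_i$, $q^d$ are invertible and commute, $K_ie_jK_i^{-1}=q^{a_{ij}}e_j$, $K_if_jK_i^{-1}=q^{-a_{ij}}f_j$, $q^de_iq^{-d}=q^{\delta_{i,0}}e_i$, $q^df_iq^{-d}=q^{-\delta_{i,0}}f_i$, $[e_i,f_j]=\delta_{ij}\frac{K_i-K_i^{-1}}{q-q^{-1}}$, and the $q$-Serre relations. Fock space: let $\{a_n\mid n\ne0\}$ generate the Heisenberg algebra with (at level $c=1$) $[a_m,a_n]=\delta_{m,-n}\frac{m}{1+q^{2|m|}}$, acting on $\mathrm{Sym}(a_{-n}\text{'s}, n\ge1)$ in the standard way ($a_{-n}$ by multiplication, $a_n\cdot 1=0$ for $n\ge1$). For $i=0,1$ the Fock space is $\mathrm{Sym}(a_{-n}\text{'s})\otimes\mathbb C[\mathbb Z\alpha]e^{i\alpha/2}$, where $\mathbb C[\mathbb Z\alpha]e^{i\alpha/2}$ has basis $e^{m\alpha}e^{i\alpha/2}$ ($m\in\mathbb Z$), $q$ being an indeterminate (scalars contain $\mathbb Q(q^{1/2})$). The ring $\mathrm{Sym}(a_{-n}\text{'s})$ is identified with the ring $\Lambda$ of symmetric functions in infinitely many variables by $a_{-n}\mapsto p_n$ (power sums), and $s_\lambda e^{m\alpha}e^{i\alpha/2}$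 denotes the Schur function $s_\lambda$ tensored with $e^{m\alpha}e^{i\alpha/2}$. Operators: $e^{n\alpha}\cdot e^{m\alpha}e^{i\alpha/2}=e^{(m+n)\alpha}e^{i\alpha/2}$, $\partial\cdot e^{m\alpha}e^{i\alpha/2}=(2m+i)e^{m\alpha}e^{i\alpha/2}$. Vertex operators: $$X^+(z)=\exp\Bigl(\sum_{n\ge1}\tfrac{(1+q^{2n})q^{-n}}{n}a_{-n}z^n\Bigr)\exp\Bigl(-\sum_{n\ge1}\tfrac{(1+q^{2n})q^{-n}}{n}a_nz^{-n}\Bigr)e^{\alpha}z^{\partial}=\sum_{n\in\mathbb Z}X_n^+z^{-n-1},$$ $$X^-(z)=\exp\Bigl(-\sum_{n\ge1}\tfrac{1+q^{2n}}{n}a_{-n}z^n\Bigr)\exp\Bigl(\sum_{n\ge1}\tfrac{1+q^{2n}}{n}a_nz^{-n}\Bigr)e^{-\alpha}z^{-\partial}=\sum_{n\in\mathbb Z}X_n^-z^{-n-1}.$$ The (level one) realization is $e_1\mapsto X_0^+$, $f_1\mapsto X_0^-$, $K_1\mapsto q^{\partial}$, $e_0\mapsto X_1^-q^{-\partial}$, $f_0\mapsto q^{\partial}X_{-1}^+$, $K_0\mapsto q^{1-\partial}$, with $q^d$ acting through the homogeneous grading. Partitions: $l(\mu)$ is the length, $\mu'$ the conjugate (dual) partition, $|\mu|$ the weight. For an integer $a$ and a partition $\mu$, $(a,\mu)$ is the juxtaposed tuple $(a,\mu_1,\dots,\mu_{l(\mu)})$. For an $l$-tuple $\nu\in\mathbb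 Z^l$ put $\delta=(l-1,l-2,\dots,1,0)$. $\nu$ is degenerate if $\nu+\delta$ has two equal entries; then $\mathrm{sgn}(\nu)=0$. Otherwise there is a unique permutation $\sigma\in\mathfrak S_l$ such that $\pi(\nu):=\sigma(\nu+\delta)-\delta$ is weakly decreasing, and $\mathrm{sgn}(\nu)=(-1)^{l(\sigma)}$ with $l(\sigma)$ the length of $\sigma$; for the tuples above $\pi(\nu)$ is a partition. For partitions $\lambda\supset\rho$, the skew diagram $\lambda-\rho$ is a horizontal (resp. vertical) $j$-strip if it has $j$ boxes in total and at most one box in each column (resp. each row). *)

theory Defs
  imports
    "HOL-Library.Poly_Mapping"
    "HOL-Library.FuncSet"
    "HOL-Combinatorics.Permutations"
    "HOL-Computational_Algebra.Polynomial"
    "HOL-Computational_Algebra.Fraction_Field"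
begin

section \<open>Scalars\<close>

text \<open>
  Scalars range over an arbitrary field \<open>'a :: field_char_0\<close> with an element \<open>q\<close> that has a square
  root and is not algebraic. The instance below makes function fields such as \<open>rat poly fract\<close>,
  i.e. \<open>\<rat>(q\<^sup>1\<^sup>/\<^sup>2)\<close>, admissible.
\<close>

instance fract :: ("{idom, ring_char_0}") field_char_0
proof
  show "inj (of_nat :: nat \<Rightarrow> 'a fract)"
    by (auto intro!: injI simp: of_nat_fract eq_fract)
qed


section \<open>Partitions and straightening of integer tuples\<close>

definition is_partition :: "nat list \<Rightarrow> bool" where
  "is_partition \<mu> \<longleftrightarrow> sorted_wrt (\<ge>) \<mu> \<and> 0 \<notin> set \<mu>"

definition first_part :: "nat list \<Rightarrow> nat" where
  "first_part \<mu> = (if \<mu> = [] then 0 else hd \<mu>)"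

definition conjugate :: "nat list \<Rightarrow> nat list" where
  "conjugate \<mu> = map (\<lambda>c. card {r. r < length \<mu> \<and> c < \<mu> ! r}) [0..<first_part \<mu>]"

definition diagram :: "nat list \<Rightarrow> (nat \<times> nat) set" where
  "diagram \<mu> = {(r, c). r < length \<mu> \<and> c < \<mu> ! r}"

definition horizontal_strip :: "nat \<Rightarrow> nat list \<Rightarrow> nat list \<Rightarrow> bool" where
  "horizontal_strip j \<kappa> \<rho> \<longleftrightarrow> diagram \<rho> \<subseteq> diagram \<kappa> \<and> card (diagram \<kappa> - diagram \<rho>) = j \<and>
     (\<forall>x \<in> diagram \<kappa> - diagram \<rho>. \<forall>y \<in> diagram \<kappa> - diagram \<rho>. snd x = snd y \<longrightarrow> x = y)"

definition vertical_strip :: "nat \<Rightarrow> nat list \<Rightarrow> nat list \<Rightarrow> bool" where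
  "vertical_strip j \<kappa> \<rho> \<longleftrightarrow> diagram \<rho> \<subseteq> diagram \<kappa> \<and> card (diagram \<kappa> - diagram \<rho>) = j \<and>
     (\<forall>x \<in> diagram \<kappa> - diagram \<rho>. \<forall>y \<in> diagram \<kappa> - diagram \<rho>. fst x = fst y \<longrightarrow> x = y)"

definition staircase :: "nat \<Rightarrow> int list" where
  "staircase l = map (\<lambda>k. int (l - 1 - k)) [0..<l]"

definition degenerate :: "int list \<Rightarrow> bool" where
  "degenerate \<nu> \<longleftrightarrow> \<not> distinct (map2 (+) \<nu> (staircase (length \<nu>)))"

definition straighten_by :: "(nat \<Rightarrow> nat) \<Rightarrow> int list \<Rightarrow> int list" where
  "straighten_by \<sigma> \<nu> =
     map2 (-) (permute_list \<sigma> (map2 (+) \<nu> (staircase (length \<nu>)))) (staircase (length \<nu>))"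

text \<open>The straightening permutation is exists exactly when \<open>\<nu>\<close> is not degenerate, and is then unique.\<close>

definition straightening_perm :: "int list \<Rightarrow> nat \<Rightarrow> nat" where
  "straightening_perm \<nu> =
     (THE \<sigma>. \<sigma> permutes {..<length \<nu>} \<and> sorted_wrt (\<ge>) (straighten_by \<sigma> \<nu>))"

definition perm_length :: "nat \<Rightarrow> (nat \<Rightarrow> nat) \<Rightarrow> nat" where
  "perm_length l \<sigma> = card {(a, b). a < b \<and> b < l \<and> \<sigma> b < \<sigma> a}"

definition tuple_sgn :: "int list \<Rightarrow> int" where
  "tuple_sgn \<nu> =
     (if degenerate \<nu> then 0 else (-1) ^ perm_length (length \<nu>) (straightening_perm \<nu>))"

text \<open>
  \<open>tuple_part\<close> is \<open>\<pi>(\<nu>)\<close> as a partition, with trailing zeros dropped. It is only meaningful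
  for nondegenerate \<open>\<nu>\<close> whose straightening has no negative entries.
\<close>

definition tuple_part :: "int list \<Rightarrow> nat list" where
  "tuple_part \<nu> = filter (\<lambda>x. x \<noteq> 0) (map nat (straighten_by (straightening_perm \<nu>) \<nu>))"

definition juxtapose :: "int \<Rightarrow> nat list \<Rightarrow> int list" where
  "juxtapose a \<mu> = a # map int \<mu>"


section \<open>Symmetric functions in infinitely many variables\<close>

text \<open>
  Formal power series in the variables \<open>x\<^sub>0, x\<^sub>1, x\<^sub>2, \<dots>\<close>, given by their coefficients; a monomial
  is its exponent vector.
\<close>

typedef 'a mseries = "UNIV :: ((nat \<Rightarrow>\<^sub>0 nat) \<Rightarrow> 'a) set"
  morphisms mcoeff MSeries ..

lemma mcoeff_MSeries [simp]: "mcoeff (MSeries f) = f"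
  by (simp add: MSeries_inverse)

lemma mseries_eqI: "(\<And>e. mcoeff F e = mcoeff G e) \<Longrightarrow> F = G"
  by (metis ext mcoeff_inverse)

lemma finite_splittings: "finite {(a, b). a + b = (e :: nat \<Rightarrow>\<^sub>0 nat)}"
proof -
  have "a \<in> (\<lambda>g. Abs_poly_mapping (\<lambda>k. if k \<in> Poly_Mapping.keys e then g k else 0)) `
      (\<Pi>\<^sub>E k\<in>Poly_Mapping.keys e. {..Poly_Mapping.lookup e k})" if "a + b = e" for a b
  proof (rule image_eqI[where x = "restrict (Poly_Mapping.lookup a) (Poly_Mapping.keys e)"])
    have le: "Poly_Mapping.lookup a k \<le> Poly_Mapping.lookup e k" for k
      using that by (auto simp: lookup_add)
    then show "restrict (Poly_Mapping.lookup a) (Poly_Mapping.keys e)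
        \<in> (\<Pi>\<^sub>E k\<in>Poly_Mapping.keys e. {..Poly_Mapping.lookup e k})"
      by auto
    have "Poly_Mapping.lookup a k = 0" if "k \<notin> Poly_Mapping.keys e" for k
      using le[of k] that by (simp add: in_keys_iff)
    then have "(\<lambda>k. if k \<in> Poly_Mapping.keys e
        then restrict (Poly_Mapping.lookup a) (Poly_Mapping.keys e) k else 0) = Poly_Mapping.lookup a"
      by auto
    then show "a = Abs_poly_mapping
        (\<lambda>k. if k \<in> Poly_Mapping.keys e
          then restrict (Poly_Mapping.lookup a) (Poly_Mapping.keys e) k else 0)"
      by (simp add: Poly_Mapping.lookup_inverse)
  qed
  then have "fst ` {(a, b). a + b = e} \<subseteq>
      (\<lambda>g. Abs_poly_mapping (\<lambda>k. if k \<in> Poly_Mapping.keys e then g k else 0)) `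
      (\<Pi>\<^sub>E k\<in>Poly_Mapping.keys e. {..Poly_Mapping.lookup e k})"
    by auto
  moreover have "finite (\<Pi>\<^sub>E k\<in>Poly_Mapping.keys e. {..Poly_Mapping.lookup e k})"
    by (intro finite_PiE) auto
  ultimately have "finite (fst ` {(a, b). a + b = e})"
    by (meson finite_imageI finite_subset)
  moreover have "inj_on fst {(a, b). a + b = e}"
    by (auto simp: inj_on_def)
  ultimately show ?thesis
    using finite_imageD by blast
qed

instantiation mseries :: (comm_ring_1) comm_ring_1
begin

definition zero_mseries where "0 = MSeries (\<lambda>_. 0)"
definition one_mseries where "1 = MSeries (\<lambda>e. if e = 0 then 1 else 0)"
definition plus_mseries where "F + G = MSeries (\<lambda>e. mcoeff F e + mcoeff G e)"
definition minus_mseries where "F - G = MSeries (\<lambda>e. mcoeff F e - mcoeff G e)"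
definition uminus_mseries where "- F = MSeries (\<lambda>e. - mcoeff F e)"
definition times_mseries where
  "F * G = MSeries (\<lambda>e. \<Sum>(a, b) | a + b = e. mcoeff F a * mcoeff G b)"

instance
proof
  fix F G H :: "'a mseries"
  note defs = zero_mseries_def one_mseries_def plus_mseries_def minus_mseries_def
    uminus_mseries_def times_mseries_def
  show "F + G + H = F + (G + H)" "F + G = G + F" "0 + F = F" "- F + F = 0" "F - G = F + - G"
    by (simp_all add: defs mcoeff_inverse algebra_simps)
  show "F * G = G * F"
    by (auto simp: times_mseries_def fun_eq_iff MSeries_inject add.commute mult.commute
        intro!: sum.reindex_bij_witness[of _ prod.swap prod.swap])
  show "(F + G) * H = F * H + G * H"
    by (simp add: times_mseries_def plus_mseries_def case_prod_unfold distrib_right sum.distrib)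
  show "1 * F = F"
  proof (rule mseries_eqI)
    fix e
    have "mcoeff (1 * F) e = (\<Sum>x | fst x + snd x = e. mcoeff 1 (fst x) * mcoeff F (snd x))"
      by (simp add: times_mseries_def case_prod_unfold)
    also have "\<dots> = (\<Sum>x\<in>{(0, e)}. mcoeff 1 (fst x) * mcoeff F (snd x))"
      using finite_splittings[of e]
      by (intro sum.mono_neutral_right) (auto simp: one_mseries_def case_prod_unfold)
    also have "\<dots> = mcoeff F e"
      by (simp add: one_mseries_def)
    finally show "mcoeff (1 * F) e = mcoeff F e" .
  qed
  show "F * G * H = F * (G * H)"
  proof (rule mseries_eqI)
    fix e :: "nat \<Rightarrow>\<^sub>0 nat"
    let ?P = "\<lambda>e :: nat \<Rightarrow>\<^sub>0 nat. {x. fst x + snd x = e}"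
    have fin: "finite (?P e)" for e
      using finite_splittings[of e] by (simp add: case_prod_unfold)
    have "mcoeff (F * G * H) e =
        (\<Sum>x\<in>?P e. \<Sum>y\<in>?P (fst x). mcoeff F (fst y) * mcoeff G (snd y) * mcoeff H (snd x))"
      by (simp add: times_mseries_def case_prod_unfold sum_distrib_right)
    also have "\<dots> = (\<Sum>(x, y)\<in>Sigma (?P e) (\<lambda>x. ?P (fst x)).
        mcoeff F (fst y) * mcoeff G (snd y) * mcoeff H (snd x))"
      by (simp add: sum.Sigma fin)
    also have "\<dots> = (\<Sum>(x, y)\<in>Sigma (?P e) (\<lambda>x. ?P (snd x)).
        mcoeff F (fst x) * (mcoeff G (fst y) * mcoeff H (snd y)))"
      by (rule sum.reindex_bij_witness[of _
            "\<lambda>(x, y). ((fst x + fst y, snd y), (fst x, fst y))"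
            "\<lambda>(x, y). ((fst y, snd y + snd x), (snd y, snd x))"])
        (auto simp: add.assoc mult.assoc)
    also have "\<dots> = (\<Sum>x\<in>?P e. \<Sum>y\<in>?P (snd x).
        mcoeff F (fst x) * (mcoeff G (fst y) * mcoeff H (snd y)))"
      by (simp add: sum.Sigma fin)
    also have "\<dots> = mcoeff (F * (G * H)) e"
      by (simp add: times_mseries_def case_prod_unfold sum_distrib_left)
    finally show "mcoeff (F * G * H) e = mcoeff (F * (G * H)) e" .
  qed
  show "(0 :: 'a mseries) \<noteq> 1"
    by (auto simp: zero_mseries_def one_mseries_def MSeries_inject fun_eq_iff)
qed

end

definition mconst :: "'a::zero \<Rightarrow> 'a mseries" where
  "mconst c = MSeries (\<lambda>e. if e = 0 then c else 0)"

definition power_sum :: "nat \<Rightarrow> 'a::zero_neq_one mseries" where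
  "power_sum n = MSeries (\<lambda>e. if \<exists>k. e = Poly_Mapping.single k n then 1 else 0)"

definition semistandard :: "nat list \<Rightarrow> (nat \<times> nat \<Rightarrow> nat) \<Rightarrow> bool" where
  "semistandard \<kappa> T \<longleftrightarrow>
     (\<forall>r c c'. c < c' \<and> (r, c) \<in> diagram \<kappa> \<and> (r, c') \<in> diagram \<kappa> \<longrightarrow> T (r, c) \<le> T (r, c')) \<and>
     (\<forall>r r' c. r < r' \<and> (r, c) \<in> diagram \<kappa> \<and> (r', c) \<in> diagram \<kappa> \<longrightarrow> T (r, c) < T (r', c))"

text \<open>
  \<open>s\<^sub>\<kappa>\<close> is the sum of \<open>x\<^sup>T\<close> over the semistandard tableaux \<open>T\<close> of shape \<open>\<kappa>\<close>.
\<close>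

definition schur :: "nat list \<Rightarrow> 'a::semiring_1 mseries" where
  "schur \<kappa> = MSeries (\<lambda>e. of_nat (card
     {T \<in> diagram \<kappa> \<rightarrow>\<^sub>E UNIV. semistandard \<kappa> T \<and>
        (\<Sum>x\<in>diagram \<kappa>. Poly_Mapping.single (T x) 1) = e}))"


section \<open>The Fock space\<close>

text \<open>
  \<open>Sym(a\<^bsub>-n\<^esub>'s)\<close> is the polynomial ring in variables indexed by \<open>nat\<close>, where the index \<open>k\<close> stands for
  \<open>a\<^bsub>-(k+1)\<^esub>\<close>. The Fock space is the group algebra of \<open>\<int>\<close> over it: the basis element
  \<open>e\<^bsup>m\<alpha>\<^esup>e\<^bsup>i\<alpha>/2\<^esup>\<close> is recorded by \<open>m\<close>, and \<open>i\<close> enters only through the operators.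
\<close>

type_synonym 'a heis_sym = "(nat \<Rightarrow>\<^sub>0 nat) \<Rightarrow>\<^sub>0 'a"
type_synonym 'a fock = "int \<Rightarrow>\<^sub>0 'a heis_sym"

text \<open>
  The ring homomorphism \<open>a\<^bsub>-n\<^esub> \<mapsto> p\<^sub>n\<close>. In characteristic \<open>0\<close> it is injective with image the ring
  \<open>\<Lambda>\<close> of symmetric series of bounded degree; \<open>schur_sym \<kappa>\<close> is the element identified with \<open>s\<^sub>\<kappa>\<close>.
\<close>

definition to_Lambda :: "'a::comm_ring_1 heis_sym \<Rightarrow> 'a mseries" where
  "to_Lambda f = (\<Sum>t\<in>Poly_Mapping.keys f. mconst (Poly_Mapping.lookup f t) *
     (\<Prod>k\<in>Poly_Mapping.keys t. power_sum (Suc k) ^ Poly_Mapping.lookup t k))"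

definition schur_sym :: "nat list \<Rightarrow> 'a::comm_ring_1 heis_sym" where
  "schur_sym \<kappa> = the_inv to_Lambda (schur \<kappa>)"

definition schur_fock :: "nat list \<Rightarrow> int \<Rightarrow> 'a::comm_ring_1 fock" where
  "schur_fock \<kappa> m = Poly_Mapping.single m (schur_sym \<kappa>)"

definition fock_scale :: "'a::comm_ring_1 \<Rightarrow> 'a fock \<Rightarrow> 'a fock" where
  "fock_scale c v = Poly_Mapping.single 0 (Poly_Mapping.single 0 c) * v"

definition partial_deriv :: "nat \<Rightarrow> 'a::comm_ring_1 heis_sym \<Rightarrow> 'a heis_sym" where
  "partial_deriv k f = (\<Sum>t\<in>Poly_Mapping.keys f.
     Poly_Mapping.single (t - Poly_Mapping.single k 1)
       (of_nat (Poly_Mapping.lookup t k) * Poly_Mapping.lookup f t))"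

text \<open>
  The Heisenberg generators \<open>a\<^sub>n\<close>, \<open>n \<noteq> 0\<close>: \<open>a\<^bsub>-n\<^esub>\<close> acts by multiplication and \<open>a\<^sub>n\<close> by the
  derivation with \<open>a\<^sub>n(a\<^bsub>-m\<^esub>) = [a\<^sub>n, a\<^bsub>-m\<^esub>] = \<delta>\<^bsub>m,n\<^esub> n / (1 + q\<^bsup>2n\<^esup>)\<close> for \<open>n \<ge> 1\<close>. The value at \<open>n = 0\<close>
  is a dummy.
\<close>

definition heis :: "'a::field \<Rightarrow> int \<Rightarrow> 'a fock \<Rightarrow> 'a fock" where
  "heis q n v =
     (if n < 0 then
        Poly_Mapping.single 0 (Poly_Mapping.single (Poly_Mapping.single (nat (- n) - 1) 1) 1) * v
      else if n > 0 then
        fock_scale (of_int n / (1 + q powi (2 * n))) (Poly_Mapping.map (partial_deriv (nat n - 1)) v)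
      else 0)"

definition lattice_shift :: "int \<Rightarrow> 'a::comm_ring_1 fock \<Rightarrow> 'a fock" where
  "lattice_shift n v = Poly_Mapping.single n 1 * v"

text \<open>\<open>q_partial q i s\<close> is the operator \<open>q\<^bsup>s\<partial>\<^esup>\<close>, where \<open>\<partial> = 2m + i\<close> on \<open>e\<^bsup>m\<alpha>\<^esup>e\<^bsup>i\<alpha>/2\<^esup>\<close>.\<close>

definition q_partial :: "'a::field \<Rightarrow> int \<Rightarrow> int \<Rightarrow> 'a fock \<Rightarrow> 'a fock" where
  "q_partial q i s v =
     Poly_Mapping.mapp (\<lambda>m f. Poly_Mapping.single 0 (q powi (s * (2 * m + i))) * f) v"

text \<open>
  \<open>q_grading q i s\<close> is \<open>q\<^bsup>sd\<^esup>\<close> for the homogeneous grading in which \<open>a\<^bsub>-n\<^esub>\<close> lowers the degree by \<open>n\<close> and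
  \<open>e\<^bsup>m\<alpha>\<^esup>e\<^bsup>i\<alpha>/2\<^esup>\<close> has degree \<open>-(m\<^sup>2 + im)\<close>, which is \<open>-(m + i/2)\<^sup>2\<close> normalised to be \<open>0\<close> at \<open>m = 0\<close>.
\<close>

definition exponent_weight :: "(nat \<Rightarrow>\<^sub>0 nat) \<Rightarrow> nat" where
  "exponent_weight t = (\<Sum>k\<in>Poly_Mapping.keys t. Suc k * Poly_Mapping.lookup t k)"

definition q_grading :: "'a::field \<Rightarrow> int \<Rightarrow> int \<Rightarrow> 'a fock \<Rightarrow> 'a fock" where
  "q_grading q i s v = Poly_Mapping.mapp (\<lambda>m f. Poly_Mapping.mapp
     (\<lambda>t c. q powi (- s * (int (exponent_weight t) + m\<^sup>2 + i * m)) * c) f) v"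


section \<open>Vertex operators\<close>

text \<open>
  \<open>exp_coeff T r\<close> is the coefficient of \<open>w\<^sup>r\<close> in
  \<open>exp (\<Sum>n\<ge>1. T\<^sub>n w\<^sup>n) = \<Sum>k. 1/k! \<Sum>n\<^sub>1,\<dots>,n\<^sub>k\<ge>1. T\<^bsub>n\<^sub>1\<^esub> \<dots> T\<^bsub>n\<^sub>k\<^esub> w\<^bsup>n\<^sub>1+\<dots>+n\<^sub>k\<^esup>\<close>.
\<close>

definition exp_coeff :: "(nat \<Rightarrow> 'a::field_char_0 fock \<Rightarrow> 'a fock) \<Rightarrow> nat \<Rightarrow> 'a fock \<Rightarrow> 'a fock" where
  "exp_coeff T r v = (\<Sum>ns | 0 \<notin> set ns \<and> sum_list ns = r.
     fock_scale (inverse (fact (length ns))) (foldr T ns v))"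

text \<open>
  \<open>vertex_coeff q i a b \<epsilon> N\<close> is the coefficient of \<open>z\<^sup>N\<close> in
  \<open>exp (\<Sum>n\<ge>1. a\<^sub>n a\<^bsub>-n\<^esub> z\<^sup>n) exp (\<Sum>n\<ge>1. b\<^sub>n a\<^sub>n z\<^bsup>-n\<^esup>) e\<^bsup>\<epsilon>\<alpha>\<^esup> z\<^bsup>\<epsilon>\<partial>\<^esup>\<close> (with scalars \<open>a\<^sub>n\<close>, \<open>b\<^sub>n\<close>).
  In the sum over \<open>s\<close>, the power \<open>-s\<close> of \<open>z\<close> coming from the second exponential, only finitely many
  terms are nonzero.
\<close>

definition vertex_coeff ::
    "'a::field_char_0 \<Rightarrow> int \<Rightarrow> (nat \<Rightarrow> 'a) \<Rightarrow> (nat \<Rightarrow> 'a) \<Rightarrow> int \<Rightarrow> int \<Rightarrow> 'a fock \<Rightarrow> 'a fock" where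
  "vertex_coeff q i a b \<epsilon> N v = (\<Sum>m\<in>Poly_Mapping.keys v. Sum_any (\<lambda>s :: nat.
     let r = N + int s - \<epsilon> * (2 * m + i) in
     if r < 0 then 0 else
       exp_coeff (\<lambda>n u. fock_scale (a n) (heis q (- int n) u)) (nat r)
         (exp_coeff (\<lambda>n u. fock_scale (b n) (heis q (int n) u)) s
           (lattice_shift \<epsilon> (Poly_Mapping.single m (Poly_Mapping.lookup v m))))))"

text \<open>The components are indexed by \<open>X\<^sup>\<plusminus>(z) = \<Sum>n\<in>\<int>. X\<^sup>\<plusminus>\<^sub>n z\<^bsup>-n-1\<^esup>\<close>.\<close>

definition X_plus :: "'a::field_char_0 \<Rightarrow> int \<Rightarrow> int \<Rightarrow> 'a fock \<Rightarrow> 'a fock" where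
  "X_plus q i n = vertex_coeff q i
     (\<lambda>k. (1 + q ^ (2 * k)) * q powi (- int k) / of_nat k)
     (\<lambda>k. - ((1 + q ^ (2 * k)) * q powi (- int k) / of_nat k)) 1 (- n - 1)"

definition X_minus :: "'a::field_char_0 \<Rightarrow> int \<Rightarrow> int \<Rightarrow> 'a fock \<Rightarrow> 'a fock" where
  "X_minus q i n = vertex_coeff q i
     (\<lambda>k. - ((1 + q ^ (2 * k)) / of_nat k))
     (\<lambda>k. (1 + q ^ (2 * k)) / of_nat k) (- 1) (- n - 1)"


section \<open>The quantum affine algebra\<close>

definition cartan :: "nat \<Rightarrow> nat \<Rightarrow> int" where
  "cartan i j = (if i = j then 2 else - 2)"

definition q_int :: "'a::field \<Rightarrow> nat \<Rightarrow> 'a" where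
  "q_int q n = (q ^ n - inverse q ^ n) / (q - inverse q)"

text \<open>
  A module over the algebra presented by the generators \<open>e\<^sub>i, f\<^sub>i, K\<^sub>i\<^sup>\<plusminus>\<^sup>1\<close> (\<open>i = 0, 1\<close>) and \<open>q\<^bsup>\<plusminus>d\<^esup>\<close>:
  a vector space with linear operators satisfying the defining relations. \<open>D\<close> and \<open>Dinv\<close> are
  \<open>q\<^sup>d\<close> and \<open>q\<^bsup>-d\<^esup>\<close>.
\<close>

locale Uq_sl2_hat_module = vector_space scale
  for scale :: "'a::field \<Rightarrow> 'v::ab_group_add \<Rightarrow> 'v" +
  fixes q :: 'a
    and e f K Kinv :: "nat \<Rightarrow> 'v \<Rightarrow> 'v"
    and D Dinv :: "'v \<Rightarrow> 'v"
  assumes linear: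
      "i < 2 \<Longrightarrow> Vector_Spaces.linear scale scale (e i)"
      "i < 2 \<Longrightarrow> Vector_Spaces.linear scale scale (f i)"
      "i < 2 \<Longrightarrow> Vector_Spaces.linear scale scale (K i)"
      "i < 2 \<Longrightarrow> Vector_Spaces.linear scale scale (Kinv i)"
      "Vector_Spaces.linear scale scale D"
      "Vector_Spaces.linear scale scale Dinv"
    and invertible:
      "i < 2 \<Longrightarrow> K i (Kinv i v) = v" "i < 2 \<Longrightarrow> Kinv i (K i v) = v"
      "D (Dinv v) = v" "Dinv (D v) = v"
    and commute:
      "i < 2 \<Longrightarrow> j < 2 \<Longrightarrow> K i (K j v) = K j (K i v)"
      "i < 2 \<Longrightarrow> K i (D v) = D (K i v)"
    and K_conj:
      "i < 2 \<Longrightarrow> j < 2 \<Longrightarrow> K i (e j (Kinv i v)) = scale (q powi cartan i j) (e j v)"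
      "i < 2 \<Longrightarrow> j < 2 \<Longrightarrow> K i (f j (Kinv i v)) = scale (q powi (- cartan i j)) (f j v)"
    and D_conj:
      "i < 2 \<Longrightarrow> D (e i (Dinv v)) = scale (if i = 0 then q else 1) (e i v)"
      "i < 2 \<Longrightarrow> D (f i (Dinv v)) = scale (if i = 0 then inverse q else 1) (f i v)"
    and e_f_commutator:
      "i < 2 \<Longrightarrow> j < 2 \<Longrightarrow> e i (f j v) - f j (e i v) =
         (if i = j then scale (1 / (q - inverse q)) (K i v - Kinv i v) else 0)"
    and serre:
      "i < 2 \<Longrightarrow> j < 2 \<Longrightarrow> i \<noteq> j \<Longrightarrow>
         e i (e i (e i (e j v))) - scale (q_int q 3) (e i (e i (e j (e i v))))
         + scale (q_int q 3) (e i (e j (e i (e i v)))) - e j (e i (e i (e i v))) = 0"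
      "i < 2 \<Longrightarrow> j < 2 \<Longrightarrow> i \<noteq> j \<Longrightarrow>
         f i (f i (f i (f j v))) - scale (q_int q 3) (f i (f i (f j (f i v))))
         + scale (q_int q 3) (f i (f j (f i (f i v)))) - f j (f i (f i (f i v))) = 0"

text \<open>The level one realization on the Fock space with parameter \<open>i\<close>.\<close>

definition fock_e :: "'a::field_char_0 \<Rightarrow> int \<Rightarrow> nat \<Rightarrow> 'a fock \<Rightarrow> 'a fock" where
  "fock_e q i k = (if k = 0 then X_minus q i 1 \<circ> q_partial q i (- 1) else X_plus q i 0)"

definition fock_f :: "'a::field_char_0 \<Rightarrow> int \<Rightarrow> nat \<Rightarrow> 'a fock \<Rightarrow> 'a fock" where
  "fock_f q i k = (if k = 0 then q_partial q i 1 \<circ> X_plus q i (- 1) else X_minus q i 0)"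

definition fock_K :: "'a::field \<Rightarrow> int \<Rightarrow> nat \<Rightarrow> 'a fock \<Rightarrow> 'a fock" where
  "fock_K q i k = (if k = 0 then fock_scale q \<circ> q_partial q i (- 1) else q_partial q i 1)"

definition fock_Kinv :: "'a::field \<Rightarrow> int \<Rightarrow> nat \<Rightarrow> 'a fock \<Rightarrow> 'a fock" where
  "fock_Kinv q i k =
     (if k = 0 then fock_scale (inverse q) \<circ> q_partial q i 1 else q_partial q i (- 1))"

end

theory Submission
  imports Defs
begin

text \<open>
  On the polynomial ring each vertex operator is a creation exponential times an annihilation
  exponential. Normal ordering gives quadratic relations and commutators of the components; the
  Serre relations reduce to these, since up to powers of \<open>K\<close> the \<open>q\<close>-commutator of \<open>e\<^sub>0\<close> and \<open>e\<^sub>1\<close>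
  is a multiple of a Heisenberg generator.

  For the action on Schur functions, let \<open>H(z)\<close> be multiplication by the generating function of the
  complete symmetric functions and \<open>B(z)\<close> the generating function of the Bernstein operators. Then
  \<open>X\<^sup>+(z)\<close> is \<open>H(z/q) B(q z)\<close> up to a power of \<open>z\<close>, and the involution \<open>\<omega>\<close> turns \<open>X\<^sup>-(z)\<close> into an
  operator of the same kind. The relation \<open>B\<^sub>a B\<^sub>b = - B\<^sub>b\<^sub>-\<^sub>1 B\<^sub>a\<^sub>+\<^sub>1\<close> straightens \<open>B\<^sub>a s\<^sub>\<mu>\<close> to \<open>\<plusminus>s\<^sub>\<pi>\<^sub>(\<^sub>a\<^sub>,\<^sub>\<mu>\<^sub>)\<close>,
  and the Pieri rule expands the product with \<open>h\<^sub>j\<close>.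
\<close>

section \<open>Linear operators on the polynomial ring\<close>

text \<open>The exponentials are given as finite sums over compositions, a form that is awkward to
  multiply or commute. In characteristic 0 their coefficients are determined by Newton's recursion r
  E_r = sum n T_n E_(r-n), and all product and contraction formulas are obtained by checking it. Two
  vertex operators then differ from their normally ordered product by a scalar series. For equal
  signs it is a quadratic polynomial, which gives the quadratic relations. For opposite signs it is
  the inverse of one; the two orders expand the same rational function in opposite directions, and
  the commutator is a sum of two delta functions.

  Schur functions are sums over tableaux, and their preimages under \<open>to_Lambda\<close> are
  taken by an inverse function, so injectivity and the image of the Bernstein products have to be
  established. Both rest on one fact: the coefficient of x_v^k in a symmetric function f is h_k^perp
  f in the remaining variables. The operators h_k^perp, k > 0, also detect f up to its constant
  term, which yields omega s_mu' = s_mu by induction on the weight.\<close>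

definition hconst :: "'a::comm_ring_1 \<Rightarrow> 'a heis_sym" where
  "hconst c = Poly_Mapping.single 0 c"

text \<open>The variable with index n - 1 is the generator a_(-n). Truncated subtraction identifies
  \<open>hvar 0\<close> with \<open>hvar 1\<close>, hence the positivity assumptions wherever
  generators are distinguished.\<close>

definition hvar :: "nat \<Rightarrow> 'a::comm_ring_1 heis_sym" where
  "hvar n = Poly_Mapping.single (Poly_Mapping.single (n - 1) 1) 1"

text \<open>The derivation d/da_(-n) without the factor n / (1 + q^(2n)) of a_n; that factor is
  moved into the coefficients of the exponentials.\<close>

definition hderiv :: "nat \<Rightarrow> 'a::comm_ring_1 heis_sym \<Rightarrow> 'a heis_sym" where
  "hderiv n = partial_deriv (n - 1)"

lemma hconst_0 [simp]: "hconst 0 = 0" and hconst_1 [simp]: "hconst 1 = 1"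
  by (simp_all add: hconst_def)

lemma hconst_add: "hconst (a + b) = hconst a + hconst b"
  and hconst_diff: "hconst (a - b) = hconst a - hconst b"
  and hconst_uminus: "hconst (- a) = - hconst a"
  and hconst_mult: "hconst (a * b) = hconst a * hconst b"
  by (simp_all add: hconst_def single_add single_diff single_uminus mult_single)

lemma hconst_sum: "hconst (sum g A) = (\<Sum>x\<in>A. hconst (g x))"
  by (induction A rule: infinite_finite_induct) (auto simp: hconst_add)

lemma hconst_mult_left: "hconst a * (hconst b * f) = hconst (a * b) * f"
  by (simp add: hconst_mult mult.assoc)

lemma hconst_cancel: "c \<noteq> 0 \<Longrightarrow> hconst (c :: 'a::field) * f = hconst c * g \<Longrightarrow> f = g"
proof -
  assume "c \<noteq> 0" and eq: "hconst c * f = hconst c * g"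
  have "hconst (inverse c) * (hconst c * f) = hconst (inverse c) * (hconst c * g)"
    by (simp add: eq)
  then show "f = g"
    using \<open>c \<noteq> 0\<close> by (simp add: hconst_mult_left)
qed

lemma lookup_hconst_mult: "Poly_Mapping.lookup (hconst c * f) t = c * Poly_Mapping.lookup f t"
  unfolding hconst_def mult_map_scale_conv_mult [symmetric]
  by (simp add: Poly_Mapping.map.rep_eq when_def)

lemma poly_mapping_as_sum:
  "f = (\<Sum>t\<in>Poly_Mapping.keys f. Poly_Mapping.single t (Poly_Mapping.lookup f t))"
  by (rule poly_mapping_eqI)
    (simp add: lookup_sum lookup_single when_def in_keys_iff)

lemma poly_mapping_sum_induct:
  fixes f :: "'b \<Rightarrow>\<^sub>0 'c::comm_monoid_add"
  assumes "P 0" "\<And>f g. P f \<Longrightarrow> P g \<Longrightarrow> P (f + g)" "\<And>t c. P (Poly_Mapping.single t c)"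
  shows "P f"
proof -
  have "finite A \<Longrightarrow> P (\<Sum>t\<in>A. Poly_Mapping.single t (g t))" for A and g
    by (induction A rule: finite_induct) (auto intro: assms)
  then show ?thesis
    by (subst poly_mapping_as_sum) simp
qed

definition hlinear :: "('a::comm_ring_1 heis_sym \<Rightarrow> 'a heis_sym) \<Rightarrow> bool" where
  "hlinear T \<longleftrightarrow> (\<forall>f g. T (f + g) = T f + T g) \<and> (\<forall>c f. T (hconst c * f) = hconst c * T f)"

lemma hlinear_add: "hlinear T \<Longrightarrow> T (f + g) = T f + T g"
  and hlinear_scale: "hlinear T \<Longrightarrow> T (hconst c * f) = hconst c * T f"
  by (simp_all add: hlinear_def)

lemma hlinear_0: "hlinear T \<Longrightarrow> T 0 = 0"
  using hlinear_scale[of T 0 0] by simp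

lemma hlinear_uminus: "hlinear T \<Longrightarrow> T (- f) = - T f"
  using hlinear_scale[of T "- 1" f] by (simp add: hconst_uminus)

lemma hlinear_diff: "hlinear T \<Longrightarrow> T (f - g) = T f - T g"
  using hlinear_add[of T f "- g"] by (simp add: hlinear_uminus)

lemma hlinear_sum: "hlinear T \<Longrightarrow> T (sum g A) = (\<Sum>x\<in>A. T (g x))"
  by (induction A rule: infinite_finite_induct) (auto simp: hlinear_0 hlinear_add)

lemma hlinear_comp: "hlinear S \<Longrightarrow> hlinear T \<Longrightarrow> hlinear (\<lambda>f. S (T f))"
  by (simp add: hlinear_def)

lemma hlinear_mult_left: "hlinear T \<Longrightarrow> hlinear (\<lambda>f. g * T f)"
  by (simp add: hlinear_def algebra_simps)

lemma hlinear_sum_ops: "(\<And>x. x \<in> A \<Longrightarrow> hlinear (T x)) \<Longrightarrow> hlinear (\<lambda>f. \<Sum>x\<in>A. T x f)"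
  by (simp add: hlinear_def sum.distrib sum_distrib_left)

lemma hlinear_mult: "hlinear (\<lambda>f. g * f)"
  by (simp add: hlinear_def algebra_simps)

lemma hlinear_eqI:
  assumes "hlinear S" "hlinear T" and "\<And>t. S (Poly_Mapping.single t 1) = T (Poly_Mapping.single t 1)"
  shows "S f = T f"
proof (induction f rule: poly_mapping_sum_induct)
  case (3 t c)
  have "Poly_Mapping.single t c = hconst c * Poly_Mapping.single t 1"
    by (simp add: hconst_def mult_single)
  then show ?case
    using assms by (simp add: hlinear_scale)
qed (simp_all add: hlinear_0 hlinear_add assms)

lemma partial_deriv_superset:
  assumes "finite A" "Poly_Mapping.keys f \<subseteq> A"
  shows "partial_deriv k f = (\<Sum>t\<in>A. Poly_Mapping.single (t - Poly_Mapping.single k 1)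
       (of_nat (Poly_Mapping.lookup t k) * Poly_Mapping.lookup f t))"
  unfolding partial_deriv_def using assms
  by (intro sum.mono_neutral_left) (auto simp: in_keys_iff)

lemma partial_deriv_add: "partial_deriv k (f + g) = partial_deriv k f + partial_deriv k g"
proof -
  let ?A = "Poly_Mapping.keys f \<union> Poly_Mapping.keys g"
  have "partial_deriv k h = (\<Sum>t\<in>?A. Poly_Mapping.single (t - Poly_Mapping.single k 1)
       (of_nat (Poly_Mapping.lookup t k) * Poly_Mapping.lookup h t))" if "h \<in> {f, g, f + g}" for h
    using that Poly_Mapping.keys_add[of f g] by (intro partial_deriv_superset) auto
  then show ?thesis
    by (simp add: lookup_add algebra_simps sum.distrib single_add)
qed

lemma partial_deriv_single:
  "partial_deriv k (Poly_Mapping.single t c) =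
     Poly_Mapping.single (t - Poly_Mapping.single k 1) (of_nat (Poly_Mapping.lookup t k) * c)"
  by (subst partial_deriv_superset[of "{t}"]) auto

lemma partial_deriv_0: "partial_deriv k 0 = 0"
  by (simp add: partial_deriv_def)

lemma single_diff_add:
  assumes "Poly_Mapping.lookup s k \<noteq> (0::nat)"
  shows "s - Poly_Mapping.single k (Suc 0) + t = s + t - Poly_Mapping.single k (Suc 0)"
  using assms by (intro poly_mapping_eqI) (auto simp: lookup_add lookup_minus lookup_single when_def)

lemma partial_deriv_mult_single:
  "partial_deriv k (Poly_Mapping.single s a * Poly_Mapping.single t b) =
   partial_deriv k (Poly_Mapping.single s a) * Poly_Mapping.single t b +
   Poly_Mapping.single s a * partial_deriv k (Poly_Mapping.single t b)"
proof -
  \<comment> \<open>If k does not occur in s, truncated subtraction spoils the monomials, but then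
    both coefficients are 0.\<close>
  have "Poly_Mapping.single (s - Poly_Mapping.single k 1 + t) (of_nat (Poly_Mapping.lookup s k) * a * b) =
      Poly_Mapping.single (s + t - Poly_Mapping.single k 1) (of_nat (Poly_Mapping.lookup s k) * a * b)"
    by (cases "Poly_Mapping.lookup s k = 0") (simp_all add: single_diff_add)
  moreover have "Poly_Mapping.single (s + (t - Poly_Mapping.single k 1)) (a * (of_nat (Poly_Mapping.lookup t k) * b)) =
      Poly_Mapping.single (s + t - Poly_Mapping.single k 1) (a * (of_nat (Poly_Mapping.lookup t k) * b))"
    using single_diff_add[of t k s]
    by (cases "Poly_Mapping.lookup t k = 0") (simp_all add: add.commute)
  ultimately show ?thesis
    by (simp add: mult_single partial_deriv_single lookup_add single_add [symmetric] algebra_simps)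
qed

lemma partial_deriv_mult: "partial_deriv k (f * g) = partial_deriv k f * g + f * partial_deriv k g"
proof (induction f rule: poly_mapping_sum_induct)
  case (3 t c)
  show ?case
    by (induction g rule: poly_mapping_sum_induct)
      (simp_all add: partial_deriv_0 partial_deriv_add partial_deriv_mult_single algebra_simps)
qed (simp_all add: partial_deriv_0 partial_deriv_add algebra_simps)

lemma hderiv_mult: "hderiv n (f * g) = hderiv n f * g + f * hderiv n g"
  by (simp add: hderiv_def partial_deriv_mult)

lemma hderiv_hconst [simp]: "hderiv n (hconst c) = 0"
  by (simp add: hderiv_def hconst_def partial_deriv_single)

lemma hlinear_hderiv: "hlinear (hderiv n)"
  by (simp add: hlinear_def hderiv_mult) (simp add: hderiv_def partial_deriv_add)

lemma hderiv_hvar: "n > 0 \<Longrightarrow> m > 0 \<Longrightarrow> hderiv n (hvar m) = (if n = m then 1 else 0)"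
  by (auto simp: hderiv_def hvar_def partial_deriv_single lookup_single when_def)

lemma hderiv_commute: "hderiv m (hderiv n f) = hderiv n (hderiv m f)"
proof (induction f rule: poly_mapping_sum_induct)
  case (3 t c)
  have "t - Poly_Mapping.single a 1 - Poly_Mapping.single b 1 =
      t - Poly_Mapping.single b (1::nat) - Poly_Mapping.single a 1" for a b
    by (rule poly_mapping_eqI) (simp add: lookup_minus)
  then show ?case
    by (cases "m - 1 = n - 1")
      (auto simp: hderiv_def partial_deriv_single lookup_minus lookup_single when_def mult_ac)
qed (simp_all add: hlinear_0 hlinear_add hlinear_hderiv)

section \<open>Exponentials of commuting operators\<close>

text \<open>The counterpart of \<open>exp_coeff\<close> on one lattice component: the coefficient of
  w^r in exp (sum T_n w^n).\<close>

definition hexp :: "(nat \<Rightarrow> 'a::field_char_0 heis_sym \<Rightarrow> 'a heis_sym) \<Rightarrow> nat \<Rightarrow> 'a heis_sym \<Rightarrow> 'a heis_sym"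
  where "hexp T r f = (\<Sum>ns | 0 \<notin> set ns \<and> sum_list ns = r.
     hconst (inverse (fact (length ns))) * foldr T ns f)"

lemma length_le_sum_list: "0 \<notin> set ns \<Longrightarrow> length ns \<le> sum_list (ns :: nat list)"
  by (induction ns) (auto simp: Suc_le_eq)

lemma finite_compositions: "finite {ns. 0 \<notin> set ns \<and> sum_list ns = (r::nat)}"
proof (rule finite_subset)
  show "{ns. 0 \<notin> set ns \<and> sum_list ns = r} \<subseteq> {ns. set ns \<subseteq> {..r} \<and> length ns \<le> r}"
    using length_le_sum_list member_le_sum_list by fastforce
qed (simp add: finite_lists_length_le)

lemma hexp_0 [simp]: "hexp T 0 f = f"
proof -
  have "{ns. 0 \<notin> set ns \<and> sum_list ns = (0::nat)} = {[]}"
  proof -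
    have "ns = []" if "0 \<notin> set ns" "sum_list ns = (0::nat)" for ns
      using length_le_sum_list[of ns] that by simp
    then show ?thesis
      by auto
  qed
  then show ?thesis
    by (simp add: hexp_def)
qed

locale commuting_ops =
  fixes T :: "nat \<Rightarrow> 'a::field_char_0 heis_sym \<Rightarrow> 'a heis_sym"
  assumes lin: "hlinear (T n)"
    and commute: "T m (T n f) = T n (T m f)"
begin

lemma foldr_commute: "foldr T ns (T n f) = T n (foldr T ns f)"
  by (induction ns) (auto simp: commute)

lemma foldr_rotate: "foldr T (rotate k ns) f = foldr T ns f"
proof (induction k arbitrary: ns)
  case (Suc k)
  have "foldr T (rotate1 xs) f = foldr T xs f" for xs
    by (cases xs) (simp_all add: foldr_commute)
  then show ?case
    using Suc by (simp add: rotate_Suc)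
qed simp

lemma foldr_linear: "hlinear (foldr T ns)"
proof (induction ns)
  case Nil
  show ?case by (simp add: hlinear_def)
next
  case (Cons n ns)
  have "foldr T (n # ns) = (\<lambda>f. T n (foldr T ns f))" by (auto simp: fun_eq_iff)
  then show ?case using Cons lin by (simp add: hlinear_comp)
qed

lemma hexp_linear: "hlinear (hexp T r)"
proof -
  have "hlinear (\<lambda>f. \<Sum>ns | 0 \<notin> set ns \<and> sum_list ns = r.
     hconst (inverse (fact (length ns))) * foldr T ns f)"
    by (intro hlinear_sum_ops hlinear_mult_left foldr_linear)
  then show ?thesis
    by (simp add: hexp_def[abs_def])
qed

text \<open>Rotation permutes the compositions of r of length k and brings part i to the front; the
  product of operators is unchanged because its factors commute.\<close>

lemma sum_compositions_first:
  assumes "i < k"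
  shows "(\<Sum>ns | 0 \<notin> set ns \<and> sum_list ns = r \<and> length ns = k. hconst (of_nat (ns ! i)) * foldr T ns f) =
         (\<Sum>ns | 0 \<notin> set ns \<and> sum_list ns = r \<and> length ns = k. hconst (of_nat (hd ns)) * foldr T ns f)"
proof (rule sum.reindex_bij_witness[of _ "rotate (k - i)" "rotate i"])
  have "sum_list (rotate1 xs) = sum_list xs" for xs :: "nat list"
    by (cases xs) auto
  then have [simp]: "sum_list (rotate n xs) = sum_list xs" for n and xs :: "nat list"
    by (induction n) (auto simp: rotate_Suc)
  fix ns assume ns: "ns \<in> {ns. 0 \<notin> set ns \<and> sum_list ns = r \<and> length ns = k}"
  show "rotate (k - i) (rotate i ns) = ns" "rotate i (rotate (k - i) ns) = ns"
    using ns assms by (auto simp: rotate_rotate rotate_id)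
  show "rotate i ns \<in> {ns. 0 \<notin> set ns \<and> sum_list ns = r \<and> length ns = k}"
    "rotate (k - i) ns \<in> {ns. 0 \<notin> set ns \<and> sum_list ns = r \<and> length ns = k}"
    using ns by auto
  show "hconst (of_nat (hd (rotate i ns))) * foldr T (rotate i ns) f = hconst (of_nat (ns ! i)) * foldr T ns f"
    using ns assms by (cases "ns = []") (auto simp: foldr_rotate hd_rotate_conv_nth)
qed

text \<open>r is the sum of the k parts, and by rotation each part contributes as much as the
  first.\<close>

lemma sum_compositions_length:
  assumes "k > 0"
  shows "(\<Sum>ns | 0 \<notin> set ns \<and> sum_list ns = r \<and> length ns = k. hconst (of_nat r) * foldr T ns f) =
      (\<Sum>ns | 0 \<notin> set ns \<and> sum_list ns = r \<and> length ns = k. hconst (of_nat (k * hd ns)) * foldr T ns f)"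
proof -
  let ?A = "{ns. 0 \<notin> set ns \<and> sum_list ns = r \<and> length ns = k}"
  have "(\<Sum>ns\<in>?A. hconst (of_nat r) * foldr T ns f) =
      (\<Sum>ns\<in>?A. \<Sum>i<k. hconst (of_nat (ns ! i)) * foldr T ns f)"
    by (rule sum.cong)
      (auto simp: sum_list_sum_nth hconst_sum sum_distrib_right atLeast0LessThan)
  also have "\<dots> = (\<Sum>i<k. \<Sum>ns\<in>?A. hconst (of_nat (ns ! i)) * foldr T ns f)"
    by (rule sum.swap)
  also have "\<dots> = (\<Sum>i<k. \<Sum>ns\<in>?A. hconst (of_nat (hd ns)) * foldr T ns f)"
    by (intro sum.cong refl sum_compositions_first) auto
  also have "\<dots> = (\<Sum>ns\<in>?A. hconst (of_nat (k * hd ns)) * foldr T ns f)"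
    by (simp add: sum_distrib_left hconst_mult mult.assoc flip: hconst_def single_of_nat)
  finally show ?thesis .
qed

text \<open>The coefficient form of w d/dw exp T(w) = (w T'(w)) exp T(w), which holds because the
  operators commute.\<close>

lemma hexp_newton:
  "hconst (of_nat r) * hexp T r f = (\<Sum>n = 1..r. hconst (of_nat n) * T n (hexp T (r - n) f))"
proof (cases "r = 0")
  case False
  let ?C = "\<lambda>r. {ns. 0 \<notin> set ns \<and> sum_list ns = (r::nat)}"
  let ?A = "\<lambda>k. {ns. 0 \<notin> set ns \<and> sum_list ns = r \<and> length ns = (k::nat)}"
  have len: "ns \<in> ?C r \<Longrightarrow> length ns \<in> {1..r}" for ns
    using length_le_sum_list[of ns] False by (cases ns) auto
  have group: "(\<Sum>ns\<in>?C r. g ns) = (\<Sum>k = 1..r. \<Sum>ns\<in>?A k. g ns)" for g :: "nat list \<Rightarrow> 'a heis_sym"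
  proof -
    have "(\<Sum>k = 1..r. \<Sum>ns\<in>?A k. g ns) = (\<Sum>k = 1..r. \<Sum>ns | ns \<in> ?C r \<and> length ns = k. g ns)"
      by (intro sum.cong) auto
    also have "\<dots> = (\<Sum>ns\<in>?C r. g ns)"
      using len by (intro sum.group finite_compositions) auto
    finally show ?thesis by simp
  qed
  have "hconst (of_nat r) * hexp T r f =
      (\<Sum>k = 1..r. hconst (inverse (fact k)) * (\<Sum>ns\<in>?A k. hconst (of_nat r) * foldr T ns f))"
    unfolding hexp_def group sum_distrib_left
    by (intro sum.cong) (auto simp: mult_ac)
  also have "\<dots> = (\<Sum>k = 1..r. hconst (inverse (fact k)) * (\<Sum>ns\<in>?A k. hconst (of_nat (k * hd ns)) * foldr T ns f))"
    by (intro sum.cong refl arg_cong[where f = "\<lambda>x. _ * x"] sum_compositions_length) auto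
  \<comment> \<open>k / k! = 1 / (k - 1)! is the weight that belongs to the composition without its
    first part.\<close>
  also have "\<dots> = (\<Sum>k = 1..r. \<Sum>ns\<in>?A k. hconst (of_nat (hd ns) * inverse (fact (length ns - 1))) * foldr T ns f)"
    unfolding sum_distrib_left
  proof (intro sum.cong refl)
    fix k ns assume "k \<in> {1..r}" "ns \<in> ?A k"
    then have "inverse (fact k) * of_nat (k * hd ns) = (of_nat (hd ns) * inverse (fact (length ns - 1)) :: 'a)"
      by (cases k) (simp_all add: divide_simps del: of_nat_Suc, simp add: algebra_simps)
    then show "hconst (inverse (fact k)) * (hconst (of_nat (k * hd ns)) * foldr T ns f) =
        hconst (of_nat (hd ns) * inverse (fact (length ns - 1))) * foldr T ns f"
      by (simp only: hconst_mult_left)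
  qed
  also have "\<dots> = (\<Sum>ns\<in>?C r. hconst (of_nat (hd ns) * inverse (fact (length ns - 1))) * foldr T ns f)"
    by (simp only: group)
  \<comment> \<open>A composition of r is its first part n followed by a composition of r -
    n.\<close>
  also have "\<dots> = (\<Sum>(n, ns)\<in>(SIGMA n:{1..r}. ?C (r - n)).
      hconst (of_nat n * inverse (fact (length ns))) * T n (foldr T ns f))"
  proof (rule sum.reindex_bij_witness[of _ "\<lambda>(n, ns). n # ns" "\<lambda>ns. (hd ns, tl ns)"], goal_cases)
    case (1 ns)
    then show ?case using len[of ns] by (cases ns) auto
  next
    case (2 ns)
    then show ?case using len[of ns] by (cases ns) auto
  next
    case (5 ns)
    then show ?case using len[of ns] by (cases ns) auto
  qed auto
  also have "\<dots> = (\<Sum>n = 1..r. \<Sum>ns\<in>?C (r - n). hconst (of_nat n * inverse (fact (length ns))) * T n (foldr T ns f))"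
    by (rule sum.Sigma [symmetric]) (auto intro: finite_compositions)
  also have "\<dots> = (\<Sum>n = 1..r. hconst (of_nat n) * T n (hexp T (r - n) f))"
    unfolding hexp_def
    by (simp add: hlinear_sum lin hlinear_scale sum_distrib_left hconst_mult_left)
  finally show ?thesis .
qed simp

text \<open>Division by r is possible in characteristic 0, so the recursion determines every
  coefficient from the first one. The laws for products, sums and scaling below are proved through
  this uniqueness.\<close>

lemma hexp_unique:
  assumes "G 0 = f"
    and "\<And>r. r > 0 \<Longrightarrow> hconst (of_nat r) * G r = (\<Sum>n = 1..r. hconst (of_nat n) * T n (G (r - n)))"
  shows "G r = hexp T r f"
proof (induction r rule: less_induct)
  case (less r)
  show ?case
  proof (cases "r = 0")
    case False
    have "hconst (of_nat r) * G r = hconst (of_nat r) * hexp T r f"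
      unfolding hexp_newton using False less by (simp add: assms(2))
    then show ?thesis
      by (rule hconst_cancel[rotated]) (use False in simp)
  qed (simp add: assms(1))
qed

end

text \<open>The Leibniz rule for w d/dw: r splits as i + (r - i), the recursions in the two indices
  produce \<open>X\<close> and \<open>Y\<close>, and \<open>T\<close> acts as their sum. In its uses
  \<open>b i j\<close> is a product or composition of two exponential coefficients of degrees i and
  j.\<close>

lemma newton_convolution:
  fixes b :: "nat \<Rightarrow> nat \<Rightarrow> 'a::field_char_0 heis_sym"
  assumes X: "\<And>i j. hconst (of_nat i) * b i j = (\<Sum>n = 1..i. hconst (of_nat n) * X n (i - n) j)"
    and Y: "\<And>i j. hconst (of_nat j) * b i j = (\<Sum>n = 1..j. hconst (of_nat n) * Y n i (j - n))"
    and T: "\<And>n i j. n > 0 \<Longrightarrow> T n (b i j) = X n i j + Y n i j"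
    and lin: "\<And>n. hlinear (T n)"
  shows "hconst (of_nat r) * (\<Sum>i\<le>r. b i (r - i)) =
    (\<Sum>n = 1..r. hconst (of_nat n) * T n (\<Sum>i\<le>r - n. b i (r - n - i)))"
proof -
  have "hconst (of_nat r) * (\<Sum>i\<le>r. b i (r - i)) =
      (\<Sum>i\<le>r. hconst (of_nat i) * b i (r - i) + hconst (of_nat (r - i)) * b i (r - i))"
    unfolding sum_distrib_left
    by (intro sum.cong) (auto simp: hconst_add [symmetric] of_nat_diff simp flip: distrib_right)
  also have "\<dots> = (\<Sum>i\<le>r. \<Sum>n = 1..i. hconst (of_nat n) * X n (i - n) (r - i)) +
      (\<Sum>i\<le>r. \<Sum>n = 1..r - i. hconst (of_nat n) * Y n i (r - i - n))"
    by (simp only: X Y sum.distrib)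
  also have "(\<Sum>i\<le>r. \<Sum>n = 1..i. hconst (of_nat n) * X n (i - n) (r - i)) =
      (\<Sum>n = 1..r. \<Sum>i\<le>r - n. hconst (of_nat n) * X n i (r - n - i))"
    apply (subst sum.Sigma, simp, simp)
    apply (subst sum.Sigma, simp, simp)
    by (rule sum.reindex_bij_witness[of _ "\<lambda>(n, i). (i + n, n)" "\<lambda>(i, n). (n, i - n)"]) auto
  also have "(\<Sum>i\<le>r. \<Sum>n = 1..r - i. hconst (of_nat n) * Y n i (r - i - n)) =
      (\<Sum>n = 1..r. \<Sum>i\<le>r - n. hconst (of_nat n) * Y n i (r - n - i))"
    apply (subst sum.Sigma, simp, simp)
    apply (subst sum.Sigma, simp, simp)
    by (rule sum.reindex_bij_witness[of _ "\<lambda>(n, i). (i, n)" "\<lambda>(i, n). (n, i)"])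
      (auto simp: diff_commute add.commute)
  also have "(\<Sum>n = 1..r. \<Sum>i\<le>r - n. hconst (of_nat n) * X n i (r - n - i)) +
      (\<Sum>n = 1..r. \<Sum>i\<le>r - n. hconst (of_nat n) * Y n i (r - n - i)) =
      (\<Sum>n = 1..r. hconst (of_nat n) * T n (\<Sum>i\<le>r - n. b i (r - n - i)))"
    by (simp add: hlinear_sum lin T sum_distrib_left sum.distrib distrib_left)
  finally show ?thesis .
qed

lemma hexp_cong:
  assumes "\<And>n f. n > 0 \<Longrightarrow> T n f = U n f"
  shows "hexp T r f = hexp U r f"
proof -
  have "foldr T ns f = foldr U ns f" if "0 \<notin> set ns" for ns
    using that by (induction ns) (auto simp: assms)
  then show ?thesis
    by (simp add: hexp_def)
qed

lemma hexp_swap: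
  assumes "hlinear S" and "\<And>n f. S (T n f) = T n (S f)"
  shows "S (hexp T r f) = hexp T r (S f)"
proof -
  have "S (foldr T ns f) = foldr T ns (S f)" for ns
    by (induction ns) (auto simp: assms)
  then show ?thesis
    by (simp add: hexp_def hlinear_sum[OF assms(1)] hlinear_scale[OF assms(1)])
qed

section \<open>Scalar, creation and annihilation exponentials\<close>

definition sexp :: "(nat \<Rightarrow> 'a::field_char_0) \<Rightarrow> nat \<Rightarrow> 'a" where
  "sexp c r = (\<Sum>ns | 0 \<notin> set ns \<and> sum_list ns = r. inverse (fact (length ns)) * prod_list (map c ns))"

text \<open>Coefficients of negative index are 0, so that degrees can be shifted freely in later
  sums.\<close>

definition cre :: "(nat \<Rightarrow> 'a::field_char_0) \<Rightarrow> int \<Rightarrow> 'a heis_sym" where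
  "cre a r = (if r < 0 then 0 else hexp (\<lambda>n f. hconst (a n) * (hvar n * f)) (nat r) 1)"

definition ann :: "(nat \<Rightarrow> 'a::field_char_0) \<Rightarrow> nat \<Rightarrow> 'a heis_sym \<Rightarrow> 'a heis_sym" where
  "ann b = hexp (\<lambda>n f. hconst (b n) * hderiv n f)"

lemma commuting_mult: "commuting_ops (\<lambda>n f. hconst (a n) * (hvar n * f))"
  by unfold_locales (auto simp: hlinear_def algebra_simps)

lemma commuting_scalar: "commuting_ops (\<lambda>n f. hconst (a n) * f)"
  by unfold_locales (auto simp: hlinear_def algebra_simps)

lemma commuting_deriv: "commuting_ops (\<lambda>n f. hconst (b n) * hderiv n f)"
proof
  fix m n f
  show "hlinear (\<lambda>f. hconst (b n) * hderiv n f)"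
    by (intro hlinear_mult_left hlinear_hderiv)
  show "hconst (b m) * hderiv m (hconst (b n) * hderiv n f) =
       hconst (b n) * hderiv n (hconst (b m) * hderiv m f)"
    by (simp add: hlinear_scale hlinear_hderiv mult_ac hderiv_commute[of m n])
qed

lemma hconst_eq_iff: "hconst a = hconst b \<longleftrightarrow> a = b"
  by (simp add: hconst_def inj_eq)

lemma hconst_sexp: "hconst (sexp c r) = hexp (\<lambda>n f. hconst (c n) * f) r 1"
proof -
  have "hconst (prod_list (map c ns)) = foldr (\<lambda>n f. hconst (c n) * f) ns 1" for ns
    by (induction ns) (auto simp: hconst_mult)
  then show ?thesis
    by (simp add: sexp_def hexp_def hconst_sum hconst_mult)
qed

lemma sexp_0 [simp]: "sexp c 0 = 1"
  using hconst_sexp[of c 0] by (simp add: hconst_eq_iff flip: hconst_1)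

lemma sexp_newton: "of_nat r * sexp c r = (\<Sum>n = 1..r. of_nat n * c n * sexp c (r - n))"
proof -
  have "hconst (of_nat r * sexp c r) = hconst (\<Sum>n = 1..r. of_nat n * c n * sexp c (r - n))"
    using commuting_ops.hexp_newton[OF commuting_scalar, of r c 1]
    by (simp add: hconst_sexp hconst_sum hconst_mult mult.assoc)
  then show ?thesis
    by (simp add: hconst_eq_iff)
qed

lemma sexp_unique:
  assumes "g 0 = 1" and "\<And>r. r > 0 \<Longrightarrow> of_nat r * g r = (\<Sum>n = 1..r. of_nat n * c n * g (r - n))"
  shows "sexp c r = g r"
proof (induction r rule: less_induct)
  case (less r)
  have "of_nat r * sexp c r = of_nat r * g r"
    using less by (cases "r = 0") (auto simp: sexp_newton assms(2) intro!: sum.cong)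
  then show ?case
    using assms(1) by (cases "r = 0") auto
qed

lemma ann_0 [simp]: "ann b 0 f = f"
  by (simp add: ann_def)

lemma ann_linear: "hlinear (ann b s)"
  unfolding ann_def by (rule commuting_ops.hexp_linear[OF commuting_deriv])

lemma ann_newton:
  "hconst (of_nat r) * ann b r f = (\<Sum>n = 1..r. hconst (of_nat n) * (hconst (b n) * hderiv n (ann b (r - n) f)))"
  unfolding ann_def by (rule commuting_ops.hexp_newton[OF commuting_deriv])

lemma ann_unique:
  assumes "G 0 = f"
    and "\<And>r. r > 0 \<Longrightarrow> hconst (of_nat r) * G r = (\<Sum>n = 1..r. hconst (of_nat n) * (hconst (b n) * hderiv n (G (r - n))))"
  shows "ann b r f = G r"
  unfolding ann_def using commuting_ops.hexp_unique[OF commuting_deriv, of G f b r] assms by simp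

lemma ann_cong: "(\<And>n. n > 0 \<Longrightarrow> b n = b' n) \<Longrightarrow> ann b s f = ann b' s f"
  unfolding ann_def by (rule hexp_cong) simp

text \<open>Each \<open>hderiv n\<close> is a derivation, so the exponential of their series is
  multiplicative. \<open>X\<close> and \<open>Y\<close> let the derivation act on the left and on
  the right factor.\<close>

lemma ann_mult: "ann b s (f * g) = (\<Sum>i\<le>s. ann b i f * ann b (s - i) g)"
proof (rule ann_unique)
  fix r :: nat
  show "hconst (of_nat r) * (\<Sum>i\<le>r. ann b i f * ann b (r - i) g) =
    (\<Sum>n = 1..r. hconst (of_nat n) * (hconst (b n) * hderiv n (\<Sum>i\<le>r - n. ann b i f * ann b (r - n - i) g)))"
  proof (rule newton_convolution[where T = "\<lambda>n f. hconst (b n) * hderiv n f" and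
        X = "\<lambda>n i j. hconst (b n) * hderiv n (ann b i f) * ann b j g" and
        Y = "\<lambda>n i j. ann b i f * (hconst (b n) * hderiv n (ann b j g))"])
    fix i j :: nat
    show "hconst (of_nat i) * (ann b i f * ann b j g) =
        (\<Sum>n = 1..i. hconst (of_nat n) * (hconst (b n) * hderiv n (ann b (i - n) f) * ann b j g))"
      by (simp only: mult.assoc[symmetric] ann_newton sum_distrib_right)
    show "hconst (of_nat j) * (ann b i f * ann b j g) =
        (\<Sum>n = 1..j. hconst (of_nat n) * (ann b i f * (hconst (b n) * hderiv n (ann b (j - n) g))))"
      by (subst mult.left_commute, subst ann_newton, simp only: sum_distrib_left mult_ac)
  qed (auto simp: hderiv_mult algebra_simps intro!: hlinear_mult_left hlinear_hderiv)
qed simp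

lemma ann_hconst: "ann b s (hconst c) = (if s = 0 then hconst c else 0)"
  by (rule ann_unique) (auto intro!: sum.neutral simp: hlinear_0 hlinear_hderiv)

lemma ann_1: "ann b s 1 = (if s = 0 then 1 else 0)"
  using ann_hconst[of b s 1] by simp

text \<open>exp (A + B) = exp A exp B for commuting A and B.\<close>

lemma ann_add: "ann (\<lambda>n. b n + b' n) s f = (\<Sum>i\<le>s. ann b i (ann b' (s - i) f))"
proof (rule ann_unique)
  fix r :: nat
  let ?T = "\<lambda>n f. hconst (b n + b' n) * hderiv n f"
  show "hconst (of_nat r) * (\<Sum>i\<le>r. ann b i (ann b' (r - i) f)) =
    (\<Sum>n = 1..r. hconst (of_nat n) * ?T n (\<Sum>i\<le>r - n. ann b i (ann b' (r - n - i) f)))"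
  proof (rule newton_convolution[where T = ?T and
        X = "\<lambda>n i j. hconst (b n) * hderiv n (ann b i (ann b' j f))" and
        Y = "\<lambda>n i j. ann b i (hconst (b' n) * hderiv n (ann b' j f))"])
    fix i j :: nat
    show "hconst (of_nat i) * (ann b i (ann b' j f)) =
        (\<Sum>n = 1..i. hconst (of_nat n) * (hconst (b n) * hderiv n (ann b (i - n) (ann b' j f))))"
      by (rule ann_newton)
    show "hconst (of_nat j) * (ann b i (ann b' j f)) =
        (\<Sum>n = 1..j. hconst (of_nat n) * (ann b i (hconst (b' n) * hderiv n (ann b' (j - n) f))))"
      using arg_cong[OF ann_newton, of "ann b i" j b' f]
      by (simp add: hlinear_sum ann_linear hlinear_scale)
    have "ann b i (hderiv n g) = hderiv n (ann b i g)" for n g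
      unfolding ann_def
      by (rule hexp_swap[symmetric])
        (auto simp: hlinear_hderiv hlinear_scale intro: hderiv_commute arg_cong)
    then show "?T n (ann b i (ann b' j f)) = hconst (b n) * hderiv n (ann b i (ann b' j f)) +
        ann b i (hconst (b' n) * hderiv n (ann b' j f))" for n
      by (simp add: hlinear_scale ann_linear hconst_add distrib_right)
  qed (auto intro!: hlinear_mult_left hlinear_hderiv)
qed simp

lemma ann_hderiv: "ann b s (hderiv n f) = hderiv n (ann b s f)"
  unfolding ann_def
  by (rule hexp_swap[symmetric])
    (auto simp: hlinear_hderiv hlinear_scale intro: hderiv_commute arg_cong)

lemma ann_commute: "ann b s (ann b' t f) = ann b' t (ann b s f)"
  unfolding ann_def[of b']
  by (rule hexp_swap) (simp_all add: ann_linear hlinear_scale ann_hderiv)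

lemma ann_scale: "ann (\<lambda>n. u ^ n * b n) s f = hconst (u ^ s) * ann b s f"
proof (rule ann_unique)
  fix r :: nat
  have "hconst (of_nat r) * (hconst (u ^ r) * ann b r f) =
      hconst (u ^ r) * (\<Sum>n = 1..r. hconst (of_nat n) * (hconst (b n) * hderiv n (ann b (r - n) f)))"
    by (simp only: ann_newton[symmetric] mult.left_commute)
  also have "\<dots> = (\<Sum>n = 1..r. hconst (of_nat n) * (hconst (u ^ n * b n) * hderiv n (hconst (u ^ (r - n)) * ann b (r - n) f)))"
    unfolding sum_distrib_left
  proof (intro sum.cong refl)
    fix n assume "n \<in> {1..r}"
    then have "u ^ r = u ^ n * u ^ (r - n)"
      by (simp flip: power_add)
    then show "hconst (u ^ r) * (hconst (of_nat n) * (hconst (b n) * hderiv n (ann b (r - n) f))) =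
        hconst (of_nat n) * (hconst (u ^ n * b n) * hderiv n (hconst (u ^ (r - n)) * ann b (r - n) f))"
      by (simp only: hlinear_scale[OF hlinear_hderiv] hconst_mult) (simp only: mult_ac)
  qed
  finally show "hconst (of_nat r) * (hconst (u ^ r) * ann b r f) = \<dots>" .
qed simp

lemma ann_zero: "ann (\<lambda>_. 0) s f = (if s = 0 then f else 0)"
  by (rule ann_unique) auto

lemma cre_neg: "r < 0 \<Longrightarrow> cre a r = 0"
  by (simp add: cre_def)

lemma cre_0 [simp]: "cre a 0 = 1"
  by (simp add: cre_def)

text \<open>The upper limit is free because terms with n > r contain coefficients of negative index.
  One range of summation therefore serves r and r - n alike, as needed in
  \<open>hderiv_cre\<close>.\<close>

lemma cre_newton:
  assumes "r \<le> int N"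
  shows "hconst (of_int r) * cre a r = (\<Sum>n = 1..N. hconst (of_nat n) * (hconst (a n) * (hvar n * cre a (r - int n))))"
proof (cases "r < 0")
  case False
  then obtain k where k: "r = int k"
    by (metis nat_0_le not_less)
  have "hconst (of_int r) * cre a r = (\<Sum>n = 1..k. hconst (of_nat n) * (hconst (a n) * (hvar n * cre a (r - int n))))"
    using commuting_ops.hexp_newton[OF commuting_mult, of k a 1]
    by (auto simp: k cre_def nat_diff_distrib' intro!: sum.cong)
  also have "\<dots> = (\<Sum>n = 1..N. hconst (of_nat n) * (hconst (a n) * (hvar n * cre a (r - int n))))"
    using assms k by (intro sum.mono_neutral_left) (auto simp: cre_neg)
  finally show ?thesis .
qed (simp add: cre_neg)

lemma cre_newton_nat:
  "hconst (of_nat r) * cre a (int r) = (\<Sum>n = 1..r. hconst (of_nat n) * (hconst (a n) * (hvar n * cre a (int (r - n)))))"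
  using cre_newton[of "int r" r a] by (auto simp: of_nat_diff intro!: sum.cong)

lemma cre_unique:
  assumes "G 0 = 1" and "\<And>r. r < 0 \<Longrightarrow> G r = 0"
    and "\<And>r. r > 0 \<Longrightarrow> hconst (of_nat r) * G (int r) = (\<Sum>n = 1..r. hconst (of_nat n) * (hconst (a n) * (hvar n * G (int r - int n))))"
  shows "cre a r = G r"
proof (cases "r < 0")
  case False
  have "G (int (nat r)) = hexp (\<lambda>n f. hconst (a n) * (hvar n * f)) (nat r) 1"
    by (rule commuting_ops.hexp_unique[OF commuting_mult])
      (use assms in \<open>auto simp: of_nat_diff intro!: sum.cong\<close>)
  then show ?thesis
    using False by (simp add: cre_def)
qed (simp add: cre_neg assms)

lemma cre_cong: "(\<And>n. n > 0 \<Longrightarrow> a n = a' n) \<Longrightarrow> cre a r = cre a' r"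
  unfolding cre_def by (auto intro!: hexp_cong)

text \<open>Multiplication operators commute with multiplication by f, so their exponential
  multiplies by its value at 1.\<close>

lemma hexp_mult: "hexp (\<lambda>n f. hconst (a n) * (hvar n * f)) r f = cre a (int r) * f"
  by (rule commuting_ops.hexp_unique[OF commuting_mult, symmetric])
    (simp, simp only: mult.assoc[symmetric] cre_newton_nat sum_distrib_right)

lemma cre_scale: "cre (\<lambda>n. u ^ n * a n) r = hconst (u ^ nat r) * cre a r"
proof (rule cre_unique)
  fix r :: nat
  have "hconst (of_nat r) * (hconst (u ^ nat (int r)) * cre a (int r)) =
      hconst (u ^ r) * (\<Sum>n = 1..r. hconst (of_nat n) * (hconst (a n) * (hvar n * cre a (int r - int n))))"
    using cre_newton[of "int r" r a] by (simp add: mult_ac)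
  also have "\<dots> = (\<Sum>n = 1..r. hconst (of_nat n) * (hconst (u ^ n * a n) * (hvar n * (hconst (u ^ nat (int r - int n)) * cre a (int r - int n)))))"
    unfolding sum_distrib_left
  proof (intro sum.cong refl)
    fix n assume "n \<in> {1..r}"
    then have "u ^ r = u ^ n * u ^ nat (int r - int n)"
      by (simp add: nat_diff_distrib' flip: power_add)
    then show "hconst (u ^ r) * (hconst (of_nat n) * (hconst (a n) * (hvar n * cre a (int r - int n)))) =
        hconst (of_nat n) * (hconst (u ^ n * a n) * (hvar n * (hconst (u ^ nat (int r - int n)) * cre a (int r - int n))))"
      by (simp add: hconst_mult mult_ac)
  qed
  finally show "hconst (of_nat r) * (hconst (u ^ nat (int r)) * cre a (int r)) = \<dots>" .
qed (simp_all add: cre_neg)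

lemma cre_zero: "cre (\<lambda>_. 0) r = (if r = 0 then 1 else 0)"
  by (rule cre_unique) auto

lemma cre_add:
  assumes "r \<le> int N"
  shows "cre (\<lambda>n. a n + a' n) r = (\<Sum>i\<le>N. cre a (int i) * cre a' (r - int i))"
proof -
  let ?G = "\<lambda>r. \<Sum>i\<le>nat r. cre a (int i) * cre a' (r - int i)"
  have "cre (\<lambda>n. a n + a' n) r = ?G r"
  proof (rule cre_unique)
    fix r :: nat
    let ?T = "\<lambda>n f. hconst (a n + a' n) * (hvar n * f)"
    have "hconst (of_nat r) * (\<Sum>i\<le>r. cre a (int i) * cre a' (int (r - i))) =
        (\<Sum>n = 1..r. hconst (of_nat n) * ?T n (\<Sum>i\<le>r - n. cre a (int i) * cre a' (int (r - n - i))))"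
    proof (rule newton_convolution[where T = ?T and
          X = "\<lambda>n i j. hconst (a n) * (hvar n * cre a (int i)) * cre a' (int j)" and
          Y = "\<lambda>n i j. cre a (int i) * (hconst (a' n) * (hvar n * cre a' (int j)))"])
      fix i j :: nat
      show "hconst (of_nat i) * (cre a (int i) * cre a' (int j)) =
          (\<Sum>n = 1..i. hconst (of_nat n) * (hconst (a n) * (hvar n * cre a (int (i - n))) * cre a' (int j)))"
        using cre_newton_nat[of i a]
        by (simp only: mult.assoc[symmetric] sum_distrib_right)
      show "hconst (of_nat j) * (cre a (int i) * cre a' (int j)) =
          (\<Sum>n = 1..j. hconst (of_nat n) * (cre a (int i) * (hconst (a' n) * (hvar n * cre a' (int (j - n))))))"
        by (subst mult.left_commute, subst cre_newton_nat, simp only: sum_distrib_left mult_ac)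
    qed (auto simp: hconst_add hlinear_def algebra_simps)
    also have "(\<Sum>i\<le>r. cre a (int i) * cre a' (int (r - i))) = ?G (int r)"
      by (auto simp: of_nat_diff intro!: sum.cong)
    also have "(\<Sum>n = 1..r. hconst (of_nat n) * ?T n (\<Sum>i\<le>r - n. cre a (int i) * cre a' (int (r - n - i)))) =
        (\<Sum>n = 1..r. hconst (of_nat n) * ?T n (?G (int r - int n)))"
    proof (rule sum.cong[OF refl])
      fix n assume n: "n \<in> {1..r}"
      have "(\<Sum>i\<le>r - n. cre a (int i) * cre a' (int (r - n - i))) = ?G (int r - int n)"
        using n by (intro sum.cong) (auto simp: of_nat_diff nat_diff_distrib' diff_diff_eq)
      then show "hconst (of_nat n) * ?T n (\<Sum>i\<le>r - n. cre a (int i) * cre a' (int (r - n - i))) =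
          hconst (of_nat n) * ?T n (?G (int r - int n))"
        by (simp only:)
    qed
    finally show "hconst (of_nat r) * ?G (int r) = (\<Sum>n = 1..r. hconst (of_nat n) * ?T n (?G (int r - int n)))" .
  qed (simp_all add: cre_neg)
  also have "\<dots> = (\<Sum>i\<le>N. cre a (int i) * cre a' (r - int i))"
    using assms by (intro sum.mono_neutral_left) (auto simp: cre_neg)
  finally show ?thesis .
qed

text \<open>The creation exponential is an eigenvector of every derivation, with eigenvalue a_n
  w^n.\<close>

lemma hderiv_cre:
  assumes "n > 0"
  shows "hderiv n (cre a r) = hconst (a n) * cre a (r - int n)"
proof (cases "r < 0")
  case False
  then obtain k where k: "r = int k"
    by (metis nat_0_le not_less)
  have "hderiv n (cre a (int k)) = hconst (a n) * cre a (int k - int n)"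
  proof (induction k rule: less_induct)
    case (less k)
    show ?case
    proof (cases "k = 0")
      case True
      then show ?thesis
        using assms hderiv_hconst[of n "1 :: 'a"] by (simp add: cre_neg)
    next
      case False
      have "hconst (of_nat k) * hderiv n (cre a (int k)) = hderiv n (hconst (of_int (int k)) * cre a (int k))"
        by (simp add: hlinear_scale hlinear_hderiv)
      also have "\<dots> = (\<Sum>m = 1..k. hconst (of_nat m) * (hconst (a m) * hderiv n (hvar m * cre a (int k - int m))))"
        by (subst cre_newton[of _ k]) (auto simp: hlinear_sum hlinear_hderiv hlinear_scale)
      \<comment> \<open>The product rule gives one extra term from the variable m = n; the induction
        hypothesis supplies the rest with the index lowered by n.\<close>
      also have "\<dots> = (\<Sum>m = 1..k. (if m = n then hconst (of_nat n * a n) * cre a (int k - int n) else 0) +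
           hconst (a n) * (hconst (of_nat m) * (hconst (a m) * (hvar m * cre a (int k - int n - int m)))))"
      proof (intro sum.cong refl)
        fix m assume m: "m \<in> {1..k}"
        have "hderiv n (cre a (int k - int m)) = hconst (a n) * cre a (int k - int m - int n)"
          using less[of "k - m"] m by (auto simp: of_nat_diff)
        moreover have "int k - int m - int n = int k - int n - int m"
          by simp
        ultimately show "hconst (of_nat m) * (hconst (a m) * hderiv n (hvar m * cre a (int k - int m))) =
          (if m = n then hconst (of_nat n * a n) * cre a (int k - int n) else 0) +
           hconst (a n) * (hconst (of_nat m) * (hconst (a m) * (hvar m * cre a (int k - int n - int m))))"
          using m assms by (auto simp: hderiv_mult hderiv_hvar hconst_mult algebra_simps)
      qed
      \<comment> \<open>Newton's recursion at k - n sums the second part; n + (k - n) = k then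
        restores the factor k.\<close>
      also have "\<dots> = hconst (of_nat n * a n) * cre a (int k - int n) +
          hconst (a n) * (hconst (of_int (int k - int n)) * cre a (int k - int n))"
        unfolding sum.distrib sum_distrib_left[symmetric]
        by (subst cre_newton[of "int k - int n" k]) (use assms in \<open>auto simp: sum.delta cre_neg\<close>)
      also have "\<dots> = hconst (of_nat k) * (hconst (a n) * cre a (int k - int n))"
        by (simp add: hconst_mult hconst_diff algebra_simps)
      finally show ?thesis
        by (rule hconst_cancel[rotated]) (use False in simp)
    qed
  qed
  then show ?thesis
    by (simp add: k)
qed (simp add: cre_neg hlinear_0 hlinear_hderiv)

text \<open>Since the creation series is a simultaneous eigenvector of the derivations, the
  annihilation series multiplies it by the scalar exp (sum b_n a_n w^n), called the contraction
  below.\<close>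

lemma ann_cre: "ann b s (cre a r) = hconst (sexp (\<lambda>n. b n * a n) s) * cre a (r - int s)"
proof (rule ann_unique)
  fix s :: nat
  let ?c = "\<lambda>n. b n * a n"
  have "hconst (of_nat s) * (hconst (sexp ?c s) * cre a (r - int s)) =
      hconst (\<Sum>n = 1..s. of_nat n * ?c n * sexp ?c (s - n)) * cre a (r - int s)"
    by (subst sexp_newton[symmetric]) (simp only: hconst_mult mult.assoc)
  also have "\<dots> = (\<Sum>n = 1..s. hconst (of_nat n) * (hconst (b n) * hderiv n (hconst (sexp ?c (s - n)) * cre a (r - int (s - n)))))"
    unfolding hconst_sum sum_distrib_right
  proof (intro sum.cong refl)
    fix n assume "n \<in> {1..s}"
    then have *: "r - int (s - n) - int n = r - int s" "n > 0"
      by auto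
    then show "hconst (of_nat n * ?c n * sexp ?c (s - n)) * cre a (r - int s) =
        hconst (of_nat n) * (hconst (b n) * hderiv n (hconst (sexp ?c (s - n)) * cre a (r - int (s - n))))"
      by (simp only: hlinear_scale[OF hlinear_hderiv] hderiv_cre[OF *(2)] *(1) hconst_mult) (simp only: mult_ac)
  qed
  finally show "hconst (of_nat s) * (hconst (sexp ?c s) * cre a (r - int s)) = \<dots>" .
qed simp

section \<open>Weights\<close>

text \<open>A predicate on weights covers homogeneous elements (w = d), bounded ones (w <= d) and,
  through the false predicate, vanishing. Weights are integers so that shifts may be
  negative.\<close>

definition hwt :: "(int \<Rightarrow> bool) \<Rightarrow> 'a::zero heis_sym \<Rightarrow> bool" where
  "hwt P f \<longleftrightarrow> (\<forall>t\<in>Poly_Mapping.keys f. P (int (exponent_weight t)))"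

lemma exponent_weight_superset:
  "finite A \<Longrightarrow> Poly_Mapping.keys t \<subseteq> A \<Longrightarrow> exponent_weight t = (\<Sum>k\<in>A. Suc k * Poly_Mapping.lookup t k)"
  unfolding exponent_weight_def by (rule sum.mono_neutral_left) (auto simp: in_keys_iff)

lemma exponent_weight_add: "exponent_weight (s + t) = exponent_weight s + exponent_weight t"
proof -
  let ?A = "Poly_Mapping.keys s \<union> Poly_Mapping.keys t"
  have "exponent_weight u = (\<Sum>k\<in>?A. Suc k * Poly_Mapping.lookup u k)" if "u \<in> {s, t, s + t}" for u
    using that Poly_Mapping.keys_add[of s t] by (intro exponent_weight_superset) auto
  then show ?thesis
    by (simp add: lookup_add sum.distrib algebra_simps)
qed

lemma exponent_weight_0 [simp]: "exponent_weight 0 = 0"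
  by (simp add: exponent_weight_def)

lemma exponent_weight_single [simp]: "exponent_weight (Poly_Mapping.single k n) = Suc k * n"
  by (cases "n = 0") (simp_all add: exponent_weight_def)

lemma exponent_weight_diff_single:
  assumes "Poly_Mapping.lookup t k \<noteq> 0"
  shows "exponent_weight (t - Poly_Mapping.single k (Suc 0)) + Suc k = exponent_weight t"
proof -
  have "t = (t - Poly_Mapping.single k (Suc 0)) + Poly_Mapping.single k (Suc 0)"
    using assms by (intro poly_mapping_eqI) (auto simp: lookup_add lookup_minus lookup_single when_def)
  then show ?thesis
    by (metis exponent_weight_add exponent_weight_single mult.right_neutral One_nat_def)
qed

lemma hwt_0 [simp]: "hwt P 0"
  by (simp add: hwt_def)

lemma hwt_mono: "hwt P f \<Longrightarrow> (\<And>w. w \<ge> 0 \<Longrightarrow> P w \<Longrightarrow> Q w) \<Longrightarrow> hwt Q f"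
  by (auto simp: hwt_def)

lemma hwt_add: "hwt P f \<Longrightarrow> hwt P g \<Longrightarrow> hwt P (f + g)"
  using Poly_Mapping.keys_add[of f g] by (auto simp: hwt_def)

lemma hwt_sum: "(\<And>x. x \<in> A \<Longrightarrow> hwt P (g x)) \<Longrightarrow> hwt P (sum g A)"
  by (induction A rule: infinite_finite_induct) (auto simp: hwt_add)

lemma hwt_single: "c = 0 \<or> P (int (exponent_weight t)) \<Longrightarrow> hwt P (Poly_Mapping.single t c)"
  by (auto simp: hwt_def)

lemma hwt_mult:
  assumes "hwt P f" "hwt (\<lambda>w. w = d) g"
  shows "hwt (\<lambda>w. P (w - d)) (g * f)"
  unfolding hwt_def
proof
  fix t assume "t \<in> Poly_Mapping.keys (g * f)"
  then obtain a b where "t = a + b" "a \<in> Poly_Mapping.keys g" "b \<in> Poly_Mapping.keys f"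
    using keys_mult[of g f] by auto
  then show "P (int (exponent_weight t) - d)"
    using assms by (auto simp: hwt_def exponent_weight_add)
qed

lemma hwt_hconst: "P 0 \<Longrightarrow> hwt P (hconst c)"
  unfolding hconst_def by (rule hwt_single) simp

lemma hwt_hconst_mult: "hwt P f \<Longrightarrow> hwt P (hconst c * f)"
  by (auto simp: hwt_def in_keys_iff lookup_hconst_mult)

lemma hwt_hvar: "n > 0 \<Longrightarrow> hwt (\<lambda>w. w = int n) (hvar n)"
  unfolding hvar_def by (rule hwt_single) simp

lemma hwt_bot: "hwt (\<lambda>_. False) f \<Longrightarrow> f = 0"
  by (simp add: hwt_def)

lemma hwt_bounded: "\<exists>d. hwt (\<lambda>w. w \<le> int d) f"
proof
  show "hwt (\<lambda>w. w \<le> int (Max (insert 0 (exponent_weight ` Poly_Mapping.keys f)))) f"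
    by (auto simp: hwt_def intro!: Max_ge)
qed

lemma hwt_hderiv:
  assumes "n > 0" "hwt P f"
  shows "hwt (\<lambda>w. P (w + int n)) (hderiv n f)"
  unfolding hderiv_def partial_deriv_def
proof (intro hwt_sum hwt_single)
  fix t assume "t \<in> Poly_Mapping.keys f"
  then show "of_nat (Poly_Mapping.lookup t (n - 1)) * Poly_Mapping.lookup f t = 0 \<or>
      P (int (exponent_weight (t - Poly_Mapping.single (n - 1) 1)) + int n)"
    using exponent_weight_diff_single[of t "n - 1"] assms
    by (cases "Poly_Mapping.lookup t (n - 1) = 0") (auto simp: hwt_def simp flip: of_nat_add)
qed

lemma hwt_ann:
  assumes "hwt P f"
  shows "hwt (\<lambda>w. P (w + int s)) (ann b s f)"
proof -
  have *: "hwt (\<lambda>w. P (w + int (sum_list ns))) (foldr (\<lambda>n f. hconst (b n) * hderiv n f) ns f)"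
    if "0 \<notin> set ns" for ns
    using that
  proof (induction ns)
    case (Cons n ns)
    then show ?case
      using hwt_hderiv[of n "\<lambda>w. P (w + int (sum_list ns))"]
      by (auto intro!: hwt_hconst_mult simp: add.assoc)
  qed (simp add: assms)
  show ?thesis
    unfolding ann_def hexp_def by (intro hwt_sum hwt_hconst_mult) (use * in auto)
qed

text \<open>\<open>ann b s\<close> lowers the weight by s. This makes all infinite sums over s
  finite.\<close>

lemma ann_eq_0: "hwt (\<lambda>w. w \<le> int d) f \<Longrightarrow> d < s \<Longrightarrow> ann b s f = 0"
  using hwt_ann[of "\<lambda>w. w \<le> int d" f s b] by (intro hwt_bot) (auto intro: hwt_mono)

lemma ann_bounded: "hwt (\<lambda>w. w \<le> int d) f \<Longrightarrow> hwt (\<lambda>w. w \<le> int d) (ann b s f)"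
  using hwt_ann[of "\<lambda>w. w \<le> int d" f s b] by (auto intro: hwt_mono)

lemma hwt_cre: "hwt (\<lambda>w. w = r) (cre a r)"
proof -
  have *: "hwt (\<lambda>w. w = int (sum_list ns)) (foldr (\<lambda>n f. hconst (a n) * (hvar n * f)) ns 1)"
    if "0 \<notin> set ns" for ns
    using that
  proof (induction ns)
    case Nil
    show ?case using hwt_hconst[of "\<lambda>w. w = 0" 1] by simp
  next
    case (Cons n ns)
    then show ?case
      using hwt_mult[OF Cons.IH hwt_hvar[of n]]
      by (auto intro!: hwt_hconst_mult elim!: hwt_mono)
  qed
  show ?thesis
    unfolding cre_def hexp_def
    by (auto intro!: hwt_sum hwt_hconst_mult *[THEN hwt_mono])
qed

section \<open>Vertex operators on the polynomial ring\<close>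

text \<open>The index k is the exponent of z, equivalently the amount by which the weight is raised,
  see \<open>hwt_vop\<close>.\<close>

definition vop :: "(nat \<Rightarrow> 'a::field_char_0) \<Rightarrow> (nat \<Rightarrow> 'a) \<Rightarrow> int \<Rightarrow> 'a heis_sym \<Rightarrow> 'a heis_sym" where
  "vop a b k f = Sum_any (\<lambda>s. cre a (k + int s) * ann b s f)"

lemma vop_eq:
  "hwt (\<lambda>w. w \<le> int d) f \<Longrightarrow> vop a b k f = (\<Sum>s\<le>d. cre a (k + int s) * ann b s f)"
  unfolding vop_def
proof (rule Sum_any.expand_superset)
  assume d: "hwt (\<lambda>w. w \<le> int d) f"
  show "{s. cre a (k + int s) * ann b s f \<noteq> 0} \<subseteq> {..d}"
    using ann_eq_0[OF d] by (auto simp: not_le[symmetric])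
qed simp

lemma vop_linear: "hlinear (vop a b k)"
  unfolding hlinear_def
proof (intro conjI allI)
  fix f g :: "'a heis_sym" and c
  obtain d d' where "hwt (\<lambda>w. w \<le> int d) f" "hwt (\<lambda>w. w \<le> int d') g"
    using hwt_bounded[of f] hwt_bounded[of g] by blast
  then have *: "hwt (\<lambda>w. w \<le> int (max d d')) f" "hwt (\<lambda>w. w \<le> int (max d d')) g"
    by (auto elim!: hwt_mono)
  show "vop a b k (f + g) = vop a b k f + vop a b k g"
    unfolding *[THEN vop_eq] vop_eq[OF hwt_add[OF *]]
    by (simp add: hlinear_add ann_linear algebra_simps sum.distrib)
  show "vop a b k (hconst c * f) = hconst c * vop a b k f"
    unfolding *[THEN vop_eq] vop_eq[OF hwt_hconst_mult[OF *(1)]]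
    by (simp only: hlinear_scale[OF ann_linear] sum_distrib_left mult.left_commute)
qed

lemma hwt_vop: "hwt P f \<Longrightarrow> hwt (\<lambda>w. P (w - k)) (vop a b k f)"
proof -
  assume P: "hwt P f"
  obtain d where d: "hwt (\<lambda>w. w \<le> int d) f"
    using hwt_bounded by blast
  have "hwt (\<lambda>w. P (w - k)) (cre a (k + int s) * ann b s f)" for s
    using hwt_mult[OF hwt_ann[OF P] hwt_cre] by (rule hwt_mono) auto
  then show ?thesis
    unfolding vop_eq[OF d] by (intro hwt_sum) auto
qed

lemma vop_cong:
  "(\<And>n. n > 0 \<Longrightarrow> a n = a' n) \<Longrightarrow> (\<And>n. n > 0 \<Longrightarrow> b n = b' n) \<Longrightarrow> vop a b k f = vop a' b' k f"
  unfolding vop_def using cre_cong[of a a'] ann_cong[of b b'] by simp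

lemma vop_1: "vop a b k 1 = cre a k"
proof -
  have "hwt (\<lambda>w. w \<le> int 0) (1 :: 'a heis_sym)"
    using hwt_hconst[of "\<lambda>w. w \<le> 0" "1 :: 'a"] by simp
  from vop_eq[OF this] show ?thesis
    by simp
qed

text \<open>The support of \<open>G\<close> lies in a rectangle that is contained in the triangle i
  + s <= M.\<close>

lemma triangle_reindex:
  fixes G :: "nat \<Rightarrow> nat \<Rightarrow> 'b::comm_monoid_add"
  assumes "\<And>i s. s > d \<Longrightarrow> G i s = 0" "\<And>i s. i > N \<Longrightarrow> G i s = 0" "M \<ge> N + d"
  shows "(\<Sum>s\<le>M. \<Sum>i\<le>s. G i (s - i)) = (\<Sum>i\<le>N. \<Sum>s\<le>d. G i s)"
proof -
  have "(\<Sum>s\<le>M. \<Sum>i\<le>s. G i (s - i)) = (\<Sum>(s, i)\<in>(SIGMA s:{..M}. {..s}). G i (s - i))"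
    by (rule sum.Sigma) auto
  also have "\<dots> = (\<Sum>(i, s)\<in>{(i, s). i + s \<le> M}. G i s)"
    by (rule sum.reindex_bij_witness[of _ "\<lambda>(i, s). (i + s, i)" "\<lambda>(s, i). (i, s - i)"]) auto
  also have "\<dots> = (\<Sum>(i, s)\<in>{..N} \<times> {..d}. G i s)"
  proof (rule sum.mono_neutral_right)
    have "G i s = 0" if "\<not> (i \<le> N \<and> s \<le> d)" for i s
      using assms(1,2) that by (cases "i \<le> N") (auto simp: not_le)
    then show "\<forall>x\<in>{(i, s). i + s \<le> M} - {..N} \<times> {..d}. (case x of (i, s) \<Rightarrow> G i s) = 0"
      by fastforce
    have "{(i, s). i + s \<le> M} \<subseteq> {..M} \<times> {..M}" by auto
    then show "finite {(i, s). i + s \<le> M}" by (rule finite_subset) auto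
  qed (use assms(3) in auto)
  also have "\<dots> = (\<Sum>i\<le>N. \<Sum>s\<le>d. G i s)"
    by (rule sum.cartesian_product [symmetric])
  finally show ?thesis .
qed

text \<open>\<open>ann_mult\<close> distributes the annihilation part over the two factors, and
  \<open>ann_cre\<close> turns its action on the creation factor into a contraction coefficient.
  \<open>ann_vop\<close> is the mirror image.\<close>

lemma vop_cre_mult:
  assumes "j \<le> int N"
  shows "vop a b k (cre a' j * f) =
    (\<Sum>i\<le>N. hconst (sexp (\<lambda>n. b n * a' n) i) * (cre a' (j - int i) * vop a b (k + int i) f))"
proof -
  obtain d where d: "hwt (\<lambda>w. w \<le> int d) f"
    using hwt_bounded by blast
  let ?c = "\<lambda>i. hconst (sexp (\<lambda>n. b n * a' n) i)"
  have dj: "hwt (\<lambda>w. w \<le> int (N + d)) (cre a' j * f)"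
    using hwt_mult[OF d hwt_cre[of j a']] by (rule hwt_mono) (use assms in auto)
  let ?G = "\<lambda>i s. ?c i * (cre a' (j - int i) * (cre a (k + int i + int s) * ann b s f))"
  have "vop a b k (cre a' j * f) = (\<Sum>s\<le>N + d. \<Sum>i\<le>s. ?G i (s - i))"
    unfolding vop_eq[OF dj] ann_mult ann_cre sum_distrib_left
    by (intro sum.cong refl) (auto simp: of_nat_diff mult_ac)
  also have "\<dots> = (\<Sum>i\<le>N. \<Sum>s\<le>d. ?G i s)"
    by (rule triangle_reindex) (use assms in \<open>auto simp: ann_eq_0[OF d] cre_neg\<close>)
  also have "\<dots> = (\<Sum>i\<le>N. ?c i * (cre a' (j - int i) * vop a b (k + int i) f))"
    by (simp only: vop_eq[OF d] sum_distrib_left)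
  finally show ?thesis .
qed

lemma ann_vop:
  "ann b' j (vop a b k f) =
    (\<Sum>i\<le>j. hconst (sexp (\<lambda>n. b' n * a n) i) * vop a b (k - int i) (ann b' (j - i) f))"
proof -
  obtain d where d: "hwt (\<lambda>w. w \<le> int d) f"
    using hwt_bounded by blast
  let ?c = "\<lambda>i. hconst (sexp (\<lambda>n. b' n * a n) i)"
  have "ann b' j (vop a b k f) = (\<Sum>s\<le>d. \<Sum>i\<le>j. ?c i * (cre a (k - int i + int s) * ann b s (ann b' (j - i) f)))"
    unfolding vop_eq[OF d] hlinear_sum[OF ann_linear] ann_mult ann_cre
    by (auto simp: ann_commute[of b'] algebra_simps intro!: sum.cong)
  also have "\<dots> = (\<Sum>i\<le>j. \<Sum>s\<le>d. ?c i * (cre a (k - int i + int s) * ann b s (ann b' (j - i) f)))"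
    by (rule sum.swap)
  also have "\<dots> = (\<Sum>i\<le>j. ?c i * vop a b (k - int i) (ann b' (j - i) f))"
    by (simp only: vop_eq[OF ann_bounded[OF d]] sum_distrib_left)
  finally show ?thesis .
qed

text \<open>The normally ordered product in degrees k and l: the second operator is wrapped around
  the first, so that all creation coefficients stand to the left of all annihilation coefficients,
  as \<open>nop_eq2\<close> displays.\<close>

definition nop :: "(nat \<Rightarrow> 'a::field_char_0) \<Rightarrow> (nat \<Rightarrow> 'a) \<Rightarrow> (nat \<Rightarrow> 'a) \<Rightarrow> (nat \<Rightarrow> 'a) \<Rightarrow>
    int \<Rightarrow> int \<Rightarrow> 'a heis_sym \<Rightarrow> 'a heis_sym" where
  "nop a b a' b' k l f = Sum_any (\<lambda>t. cre a' (l + int t) * vop a b k (ann b' t f))"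

lemma nop_eq:
  assumes d: "hwt (\<lambda>w. w \<le> int d) f"
  shows "nop a b a' b' k l f = (\<Sum>t\<le>d. cre a' (l + int t) * vop a b k (ann b' t f))"
  unfolding nop_def
proof (rule Sum_any.expand_superset)
  have "vop a b k (ann b' t f) = 0" if "t > d" for t
    using that by (simp add: ann_eq_0[OF d] hlinear_0 vop_linear)
  then show "{t. cre a' (l + int t) * vop a b k (ann b' t f) \<noteq> 0} \<subseteq> {..d}"
    by (auto simp: not_le[symmetric])
qed simp

lemma nop_eq2:
  assumes d: "hwt (\<lambda>w. w \<le> int d) f"
  shows "nop a b a' b' k l f =
    (\<Sum>t\<le>d. \<Sum>s\<le>d. cre a (k + int s) * cre a' (l + int t) * ann b s (ann b' t f))"
  unfolding nop_eq[OF d] vop_eq[OF ann_bounded[OF d]]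
  by (simp add: sum_distrib_left mult_ac)

lemma nop_commute: "nop a b a' b' k l f = nop a' b' a b l k f"
proof -
  obtain d where d: "hwt (\<lambda>w. w \<le> int d) f"
    using hwt_bounded by blast
  show ?thesis
    unfolding nop_eq2[OF d]
    by (subst sum.swap) (simp add: mult_ac ann_commute[of b])
qed

text \<open>Moving the annihilation part of the first operator past the creation part of the second
  costs the contraction series. Beyond i = l + d all creation indices l - i + t are negative, whence
  the bound on N.\<close>

lemma vop_vop:
  assumes d: "hwt (\<lambda>w. w \<le> int d) f" and N: "l + int d \<le> int N"
  shows "vop a b k (vop a' b' l f) =
    (\<Sum>i\<le>N. hconst (sexp (\<lambda>n. b n * a' n) i) * nop a b a' b' (k + int i) (l - int i) f)"
proof -
  let ?c = "\<lambda>i. hconst (sexp (\<lambda>n. b n * a' n) i)"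
  have "vop a b k (vop a' b' l f) =
      (\<Sum>t\<le>d. \<Sum>i\<le>N. ?c i * (cre a' (l + int t - int i) * vop a b (k + int i) (ann b' t f)))"
    unfolding vop_eq[OF d] hlinear_sum[OF vop_linear]
    by (intro sum.cong refl vop_cre_mult) (use N in auto)
  also have "\<dots> = (\<Sum>i\<le>N. \<Sum>t\<le>d. ?c i * (cre a' (l - int i + int t) * vop a b (k + int i) (ann b' t f)))"
    by (subst sum.swap) (simp add: algebra_simps)
  also have "\<dots> = (\<Sum>i\<le>N. ?c i * nop a b a' b' (k + int i) (l - int i) f)"
    by (simp only: nop_eq[OF d] sum_distrib_left)
  finally show ?thesis .
qed

section \<open>Operators on the Fock space\<close>

definition flinear :: "('a::comm_ring_1 fock \<Rightarrow> 'a fock) \<Rightarrow> bool" where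
  "flinear T \<longleftrightarrow> (\<forall>u v. T (u + v) = T u + T v) \<and> (\<forall>c u. T (fock_scale c u) = fock_scale c (T u))"

lemma flinear_add: "flinear T \<Longrightarrow> T (u + v) = T u + T v"
  and flinear_scale: "flinear T \<Longrightarrow> T (fock_scale c u) = fock_scale c (T u)"
  by (simp_all add: flinear_def)

lemma fock_scale_0 [simp]: "fock_scale c 0 = 0" "fock_scale 0 v = 0"
  by (simp_all add: fock_scale_def)

lemma fock_scale_1 [simp]: "fock_scale 1 v = v"
  by (simp add: fock_scale_def)

lemma fock_scale_single: "fock_scale c (Poly_Mapping.single m f) = Poly_Mapping.single m (hconst c * f)"
  by (simp add: fock_scale_def hconst_def mult_single)

lemma fock_scale_add: "fock_scale c (u + v) = fock_scale c u + fock_scale c v"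
  and fock_scale_diff: "fock_scale c (u - v) = fock_scale c u - fock_scale c v"
  and fock_scale_add_left: "fock_scale (c + d) v = fock_scale c v + fock_scale d v"
  and fock_scale_mult: "fock_scale (c * d) v = fock_scale c (fock_scale d v)"
  by (simp_all add: fock_scale_def algebra_simps single_add mult_single flip: mult.assoc)

lemma fock_scale_minus_1: "fock_scale (- 1) v = - v"
  using fock_scale_add_left[of 1 "- 1" v] by (simp add: eq_neg_iff_add_eq_0 add.commute)

lemma fock_scale_sum: "fock_scale c (sum g A) = (\<Sum>x\<in>A. fock_scale c (g x))"
  by (induction A rule: infinite_finite_induct) (auto simp: fock_scale_add)

lemma single_sum: "Poly_Mapping.single m (sum g A) = (\<Sum>x\<in>A. Poly_Mapping.single m (g x))"
  by (induction A rule: infinite_finite_induct) (auto simp: single_add)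

lemma flinear_uminus: "flinear T \<Longrightarrow> T (- v) = - T v"
  using flinear_scale[of T "- 1" v] by (simp add: fock_scale_minus_1)

lemma flinear_diff: "flinear T \<Longrightarrow> T (u - v) = T u - T v"
  using flinear_add[of T u "- v"] by (simp add: flinear_uminus)

lemma flinear_fock_scale: "flinear (fock_scale c)"
  by (simp add: flinear_def fock_scale_add fock_scale_mult [symmetric] mult.commute)

lemma flinear_comp: "flinear S \<Longrightarrow> flinear T \<Longrightarrow> flinear (S \<circ> T)"
  by (simp add: flinear_def)

text \<open>Operators that act on each lattice component and shift the lattice by e. Since each
  \<open>\<phi> m\<close> preserves 0, the sum over the support may be taken over a common larger
  set when two vectors are added.\<close>

lemma fock_graded_linear:
  fixes \<phi> :: "int \<Rightarrow> 'a::comm_ring_1 heis_sym \<Rightarrow> 'a heis_sym"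
  assumes "\<And>m. hlinear (\<phi> m)"
  shows "flinear (\<lambda>v. \<Sum>m\<in>Poly_Mapping.keys v. Poly_Mapping.single (m + e) (\<phi> m (Poly_Mapping.lookup v m)))"
proof -
  let ?T = "\<lambda>v. \<Sum>m\<in>Poly_Mapping.keys v. Poly_Mapping.single (m + e) (\<phi> m (Poly_Mapping.lookup v m))"
  have super: "?T v = (\<Sum>m\<in>A. Poly_Mapping.single (m + e) (\<phi> m (Poly_Mapping.lookup v m)))"
    if "finite A" "Poly_Mapping.keys v \<subseteq> A" for A and v :: "'a fock"
    using that by (intro sum.mono_neutral_left) (auto simp: in_keys_iff hlinear_0 assms)
  have "?T (u + v) = ?T u + ?T v" for u v
  proof -
    let ?A = "Poly_Mapping.keys u \<union> Poly_Mapping.keys v"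
    have A: "finite ?A" "Poly_Mapping.keys u \<subseteq> ?A" "Poly_Mapping.keys v \<subseteq> ?A" "Poly_Mapping.keys (u + v) \<subseteq> ?A"
      using Poly_Mapping.keys_add[of u v] by auto
    show ?thesis
      unfolding super[OF A(1,2)] super[OF A(1,3)] super[OF A(1,4)]
      by (simp add: lookup_add hlinear_add assms single_add sum.distrib)
  qed
  moreover have "?T (fock_scale c v) = fock_scale c (?T v)" for c v
  proof -
    have lk: "Poly_Mapping.lookup (fock_scale c v) m = hconst c * Poly_Mapping.lookup v m" for m
      unfolding fock_scale_def mult_map_scale_conv_mult [symmetric]
      by (simp add: Poly_Mapping.map.rep_eq when_def hconst_def) (simp add: mult_map_scale_conv_mult)
    have "?T (fock_scale c v) = (\<Sum>m\<in>Poly_Mapping.keys v. Poly_Mapping.single (m + e) (\<phi> m (Poly_Mapping.lookup (fock_scale c v) m)))"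
      by (rule super) (auto simp: in_keys_iff lk)
    then show ?thesis
      by (simp add: lk hlinear_scale assms fock_scale_sum fock_scale_single)
  qed
  ultimately show ?thesis
    by (simp add: flinear_def)
qed

lemma exp_coeff_single:
  assumes "\<And>n f. n > 0 \<Longrightarrow> T n (Poly_Mapping.single m f) = Poly_Mapping.single m (U n f)"
  shows "exp_coeff T r (Poly_Mapping.single m f) = Poly_Mapping.single m (hexp U r f)"
proof -
  have "foldr T ns (Poly_Mapping.single m f) = Poly_Mapping.single m (foldr U ns f)"
    if "0 \<notin> set ns" for ns
    using that by (induction ns) (auto simp: assms)
  then show ?thesis
    unfolding exp_coeff_def hexp_def single_sum
    by (intro sum.cong) (auto simp: fock_scale_single)
qed

lemma heis_neg_single:
  "n > 0 \<Longrightarrow> heis q (- int n) (Poly_Mapping.single m f) = Poly_Mapping.single m (hvar n * f)"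
  by (simp add: heis_def hvar_def mult_single)

lemma heis_pos_single:
  "n > 0 \<Longrightarrow> heis q (int n) (Poly_Mapping.single m f) =
     Poly_Mapping.single m (hconst (of_nat n / (1 + q ^ (2 * n))) * hderiv n f)"
  by (auto simp: heis_def hderiv_def fock_scale_single partial_deriv_0 nat_power_eq power_int_def nat_mult_distrib)

lemma vertex_coeff_keys:
  assumes "Poly_Mapping.keys v = {m}" "Poly_Mapping.lookup v m = f"
  shows "vertex_coeff q i a b \<epsilon> N v = Sum_any (\<lambda>s :: nat.
     let r = N + int s - \<epsilon> * (2 * m + i) in
     if r < 0 then 0 else
       exp_coeff (\<lambda>n u. fock_scale (a n) (heis q (- int n) u)) (nat r)
         (exp_coeff (\<lambda>n u. fock_scale (b n) (heis q (int n) u)) s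
           (lattice_shift \<epsilon> (Poly_Mapping.single m f))))"
  unfolding vertex_coeff_def assms(1) assms(2)[symmetric]
  by (simp only: sum.insert finite.emptyI empty_iff sum.empty add_0_right not_False_eq_True)

text \<open>The power of z coming from the lattice derivation is applied before the lattice shift,
  so it involves the old index m. The factor n / (1 + q^(2n)) of a_n joins b_n.\<close>

lemma vertex_coeff_single:
  "vertex_coeff q i a b \<epsilon> N (Poly_Mapping.single m f) =
     Poly_Mapping.single (m + \<epsilon>) (vop a (\<lambda>n. b n * (of_nat n / (1 + q ^ (2 * n)))) (N - \<epsilon> * (2 * m + i)) f)"
proof -
  let ?b = "\<lambda>n. b n * (of_nat n / (1 + q ^ (2 * n)))" and ?k = "N - \<epsilon> * (2 * m + i)"
  obtain d where d: "hwt (\<lambda>w. w \<le> int d) f"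
    using hwt_bounded by blast
  have ann: "exp_coeff (\<lambda>n u. fock_scale (b n) (heis q (int n) u)) s (Poly_Mapping.single M f) =
      Poly_Mapping.single M (ann ?b s f)" for s M and f :: "'a heis_sym"
    unfolding ann_def by (rule exp_coeff_single) (simp add: heis_pos_single fock_scale_single hconst_mult_left)
  have cre: "exp_coeff (\<lambda>n u. fock_scale (a n) (heis q (- int n) u)) s (Poly_Mapping.single M f) =
      Poly_Mapping.single M (cre a (int s) * f)" for s M and f :: "'a heis_sym"
    unfolding hexp_mult [symmetric] by (rule exp_coeff_single) (simp add: heis_neg_single fock_scale_single)
  have shift: "lattice_shift \<epsilon> (Poly_Mapping.single m f) = Poly_Mapping.single (m + \<epsilon>) f"
    by (simp add: lattice_shift_def mult_single add.commute)
  have step: "(let r = N + int s - \<epsilon> * (2 * m + i) in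
     if r < 0 then 0 else
       exp_coeff (\<lambda>n u. fock_scale (a n) (heis q (- int n) u)) (nat r)
         (exp_coeff (\<lambda>n u. fock_scale (b n) (heis q (int n) u)) s
           (lattice_shift \<epsilon> (Poly_Mapping.single m f)))) =
     Poly_Mapping.single (m + \<epsilon>) (cre a (?k + int s) * ann ?b s f)" for s
    by (auto simp: shift ann cre Let_def cre_neg algebra_simps)
  have "vertex_coeff q i a b \<epsilon> N (Poly_Mapping.single m f) =
      Sum_any (\<lambda>s. Poly_Mapping.single (m + \<epsilon>) (cre a (?k + int s) * ann ?b s f))"
  proof (cases "f = 0")
    case False
    then have "Poly_Mapping.keys (Poly_Mapping.single m f) = {m}"
      by simp
    from vertex_coeff_keys[OF this lookup_single_eq] show ?thesis
      by (simp only: step)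
  qed (simp add: vertex_coeff_def hlinear_0 ann_linear)
  also have "\<dots> = (\<Sum>s\<le>d. Poly_Mapping.single (m + \<epsilon>) (cre a (?k + int s) * ann ?b s f))"
  proof (rule Sum_any.expand_superset)
    have "Poly_Mapping.single (m + \<epsilon>) (cre a (?k + int s) * ann ?b s f) = 0" if "d < s" for s
      using that by (simp only: ann_eq_0[OF d] mult_zero_right single_zero)
    then show "{s. Poly_Mapping.single (m + \<epsilon>) (cre a (?k + int s) * ann ?b s f) \<noteq> 0} \<subseteq> {..d}"
      by (intro subsetI) (rule ccontr, simp only: mem_Collect_eq atMost_iff not_le not_True_eq_False simp_thms)
  qed simp
  also have "\<dots> = Poly_Mapping.single (m + \<epsilon>) (vop a ?b ?k f)"
    by (simp add: vop_eq[OF d] single_sum)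
  finally show ?thesis .
qed

lemma vertex_coeff_flinear: "flinear (vertex_coeff q i a b \<epsilon> N)"
proof -
  have "vertex_coeff q i a b \<epsilon> N v = (\<Sum>m\<in>Poly_Mapping.keys v. vertex_coeff q i a b \<epsilon> N (Poly_Mapping.single m (Poly_Mapping.lookup v m)))" for v
    unfolding vertex_coeff_def[of q i a b \<epsilon> N v]
    by (intro sum.cong refl vertex_coeff_keys[symmetric]) (auto simp: in_keys_iff)
  then have "vertex_coeff q i a b \<epsilon> N =
      (\<lambda>v. \<Sum>m\<in>Poly_Mapping.keys v. Poly_Mapping.single (m + \<epsilon>)
        (vop a (\<lambda>n. b n * (of_nat n / (1 + q ^ (2 * n)))) (N - \<epsilon> * (2 * m + i)) (Poly_Mapping.lookup v m)))"
    by (intro ext) (simp only: vertex_coeff_single)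
  then show ?thesis
    using fock_graded_linear[of "\<lambda>m. vop a (\<lambda>n. b n * (of_nat n / (1 + q ^ (2 * n)))) (N - \<epsilon> * (2 * m + i))" \<epsilon>, OF vop_linear]
    by (simp only:)
qed

text \<open>The coefficients of the exponentials after n / (1 + q^(2n)) has been absorbed into the
  annihilation parts. For X^- this leaves the constant 1 in the annihilation part.\<close>

definition crP :: "'a::field_char_0 \<Rightarrow> nat \<Rightarrow> 'a" where
  "crP q n = (q ^ n + inverse q ^ n) / of_nat n"

definition anP :: "'a::field_char_0 \<Rightarrow> nat \<Rightarrow> 'a" where
  "anP q n = - (inverse q ^ n)"

definition crM :: "'a::field_char_0 \<Rightarrow> nat \<Rightarrow> 'a" where
  "crM q n = - ((1 + (q\<^sup>2) ^ n) / of_nat n)"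

text \<open>X, 1 + X^(2n) and X^n - 1 (for n > 0) are nonzero polynomials with integer coefficients,
  so q is not a root of them.\<close>

lemma not_algebraic_imp_nonzero:
  fixes q :: "'a::field_char_0"
  assumes "\<not> algebraic q"
  shows "q \<noteq> 0" and "1 + q ^ (2 * n) \<noteq> 0" and "n > 0 \<Longrightarrow> q ^ n \<noteq> 1"
proof -
  have nz: "poly p q \<noteq> 0" if "p \<noteq> 0" "\<And>i. coeff p i \<in> \<int>" for p
    using assms that unfolding algebraic_def by blast
  have mon: "coeff (monom 1 k) i \<in> (\<int> :: 'a set)" for i k
    by simp
  have c1: "coeff 1 i \<in> (\<int> :: 'a set)" for i
    by (simp add: coeff_1)
  show "q \<noteq> 0"
    using nz[of "monom 1 1"] mon by (auto simp: poly_monom)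
  show "1 + q ^ (2 * n) \<noteq> 0"
  proof (cases "n = 0")
    case False
    have "coeff (1 + monom (1 :: 'a) (2 * n)) (2 * n) = 1"
      using False by simp
    then have "1 + monom (1 :: 'a) (2 * n) \<noteq> 0"
      by (metis coeff_0 zero_neq_one)
    from nz[OF this] show ?thesis
      using mon c1 by (simp add: poly_monom)
  qed simp
  assume "n > 0"
  then have "coeff (monom (1 :: 'a) n - 1) n = 1"
    by simp
  then have "monom (1 :: 'a) n - 1 \<noteq> 0"
    by (metis coeff_0 zero_neq_one)
  from nz[OF this] show "q ^ n \<noteq> 1"
    using mon c1 by (simp add: poly_monom)
qed

lemma X_plus_single:
  fixes q :: "'a::field_char_0"
  assumes "\<not> algebraic q"
  shows "X_plus q i n (Poly_Mapping.single m f) =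
    Poly_Mapping.single (m + 1) (vop (crP q) (anP q) (- n - 1 - (2 * m + i)) f)"
proof -
  note nz = not_algebraic_imp_nonzero[OF assms]
  have qn: "q powi (- int k) = inverse q ^ k" for k
    by (simp add: power_int_minus power_inverse)
  have inv: "q ^ n * inverse q ^ n = 1" for n
    using nz(1) by (simp add: power_mult_distrib [symmetric])
  have "(1 + q ^ (2 * n)) * inverse q ^ n = inverse q ^ n + q ^ n * (q ^ n * inverse q ^ n)" for n
    by (simp only: mult_2 power_add) (simp add: algebra_simps)
  then have cr: "(1 + q ^ (2 * n)) * inverse q ^ n = q ^ n + inverse q ^ n" for n
    unfolding inv by (simp add: add.commute)
  have an: "- ((1 + q ^ (2 * n)) * q powi (- int n) / of_nat n) * (of_nat n / (1 + q ^ (2 * n))) = anP q n"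
    if "n > 0" for n
    unfolding qn anP_def using nz(2)[of n] that by simp
  show ?thesis
    unfolding X_plus_def vertex_coeff_single mult_1
    by (intro arg_cong[where f = "Poly_Mapping.single _"] vop_cong an) (simp_all only: qn crP_def cr)
qed

lemma X_minus_single:
  fixes q :: "'a::field_char_0"
  assumes "\<not> algebraic q"
  shows "X_minus q i n (Poly_Mapping.single m f) =
    Poly_Mapping.single (m - 1) (vop (crM q) (\<lambda>_. 1) (- n - 1 + (2 * m + i)) f)"
proof -
  note nz = not_algebraic_imp_nonzero[OF assms]
  have an: "(1 + q ^ (2 * n)) / of_nat n * (of_nat n / (1 + q ^ (2 * n))) = 1" if "n > 0" for n
    using nz(2)[of n] that by simp
  have "X_minus q i n (Poly_Mapping.single m f) =
     Poly_Mapping.single (m + - 1) (vop (crM q) (\<lambda>_. 1) (- n - 1 - (- 1) * (2 * m + i)) f)"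
    unfolding X_minus_def vertex_coeff_single
    by (intro arg_cong[where f = "Poly_Mapping.single _"] vop_cong an) (simp_all add: crM_def power_mult)
  moreover have "- n - 1 - (- 1) * (2 * m + i) = - n - 1 + (2 * m + i)" "m + - 1 = m - 1"
    by simp_all
  ultimately show ?thesis
    by (simp only:)
qed

lemma X_plus_flinear: "flinear (X_plus q i n)" and X_minus_flinear: "flinear (X_minus q i n)"
  by (simp_all add: X_plus_def X_minus_def vertex_coeff_flinear)

lemma mapp_flinear:
  assumes "\<And>m. hlinear (\<phi> m)"
  shows "flinear (Poly_Mapping.mapp \<phi>)"
proof -
  have "Poly_Mapping.mapp \<phi> v = (\<Sum>m\<in>Poly_Mapping.keys v. Poly_Mapping.single (m + 0) (\<phi> m (Poly_Mapping.lookup v m)))" for v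
    by (rule poly_mapping_eqI) (auto simp: lookup_mapp lookup_sum lookup_single when_def hlinear_0 assms in_keys_iff)
  then have "Poly_Mapping.mapp \<phi> = (\<lambda>v. \<Sum>m\<in>Poly_Mapping.keys v. Poly_Mapping.single (m + 0) (\<phi> m (Poly_Mapping.lookup v m)))"
    by (rule ext)
  then show ?thesis
    using fock_graded_linear[of \<phi> 0, OF assms] by (simp only:)
qed

lemma q_partial_single:
  "q_partial q i s (Poly_Mapping.single m f) = Poly_Mapping.single m (hconst (q powi (s * (2 * m + i))) * f)"
  by (rule poly_mapping_eqI) (auto simp: q_partial_def lookup_mapp lookup_single when_def in_keys_iff hconst_def)

lemma q_partial_flinear: "flinear (q_partial q i s)"
  unfolding q_partial_def[abs_def] hconst_def[symmetric] by (rule mapp_flinear) (rule hlinear_mult)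

text \<open>The grading on one lattice component; c stands for the lattice part m^2 + i m of the
  negated degree.\<close>

definition hgrade :: "'a::field \<Rightarrow> int \<Rightarrow> int \<Rightarrow> 'a heis_sym \<Rightarrow> 'a heis_sym" where
  "hgrade q s c f = Poly_Mapping.mapp (\<lambda>t x. q powi (- s * (int (exponent_weight t) + c)) * x) f"

lemma lookup_hgrade:
  "Poly_Mapping.lookup (hgrade q s c f) t = q powi (- s * (int (exponent_weight t) + c)) * Poly_Mapping.lookup f t"
  by (auto simp: hgrade_def lookup_mapp when_def in_keys_iff)

lemma hgrade_linear: "hlinear (hgrade q s c)"
  by (auto simp: hlinear_def lookup_hgrade lookup_add lookup_hconst_mult distrib_left mult.left_commute
      intro!: poly_mapping_eqI)

lemma mapp_0: "Poly_Mapping.mapp F 0 = 0"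
  by (rule poly_mapping_eqI) (simp add: lookup_mapp)

lemma q_grading_single:
  "q_grading q i s (Poly_Mapping.single m f) = Poly_Mapping.single m (hgrade q s (m\<^sup>2 + i * m) f)"
  by (rule poly_mapping_eqI)
    (auto simp: q_grading_def hgrade_def lookup_mapp lookup_single when_def in_keys_iff add.assoc mapp_0)

lemma q_grading_flinear: "flinear (q_grading q i s)"
proof -
  have "q_grading q i s = Poly_Mapping.mapp (\<lambda>m. hgrade q s (m\<^sup>2 + i * m))"
    by (auto simp: fun_eq_iff q_grading_def hgrade_def[abs_def] add.assoc)
  then show ?thesis
    by (simp add: mapp_flinear hgrade_linear)
qed

lemma hgrade_homogeneous:
  assumes "hwt (\<lambda>w. w = d) f"
  shows "hgrade q s c f = hconst (q powi (- s * (d + c))) * f"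
  using assms by (intro poly_mapping_eqI) (auto simp: lookup_hgrade lookup_hconst_mult hwt_def in_keys_iff)

section \<open>Commutation relations of the vertex operators\<close>

lemma sexp_cong: "(\<And>n. n > 0 \<Longrightarrow> c n = c' n) \<Longrightarrow> sexp c r = sexp c' r"
proof -
  assume *: "\<And>n. n > 0 \<Longrightarrow> c n = c' n"
  have "prod_list (map c ns) = prod_list (map c' ns)" if "0 \<notin> set ns" for ns
    using that by (induction ns) (auto simp: *)
  then show ?thesis
    unfolding sexp_def by (intro sum.cong) auto
qed

text \<open>exp (- log (1 - u w)) = 1 / (1 - u w).\<close>

lemma sexp_geometric: "sexp (\<lambda>n. u ^ n / of_nat n) r = u ^ r"
proof (rule sexp_unique)
  fix r :: nat
  have "(\<Sum>n = 1..r. of_nat n * (u ^ n / of_nat n) * u ^ (r - n)) = (\<Sum>n = 1..r. u ^ r)"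
    by (intro sum.cong) (auto simp flip: power_add)
  then show "of_nat r * u ^ r = (\<Sum>n = 1..r. of_nat n * (u ^ n / of_nat n) * u ^ (r - n))"
    by simp
qed simp

text \<open>exp (log (1 - u w) + log (1 - v w)) is the polynomial (1 - u w)(1 - v w).\<close>

lemma sexp_two:
  "sexp (\<lambda>n. - ((u ^ n + v ^ n) / of_nat n)) r =
     (if r = 0 then 1 else if r = 1 then - (u + v) else if r = 2 then u * v else 0)"
proof (rule sexp_unique)
  let ?g = "\<lambda>r::nat. if r = 0 then 1 else if r = 1 then - (u + v) else if r = 2 then u * v else 0"
  fix r :: nat assume "r > 0"
  then consider "r = 1" | "r = 2" | k where "r = k + 3"
    by (metis One_nat_def add.commute add_2_eq_Suc' less_Suc_eq_le less_one linorder_not_less nat_le_iff_add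
        not_less_eq numeral_2_eq_2 numeral_3_eq_3 order_antisym_conv)
  then have "of_nat r * ?g r = (\<Sum>n = 1..r. - (u ^ n + v ^ n) * ?g (r - n))"
  proof cases
    case 3
    \<comment> \<open>Only the last three summands meet the support {0, 1, 2} of
      \<open>?g\<close>.\<close>
    have "(\<Sum>n = 1..k + 3. - (u ^ n + v ^ n) * ?g (r - n)) =
        (\<Sum>n \<in> {k + 1, k + 2, k + 3}. - (u ^ n + v ^ n) * ?g (r - n))"
      using 3 by (intro sum.mono_neutral_right) auto
    also have "\<dots> = 0"
      using 3 by (simp add: eval_nat_numeral algebra_simps)
    finally show ?thesis
      using 3 by simp
  qed (simp_all add: eval_nat_numeral algebra_simps)
  also have "\<dots> = (\<Sum>n = 1..r. of_nat n * (- ((u ^ n + v ^ n) / of_nat n)) * ?g (r - n))"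
    by (intro sum.cong refl) simp
  finally show "of_nat r * ?g r = \<dots>" .
qed simp

text \<open>The expansion of 1 / ((1 - u w)(1 - v w)); for u = q and v = 1/q the coefficients are
  the quantum integers [r + 1].\<close>

lemma sexp_quotient:
  assumes "u \<noteq> v"
  shows "sexp (\<lambda>n. (u ^ n + v ^ n) / of_nat n) r = (u ^ (r + 1) - v ^ (r + 1)) / (u - v)"
proof (rule sexp_unique)
  let ?g = "\<lambda>r. (u ^ (r + 1) - v ^ (r + 1)) / (u - v)"
  show "?g 0 = 1"
    using assms by simp
  fix r :: nat
  \<comment> \<open>The unmixed products give r copies of \<open>?g r\<close>; the mixed ones cancel
    in pairs under n -> r + 1 - n.\<close>
  have "(\<Sum>n = 1..r. of_nat n * ((u ^ n + v ^ n) / of_nat n) * ?g (r - n)) =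
      (\<Sum>n = 1..r. ?g r + (v ^ n * u ^ (r + 1 - n) - u ^ n * v ^ (r + 1 - n)) / (u - v))"
  proof (intro sum.cong refl)
    fix n assume n: "n \<in> {1..r}"
    then have pow: "u ^ (r + 1) = u ^ n * u ^ (r - n + 1)" "v ^ (r + 1) = v ^ n * v ^ (r - n + 1)" "r + 1 - n = r - n + 1"
      by (auto simp flip: power_add)
    have "of_nat n * ((u ^ n + v ^ n) / of_nat n) = u ^ n + v ^ n"
      using n by simp
    then show "of_nat n * ((u ^ n + v ^ n) / of_nat n) * ?g (r - n) =
        ?g r + (v ^ n * u ^ (r + 1 - n) - u ^ n * v ^ (r + 1 - n)) / (u - v)"
      unfolding pow add_divide_distrib[symmetric] by (simp add: algebra_simps)
  qed
  also have "\<dots> = of_nat r * ?g r + ((\<Sum>n = 1..r. v ^ n * u ^ (r + 1 - n)) - (\<Sum>n = 1..r. u ^ n * v ^ (r + 1 - n))) / (u - v)"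
    by (subst sum.distrib) (simp add: sum_subtractf flip: sum_divide_distrib)
  also have "(\<Sum>n = 1..r. v ^ n * u ^ (r + 1 - n)) = (\<Sum>n = 1..r. u ^ n * v ^ (r + 1 - n))"
    by (rule sum.reindex_bij_witness[of _ "\<lambda>n. r + 1 - n" "\<lambda>n. r + 1 - n"]) (auto simp: mult.commute)
  finally show "of_nat r * ?g r = (\<Sum>n = 1..r. of_nat n * ((u ^ n + v ^ n) / of_nat n) * ?g (r - n))"
    by simp
qed

lemma vop_vop_two:
  assumes "\<And>n. n > 0 \<Longrightarrow> b n * a' n = - ((u ^ n + v ^ n) / of_nat n)"
  shows "vop a b k (vop a' b' l f) = nop a b a' b' k l f
    - hconst (u + v) * nop a b a' b' (k + 1) (l - 1) f + hconst (u * v) * nop a b a' b' (k + 2) (l - 2) f"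
proof -
  obtain d where d: "hwt (\<lambda>w. w \<le> int d) f"
    using hwt_bounded by blast
  let ?c = "\<lambda>r::nat. if r = 0 then 1 else if r = 1 then - (u + v) else if r = 2 then u * v else 0"
  let ?N = "nat (l + int d) + 2"
  have c: "sexp (\<lambda>n. b n * a' n) r = ?c r" for r
    by (subst sexp_cong[OF assms]) (simp_all only: sexp_two)
  have "vop a b k (vop a' b' l f) =
      (\<Sum>i\<le>?N. hconst (sexp (\<lambda>n. b n * a' n) i) * nop a b a' b' (k + int i) (l - int i) f)"
    by (rule vop_vop[OF d]) simp
  also have "\<dots> = (\<Sum>i\<in>{0, 1, 2}. hconst (?c i) * nop a b a' b' (k + int i) (l - int i) f)"
    unfolding c by (rule sum.mono_neutral_right) auto
  also have "\<dots> = nop a b a' b' k l f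
    - hconst (u + v) * nop a b a' b' (k + 1) (l - 1) f + hconst (u * v) * nop a b a' b' (k + 2) (l - 2) f"
    by (simp add: hconst_uminus hconst_add hconst_diff algebra_simps)
  finally show ?thesis .
qed

text \<open>Both sides are expanded with the contraction (1 - w)(1 - v w) and compared using the
  symmetry of \<open>nop\<close>. This is the case of adjacent modes of the Drinfeld relation, where
  its two halves coincide.\<close>

lemma vop_quadratic:
  assumes "\<And>n. n > 0 \<Longrightarrow> b n * a n = - ((1 + v ^ n) / of_nat n)"
  shows "hconst v * vop a b (k - 3) (vop a b k f) = vop a b (k - 2) (vop a b (k - 1) f)"
proof -
  have two: "vop a b k (vop a b l f) = nop a b a b k l f - hconst (1 + v) * nop a b a b (k + 1) (l - 1) f
      + hconst (1 * v) * nop a b a b (k + 2) (l - 2) f" for k l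
    by (rule vop_vop_two) (simp add: assms)
  show ?thesis
    unfolding two by (simp add: nop_commute[of a b a b "k - 1"] nop_commute[of a b a b k] hconst_add algebra_simps)
qed

text \<open>Specialising the two variables of the normally ordered product to w z and z merges the
  exponentials into one vertex operator. B bounds the degrees j in which a nonzero term can
  occur.\<close>

lemma nop_generating:
  assumes d: "hwt (\<lambda>w. w \<le> int d) f" and w: "w \<noteq> 0" and B: "B \<ge> \<bar>D\<bar> + 2 * int d"
  shows "(\<Sum>j = - B..B. hconst (w powi j) * nop a b a' b' j (D - j) f) =
    vop (\<lambda>n. w ^ n * a n + a' n) (\<lambda>n. inverse w ^ n * b n + b' n) D f"
proof -
  let ?A = "\<lambda>n. w ^ n * a n + a' n" and ?B = "\<lambda>n. inverse w ^ n * b n + b' n"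
  \<comment> \<open>The creation index is j + s while the weight is w^j; the difference is the
    factor w^(-s), which rescales the annihilation part.\<close>
  have inner: "(\<Sum>j = - B..B. hconst (w powi j) * (cre a (j + int s) * cre a' (D - j + int t))) =
      hconst (inverse w ^ s) * cre ?A (D + int s + int t)" if st: "s \<le> d" "t \<le> d" for s t
  proof -
    let ?N = "nat (B + int s)"
    have "cre ?A (D + int s + int t) = (\<Sum>i\<le>?N. cre (\<lambda>n. w ^ n * a n) (int i) * cre a' (D + int s + int t - int i))"
      by (rule cre_add) (use B st in linarith)
    also have "\<dots> = (\<Sum>i\<le>?N. hconst (w ^ i) * (cre a (int i) * cre a' (D + int s + int t - int i)))"
      by (simp add: cre_scale mult.assoc)
    also have "\<dots> = (\<Sum>j = - int s..B. hconst (w ^ nat (j + int s)) * (cre a (j + int s) * cre a' (D - j + int t)))"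
      by (rule sum.reindex_bij_witness[of _ "\<lambda>j. nat (j + int s)" "\<lambda>i. int i - int s"])
        (use B in \<open>auto simp: algebra_simps\<close>)
    finally have "hconst (inverse w ^ s) * cre ?A (D + int s + int t) =
        (\<Sum>j = - int s..B. hconst (inverse w ^ s * w ^ nat (j + int s)) * (cre a (j + int s) * cre a' (D - j + int t)))"
      by (simp add: sum_distrib_left hconst_mult_left)
    also have "\<dots> = (\<Sum>j = - int s..B. hconst (w powi j) * (cre a (j + int s) * cre a' (D - j + int t)))"
    proof (intro sum.cong refl)
      fix j assume "j \<in> {- int s..B}"
      then have "w ^ nat (j + int s) = w powi (j + int s)"
        by (simp add: power_int_def)
      also have "\<dots> = w powi j * w ^ s"
        using w by (simp add: power_int_add)
      finally have "inverse w ^ s * w ^ nat (j + int s) = w powi j"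
        using w by (simp add: power_inverse)
      then show "hconst (inverse w ^ s * w ^ nat (j + int s)) * (cre a (j + int s) * cre a' (D - j + int t)) =
          hconst (w powi j) * (cre a (j + int s) * cre a' (D - j + int t))"
        by simp
    qed
    also have "\<dots> = (\<Sum>j = - B..B. hconst (w powi j) * (cre a (j + int s) * cre a' (D - j + int t)))"
      by (rule sum.mono_neutral_left) (use B st in \<open>auto simp: cre_neg\<close>)
    finally show ?thesis by simp
  qed
  have "(\<Sum>j = - B..B. hconst (w powi j) * nop a b a' b' j (D - j) f) =
      (\<Sum>j = - B..B. \<Sum>t\<le>d. \<Sum>s\<le>d. hconst (w powi j) * (cre a (j + int s) * cre a' (D - j + int t)) * ann b s (ann b' t f))"
    unfolding nop_eq2[OF d] by (simp add: sum_distrib_left mult.assoc)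
  also have "\<dots> = (\<Sum>t\<le>d. \<Sum>s\<le>d. \<Sum>j = - B..B. hconst (w powi j) * (cre a (j + int s) * cre a' (D - j + int t)) * ann b s (ann b' t f))"
    by (subst sum.swap) (intro sum.cong refl sum.swap)
  also have "\<dots> = (\<Sum>t\<le>d. \<Sum>s\<le>d. hconst (inverse w ^ s) * cre ?A (D + int s + int t) * ann b s (ann b' t f))"
    unfolding sum_distrib_right[symmetric] by (intro sum.cong refl arg_cong[where f = "\<lambda>x. x * _"] inner) auto
  also have "\<dots> = (\<Sum>s\<le>d. \<Sum>t\<le>d. cre ?A (D + int (s + t)) * (ann (\<lambda>n. inverse w ^ n * b n) s (ann b' t f)))"
    by (subst sum.swap) (simp only: ann_scale, simp only: mult_ac of_nat_add add.assoc)
  also have "\<dots> = (\<Sum>u\<le>2 * d. \<Sum>s\<le>u. cre ?A (D + int (s + (u - s))) * (ann (\<lambda>n. inverse w ^ n * b n) s (ann b' (u - s) f)))"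
    by (rule triangle_reindex[symmetric])
      (auto simp: ann_eq_0[OF d] ann_eq_0[OF ann_bounded[OF d]] hlinear_0[OF ann_linear])
  also have "\<dots> = (\<Sum>u\<le>2 * d. cre ?A (D + int u) * ann ?B u f)"
    unfolding ann_add sum_distrib_left by (intro sum.cong refl) auto
  also have "\<dots> = vop ?A ?B D f"
    by (rule vop_eq[symmetric]) (use d in \<open>auto elim!: hwt_mono\<close>)
  finally show ?thesis .
qed

text \<open>Both orders have the contraction 1 / ((1 - q w)(1 - w/q)), expanded in opposite
  directions. The coefficients are odd in their index, so the two one-sided sums join into one over
  all j, that is, into a delta function for each of the two factors, and
  \<open>nop_generating\<close> evaluates them. The shifts by 2 anticipate that the other operator
  has moved the lattice index by one.\<close>

lemma vop_commutator:
  assumes uq: "q \<noteq> 0" "q \<noteq> inverse q"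
    and c: "\<And>n. n > 0 \<Longrightarrow> b n * a' n = (q ^ n + inverse q ^ n) / of_nat n"
    and c': "\<And>n. n > 0 \<Longrightarrow> b' n * a n = (q ^ n + inverse q ^ n) / of_nat n"
  shows "vop a b k (vop a' b' (D - k) f) - vop a' b' (D - k + 2) (vop a b (k - 2) f) =
    hconst (1 / (q - inverse q)) *
      (hconst (q powi (1 - k)) * vop (\<lambda>n. q ^ n * a n + a' n) (\<lambda>n. inverse q ^ n * b n + b' n) D f -
       hconst (q powi (k - 1)) * vop (\<lambda>n. inverse q ^ n * a n + a' n) (\<lambda>n. q ^ n * b n + b' n) D f)"
proof -
  obtain d where d: "hwt (\<lambda>w. w \<le> int d) f"
    using hwt_bounded by blast
  \<comment> \<open>Large enough for both uses of \<open>vop_vop\<close> and both uses of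
    \<open>nop_generating\<close>.\<close>
  define B where "B = \<bar>D\<bar> + \<bar>k\<bar> + 2 * int d + 2"
  let ?c = "\<lambda>j. (q powi j - inverse q powi j) / (q - inverse q)"
  let ?G = "\<lambda>j. nop a b a' b' j (D - j) f"
  have sexp: "sexp (\<lambda>n. b n * a' n) r = ?c (int r + 1)" "sexp (\<lambda>n. b' n * a n) r = ?c (int r + 1)" for r
    by (subst sexp_cong[OF c] sexp_cong[OF c'],
      simp_all add: sexp_quotient[OF uq(2)] power_int_def nat_add_distrib)+
  \<comment> \<open>Oddness of the quantum integers is what makes the terms of the reversed product
    continue the same sequence below k - 1.\<close>
  have neg: "?c (- j) = - ?c j" for j
    by (simp add: power_int_minus power_int_inverse diff_divide_distrib)
  have "vop a b k (vop a' b' (D - k) f) =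
      (\<Sum>i\<le>nat (B - k). hconst (?c (int i + 1)) * nop a b a' b' (k + int i) (D - k - int i) f)"
    unfolding sexp(1)[symmetric] by (rule vop_vop[OF d]) (auto simp: B_def)
  also have "\<dots> = (\<Sum>j = k..B. hconst (?c (j - k + 1)) * ?G j)"
    by (rule sum.reindex_bij_witness[of _ "\<lambda>j. nat (j - k)" "\<lambda>i. k + int i"])
      (auto simp: B_def algebra_simps)
  finally have 1: "vop a b k (vop a' b' (D - k) f) = \<dots>" .
  have "vop a' b' (D - k + 2) (vop a b (k - 2) f) =
      (\<Sum>i\<le>nat (B + k - 2). hconst (?c (int i + 1)) * nop a' b' a b (D - k + 2 + int i) (k - 2 - int i) f)"
    unfolding sexp(2)[symmetric] by (rule vop_vop[OF d]) (auto simp: B_def)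
  also have "\<dots> = (\<Sum>j = - B..k - 2. hconst (?c (k - 1 - j)) * ?G j)"
    by (rule sum.reindex_bij_witness[of _ "\<lambda>j. nat (k - 2 - j)" "\<lambda>i. k - 2 - int i"])
      (auto simp: B_def algebra_simps nop_commute[of a' b'])
  also have "\<dots> = - (\<Sum>j = - B..k - 2. hconst (?c (j - k + 1)) * ?G j)"
  proof -
    have "?c (k - 1 - j) = - ?c (j - k + 1)" for j
      using neg[of "j - k + 1"] by (simp add: algebra_simps)
    then show ?thesis
      by (simp only: hconst_uminus mult_minus_left sum_negf)
  qed
  finally have 2: "vop a' b' (D - k + 2) (vop a b (k - 2) f) = \<dots>" .
  \<comment> \<open>The index k - 1 is missing from both sums, but its coefficient is the quantum
    integer [0] = 0.\<close>
  have "{- B..B} = {- B..k - 2} \<union> ({k - 1} \<union> {k..B})"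
    by (auto simp: B_def)
  then have "(\<Sum>j = - B..B. hconst (?c (j - k + 1)) * ?G j) =
      (\<Sum>j = - B..k - 2. hconst (?c (j - k + 1)) * ?G j) + (\<Sum>j = k..B. hconst (?c (j - k + 1)) * ?G j)"
    by (simp add: sum.union_disjoint)
  with 1 2 have "vop a b k (vop a' b' (D - k) f) - vop a' b' (D - k + 2) (vop a b (k - 2) f) =
      (\<Sum>j = - B..B. hconst (?c (j - k + 1)) * ?G j)"
    by simp
  \<comment> \<open>Each quantum integer is a difference of a power of q and a power of 1/q, which
    separates the two delta functions.\<close>
  also have "\<dots> = (\<Sum>j = - B..B. hconst (1 / (q - inverse q)) *
      (hconst (q powi (1 - k)) * (hconst (q powi j) * ?G j) - hconst (q powi (k - 1)) * (hconst (inverse q powi j) * ?G j)))"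
  proof (intro sum.cong refl)
    fix j
    have "q powi (1 - k + j) = q powi (1 - k) * q powi j"
      using uq(1) by (intro power_int_add) simp
    moreover have "inverse q powi (1 - k + j) = inverse q powi (1 - k) * inverse q powi j"
      using uq(1) by (intro power_int_add) simp
    moreover have "inverse q powi (1 - k) = q powi (k - 1)"
      by (metis minus_diff_eq power_int_inverse power_int_minus)
    moreover have "1 - k + j = j - k + 1"
      by simp
    ultimately have "q powi (j - k + 1) = q powi (1 - k) * q powi j"
        "inverse q powi (j - k + 1) = q powi (k - 1) * inverse q powi j"
      by (simp_all only:)
    then have "?c (j - k + 1) = 1 / (q - inverse q) * (q powi (1 - k) * q powi j - q powi (k - 1) * inverse q powi j)"
      by simp
    then show "hconst (?c (j - k + 1)) * ?G j = hconst (1 / (q - inverse q)) *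
      (hconst (q powi (1 - k)) * (hconst (q powi j) * ?G j) - hconst (q powi (k - 1)) * (hconst (inverse q powi j) * ?G j))"
      by (simp only: hconst_mult hconst_diff mult.assoc left_diff_distrib right_diff_distrib)
  qed
  also have "\<dots> = hconst (1 / (q - inverse q)) *
      (hconst (q powi (1 - k)) * (\<Sum>j = - B..B. hconst (q powi j) * ?G j) -
       hconst (q powi (k - 1)) * (\<Sum>j = - B..B. hconst (inverse q powi j) * ?G j))"
    by (simp only: sum_distrib_left sum_subtractf right_diff_distrib)
  also have "(\<Sum>j = - B..B. hconst (q powi j) * ?G j) =
      vop (\<lambda>n. q ^ n * a n + a' n) (\<lambda>n. inverse q ^ n * b n + b' n) D f"
    by (rule nop_generating[OF d uq(1)]) (simp add: B_def)
  also have "(\<Sum>j = - B..B. hconst (inverse q powi j) * ?G j) =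
      vop (\<lambda>n. inverse q ^ n * a n + a' n) (\<lambda>n. q ^ n * b n + b' n) D f"
    using nop_generating[OF d, of "inverse q" D B a b a' b'] uq(1) by (simp add: B_def)
  finally show ?thesis .
qed

lemma hderiv_vop:
  assumes "n > 0"
  shows "hderiv n (vop a b k f) = vop a b k (hderiv n f) + hconst (a n) * vop a b (k - int n) f"
proof -
  obtain d where d: "hwt (\<lambda>w. w \<le> int d) f"
    using hwt_bounded by blast
  have d': "hwt (\<lambda>w. w \<le> int d) (hderiv n f)"
    using hwt_hderiv[OF assms d] by (rule hwt_mono) simp
  have *: "k + int s - int n = k - int n + int s" for s
    by simp
  have "hderiv n (cre a (k + int s) * ann b s f) = cre a (k + int s) * ann b s (hderiv n f) +
      hconst (a n) * (cre a (k - int n + int s) * ann b s f)" for s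
    by (simp only: hderiv_mult hderiv_cre[OF assms] ann_hderiv *) (simp only: mult.assoc add.commute)
  then show ?thesis
    unfolding vop_eq[OF d] vop_eq[OF d'] hlinear_sum[OF hlinear_hderiv]
    by (simp only: sum.distrib sum_distrib_left)
qed

lemma cre_1: "cre a 1 = hconst (a 1) * hvar 1"
  using cre_newton[of 1 1 a] by simp

text \<open>\<open>hvar 1\<close> is the creation coefficient of degree one with constant
  coefficients 1, so only the contractions i = 0 and i = 1 occur.\<close>

lemma vop_hvar: "vop a b k (hvar 1 * f) = hvar 1 * vop a b k f + hconst (b 1) * vop a b (k + 1) f"
proof -
  have "sexp c 1 = c 1" for c :: "nat \<Rightarrow> 'a"
    using sexp_newton[of 1 c] by simp
  then show ?thesis
    using vop_cre_mult[of 1 1 a b k "\<lambda>_. 1" f] by (simp add: cre_1)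
qed

text \<open>The weight rises by k and the lattice part changes from c to c'; on monomials, which are
  homogeneous, both gradings are scalars.\<close>

lemma hgrade_vop:
  assumes "q \<noteq> 0"
  shows "hgrade q s c' (vop a b k f) = hconst (q powi (- s * (k + c' - c))) * vop a b k (hgrade q s c f)"
proof (rule hlinear_eqI[where S = "\<lambda>f. hgrade q s c' (vop a b k f)"])
  show "hlinear (\<lambda>f. hgrade q s c' (vop a b k f))"
    by (intro hlinear_comp[OF hgrade_linear] vop_linear)
  show "hlinear (\<lambda>f. hconst (q powi (- s * (k + c' - c))) * vop a b k (hgrade q s c f))"
    by (intro hlinear_mult_left hlinear_comp[OF vop_linear] hgrade_linear)
  fix t :: "nat \<Rightarrow>\<^sub>0 nat"
  let ?d = "int (exponent_weight t)" and ?f = "Poly_Mapping.single t 1 :: 'a heis_sym"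
  have f: "hwt (\<lambda>w. w = ?d) ?f"
    by (rule hwt_single) simp
  have "hwt (\<lambda>w. w = ?d + k) (vop a b k ?f)"
    using hwt_vop[OF f] by (rule hwt_mono) simp
  from hgrade_homogeneous[OF this]
  have "hgrade q s c' (vop a b k ?f) = hconst (q powi (- s * (?d + k + c'))) * vop a b k ?f" .
  also have "- s * (?d + k + c') = - s * (k + c' - c) + - s * (?d + c)"
    by (simp add: algebra_simps)
  also have "q powi \<dots> = q powi (- s * (k + c' - c)) * q powi (- s * (?d + c))"
    using assms by (simp only: power_int_add simp_thms)
  finally show "hgrade q s c' (vop a b k ?f) = hconst (q powi (- s * (k + c' - c))) * vop a b k (hgrade q s c ?f)"
    unfolding hgrade_homogeneous[OF f] hlinear_scale[OF vop_linear] by (simp only: hconst_mult mult.assoc)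
qed

lemma fock_induct [case_names add single]:
  assumes "\<And>u v. P u \<Longrightarrow> P v \<Longrightarrow> P (u + v)" "\<And>m f. P (Poly_Mapping.single m f)"
  shows "P (v :: 'a::comm_ring_1 fock)"
  using assms(2)[of 0 0] by (induction v rule: poly_mapping_sum_induct) (simp_all add: assms)

text \<open>(1 + q^2) times the Heisenberg generator a_1; \<open>fvar\<close> is a_(-1).\<close>

definition fderiv :: "'a::comm_ring_1 fock \<Rightarrow> 'a fock" where
  "fderiv = Poly_Mapping.mapp (\<lambda>_. hderiv 1)"

definition fvar :: "'a::comm_ring_1 fock \<Rightarrow> 'a fock" where
  "fvar = Poly_Mapping.mapp (\<lambda>_ f. hvar 1 * f)"

lemma fderiv_single: "fderiv (Poly_Mapping.single m f) = Poly_Mapping.single m (hderiv 1 f)"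
  by (rule poly_mapping_eqI)
    (auto simp: fderiv_def lookup_mapp lookup_single when_def in_keys_iff hlinear_0 hlinear_hderiv)

lemma fvar_single: "fvar (Poly_Mapping.single m f) = Poly_Mapping.single m (hvar 1 * f)"
  by (rule poly_mapping_eqI) (auto simp: fvar_def lookup_mapp lookup_single when_def in_keys_iff)

lemma fderiv_flinear: "flinear fderiv"
  unfolding fderiv_def by (intro mapp_flinear hlinear_hderiv)

lemma fvar_flinear: "flinear fvar"
  unfolding fvar_def by (intro mapp_flinear hlinear_mult)

section \<open>Relations between the components on the Fock space\<close>

locale vertex_module =
  fixes q :: "'a::field_char_0" and i :: int
  assumes not_alg: "\<not> algebraic q"
begin

abbreviation "Xp \<equiv> X_plus q i"
abbreviation "Xm \<equiv> X_minus q i"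
abbreviation "Q \<equiv> q_partial q i"
abbreviation "G \<equiv> q_grading q i"
abbreviation scale :: "'a \<Rightarrow> 'a fock \<Rightarrow> 'a fock" (infixr "\<cdot>" 75) where
  "c \<cdot> v \<equiv> fock_scale c v"

lemma nz: "q \<noteq> 0" "1 + q ^ (2 * n) \<noteq> 0"
  by (simp_all add: not_algebraic_imp_nonzero not_alg)

lemma pw: "q powi (a + b) = q powi a * q powi b"
  by (simp add: power_int_add nz)

lemma q_inverse: "q - inverse q \<noteq> 0"
proof
  assume "q - inverse q = 0"
  then have "q\<^sup>2 = 1"
    using nz(1) by (simp add: power2_eq_square field_simps)
  then show False
    using not_algebraic_imp_nonzero(3)[OF not_alg, of 2] by simp
qed

lemma Xp_single: "Xp n (Poly_Mapping.single m f) =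
    Poly_Mapping.single (m + 1) (vop (crP q) (anP q) (- n - 1 - (2 * m + i)) f)"
  by (rule X_plus_single[OF not_alg])

lemma Xm_single: "Xm n (Poly_Mapping.single m f) =
    Poly_Mapping.single (m - 1) (vop (crM q) (\<lambda>_. 1) (- n - 1 + (2 * m + i)) f)"
  by (rule X_minus_single[OF not_alg])

lemmas flin = X_plus_flinear X_minus_flinear q_partial_flinear q_grading_flinear fderiv_flinear
  fvar_flinear flinear_fock_scale

text \<open>Rewriting that moves sums and scalars out of all operators; it settles the additive step
  of \<open>fock_induct\<close> and normalises scalar factors.\<close>

lemmas push = flin[THEN flinear_add] flin[THEN flinear_diff] fock_scale_add fock_scale_diff
  X_plus_flinear[THEN flinear_scale] X_minus_flinear[THEN flinear_scale]
  q_partial_flinear[THEN flinear_scale] q_grading_flinear[THEN flinear_scale]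
  fderiv_flinear[THEN flinear_scale] fvar_flinear[THEN flinear_scale]
  fock_scale_mult[symmetric]

lemma inv_pow: "q ^ n * inverse q ^ n = 1" "inverse q ^ n * q ^ n = 1"
  using nz(1) by (simp_all add: power_mult_distrib [symmetric])

text \<open>The contraction of X^+ with itself is therefore (1 - w)(1 - w/q^2), the case v = q^(-2)
  of \<open>vop_quadratic\<close>.\<close>

lemma anP_crP: "anP q n * crP q n = - ((1 + (inverse q ^ 2) ^ n) / of_nat n)"
proof -
  have "(inverse q ^ 2) ^ n = inverse q ^ n * inverse q ^ n"
    by (simp add: power2_eq_square power_mult_distrib)
  then have "inverse q ^ n * (q ^ n + inverse q ^ n) = 1 + (inverse q ^ 2) ^ n"
    using inv_pow(2)[of n] by (simp add: distrib_left)
  then show ?thesis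
    by (simp only: anP_def crP_def mult_minus_left times_divide_eq_right minus_divide_left)
qed

text \<open>The contraction of X^+ with X^- is therefore 1 / ((1 - q w)(1 - w/q)), as
  \<open>vop_commutator\<close> requires.\<close>

lemma anP_crM: "anP q n * crM q n = (q ^ n + inverse q ^ n) / of_nat n"
proof -
  have "inverse q ^ n * (q\<^sup>2) ^ n = inverse q ^ n * q ^ n * q ^ n"
    by (simp add: power2_eq_square power_mult_distrib)
  then have "inverse q ^ n * (1 + (q\<^sup>2) ^ n) = q ^ n + inverse q ^ n"
    unfolding inv_pow(2) by (simp add: distrib_left add.commute)
  then show ?thesis
    by (simp only: anP_def crM_def minus_mult_minus times_divide_eq_right)
qed

lemma Xp_quadratic: "Xp (n + 1) (Xp n v) = q\<^sup>2 \<cdot> Xp n (Xp (n + 1) v)"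
proof (induction v rule: fock_induct)
  case (single m f)
  let ?k = "- n - 1 - (2 * m + i)" and ?Y = "vop (crP q) (anP q)"
  \<comment> \<open>Each X^+ raises m by one and so lowers the degree of the next operator by
    2.\<close>
  have k: "- (n + 1) - 1 - (2 * (m + 1) + i) = ?k - 3" "- (n + 1) - 1 - (2 * m + i) = ?k - 1"
    "- n - 1 - (2 * (m + 1) + i) = ?k - 2"
    by simp_all
  have "hconst (q\<^sup>2) * (hconst (inverse q ^ 2) * ?Y (?k - 3) (?Y ?k f)) = hconst (q\<^sup>2) * ?Y (?k - 2) (?Y (?k - 1) f)"
    by (subst vop_quadratic) (simp_all only: anP_crP)
  then have "?Y (?k - 3) (?Y ?k f) = hconst (q\<^sup>2) * ?Y (?k - 2) (?Y (?k - 1) f)"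
    unfolding hconst_mult_left inv_pow by simp
  then show "Xp (n + 1) (Xp n (Poly_Mapping.single m f)) = q\<^sup>2 \<cdot> Xp n (Xp (n + 1) (Poly_Mapping.single m f))"
    by (simp only: Xp_single fock_scale_single k)
qed (simp add: push add_diff_add ac_simps)

lemma Xm_quadratic: "Xm n (Xm (n + 1) v) = q\<^sup>2 \<cdot> Xm (n + 1) (Xm n v)"
proof (induction v rule: fock_induct)
  case (single m f)
  let ?k = "- n - 1 + (2 * m + i)" and ?Y = "vop (crM q) (\<lambda>_. 1)"
  have k: "- (n + 1) - 1 + (2 * (m - 1) + i) = ?k - 3" "- (n + 1) - 1 + (2 * m + i) = ?k - 1"
    "- n - 1 + (2 * (m - 1) + i) = ?k - 2"
    by simp_all
  have "hconst (q\<^sup>2) * ?Y (?k - 3) (?Y ?k f) = ?Y (?k - 2) (?Y (?k - 1) f)"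
    by (rule vop_quadratic) (simp add: crM_def)
  then show "Xm n (Xm (n + 1) (Poly_Mapping.single m f)) = q\<^sup>2 \<cdot> Xm (n + 1) (Xm n (Poly_Mapping.single m f))"
    by (simp only: Xm_single fock_scale_single k)
qed (simp add: push add_diff_add ac_simps)

text \<open>With the variables in ratio q the creation parts of X^+ and X^- cancel; a pure
  annihilation exponential remains, so only degrees D <= 0 contribute.\<close>

lemma generating_plus:
  "vop (\<lambda>n. q ^ n * crP q n + crM q n) (\<lambda>n. inverse q ^ n * anP q n + 1) D f =
     (if D \<le> 0 then ann (\<lambda>n. 1 - inverse q ^ (2 * n)) (nat (- D)) f else 0)"
proof -
  have "q ^ n * crP q n + crM q n = 0" for n
  proof -
    have "q ^ n * (q ^ n + inverse q ^ n) = (q\<^sup>2) ^ n + 1"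
      using inv_pow(1)[of n] by (simp add: distrib_left power2_eq_square power_mult_distrib)
    then show ?thesis
      by (simp add: crP_def crM_def add.commute)
  qed
  moreover have "inverse q ^ n * anP q n + 1 = 1 - inverse q ^ (2 * n)" for n
    by (simp add: anP_def mult_2 power_add)
  ultimately have "vop (\<lambda>n. q ^ n * crP q n + crM q n) (\<lambda>n. inverse q ^ n * anP q n + 1) D f =
      vop (\<lambda>_. 0) (\<lambda>n. 1 - inverse q ^ (2 * n)) D f"
    by (simp only:)
  also have "\<dots> = (if D \<le> 0 then ann (\<lambda>n. 1 - inverse q ^ (2 * n)) (nat (- D)) f else 0)"
  proof -
    obtain d where d: "hwt (\<lambda>w. w \<le> int d) f"
      using hwt_bounded by blast
    have d': "hwt (\<lambda>w. w \<le> int (d + nat (- D))) f"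
      using d by (rule hwt_mono) simp
    have "(D + int s = 0) \<longleftrightarrow> D \<le> 0 \<and> s = nat (- D)" for s
      by auto
    then show ?thesis
      unfolding vop_eq[OF d'] cre_zero by (auto simp: if_distrib[of "\<lambda>x. x * _"] cong: if_cong)
  qed
  finally show ?thesis .
qed

text \<open>With the variables in ratio 1/q the annihilation parts cancel instead, and the operator
  is multiplication by a creation coefficient.\<close>

lemma generating_minus:
  "vop (\<lambda>n. inverse q ^ n * crP q n + crM q n) (\<lambda>n. q ^ n * anP q n + 1) D f =
     cre (\<lambda>n. (inverse q ^ (2 * n) - q ^ (2 * n)) / of_nat n) D * f"
proof -
  have "inverse q ^ n * crP q n + crM q n = (inverse q ^ (2 * n) - q ^ (2 * n)) / of_nat n" for n
  proof -
    have "inverse q ^ n * (q ^ n + inverse q ^ n) = 1 + inverse q ^ (2 * n)"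
      using inv_pow(2)[of n] by (simp add: distrib_left mult_2 power_add)
    then have "inverse q ^ n * crP q n = (1 + inverse q ^ (2 * n)) / of_nat n"
      by (simp add: crP_def)
    then show ?thesis
      by (simp add: crM_def power_mult diff_divide_distrib add_divide_distrib)
  qed
  moreover have "q ^ n * anP q n + 1 = 0" for n
    using inv_pow(1)[of n] by (simp add: anP_def)
  ultimately have "vop (\<lambda>n. inverse q ^ n * crP q n + crM q n) (\<lambda>n. q ^ n * anP q n + 1) D f =
      vop (\<lambda>n. (inverse q ^ (2 * n) - q ^ (2 * n)) / of_nat n) (\<lambda>_. 0) D f"
    by (simp only:)
  also have "\<dots> = cre (\<lambda>n. (inverse q ^ (2 * n) - q ^ (2 * n)) / of_nat n) D * f"
  proof -
    obtain d where d: "hwt (\<lambda>w. w \<le> int d) f"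
      using hwt_bounded by blast
    show ?thesis
      unfolding vop_eq[OF d] ann_zero by (simp add: if_distrib[of "\<lambda>x. _ * x"] cong: if_cong)
  qed
  finally show ?thesis .
qed

text \<open>The Drinfeld relation between opposite currents: the two delta functions of
  \<open>vop_commutator\<close> carry the annihilating and the creating Cartan current.\<close>

lemma X_commutator:
  "Xp a (Xm b (Poly_Mapping.single m f)) - Xm b (Xp a (Poly_Mapping.single m f)) =
    (1 / (q - inverse q)) \<cdot> Poly_Mapping.single m
      (hconst (q powi (2 * m + i + a)) *
         (if a + b \<ge> 0 then ann (\<lambda>n. 1 - inverse q ^ (2 * n)) (nat (a + b)) f else 0) -
       hconst (q powi (- (2 * m + i + a))) *
         (cre (\<lambda>n. (inverse q ^ (2 * n) - q ^ (2 * n)) / of_nat n) (- (a + b)) * f))"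
proof -
  let ?k = "1 - a - (2 * m + i)" and ?D = "- (a + b)"
  have k: "- a - 1 - (2 * (m - 1) + i) = ?k" "- b - 1 + (2 * m + i) = ?D - ?k"
    "- a - 1 - (2 * m + i) = ?k - 2" "- b - 1 + (2 * (m + 1) + i) = ?D - ?k + 2" "m - 1 + 1 = m" "m + 1 - 1 = m"
    by simp_all
  have k2: "1 - ?k = 2 * m + i + a" "?k - 1 = - (2 * m + i + a)" "(?D \<le> 0) = (a + b \<ge> 0)" "- ?D = a + b"
    by auto
  have "q \<noteq> inverse q"
    using q_inverse by auto
  note vc = vop_commutator[OF nz(1) this, of "anP q" "crM q" "\<lambda>_. 1" "crP q" ?k ?D f, OF anP_crM]
  show ?thesis
    unfolding Xp_single Xm_single k single_diff[symmetric]
    by (subst vc) (simp add: crP_def, simp only: generating_plus generating_minus fock_scale_single k2)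
qed

lemma X_commutator_00: "Xp 0 (Xm 0 v) - Xm 0 (Xp 0 v) = (1 / (q - inverse q)) \<cdot> (Q 1 v - Q (- 1) v)"
  by (induction v rule: fock_induct) (simp_all add: push add_diff_add ac_simps X_commutator q_partial_single single_diff)

lemma X_commutator_m11:
  "Xp (- 1) (Xm 1 v) - Xm 1 (Xp (- 1) v) = (1 / (q - inverse q)) \<cdot> (inverse q \<cdot> Q 1 v - q \<cdot> Q (- 1) v)"
proof (induction v rule: fock_induct)
  case (single m f)
  have "2 * m + i - 1 = - 1 + (2 * m + i)" "- (2 * m + i - 1) = 1 + - (2 * m + i)"
    by simp_all
  then have "q powi (2 * m + i - 1) = inverse q * q powi (2 * m + i)"
    "q powi (- (2 * m + i - 1)) = q * q powi (- (2 * m + i))"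
    by (simp_all only: pw power_int_1_right power_int_minus)
  then show "Xp (- 1) (Xm 1 (Poly_Mapping.single m f)) - Xm 1 (Xp (- 1) (Poly_Mapping.single m f)) =
      (1 / (q - inverse q)) \<cdot> (inverse q \<cdot> Q 1 (Poly_Mapping.single m f) - q \<cdot> Q (- 1) (Poly_Mapping.single m f))"
    unfolding X_commutator q_partial_single fock_scale_single single_diff[symmetric] hconst_mult_left by simp
qed (simp add: push add_diff_add ac_simps)

lemma X_commutator_01: "Xp 0 (Xm 1 v) - Xm 1 (Xp 0 v) = inverse q \<cdot> Q 1 (fderiv v)"
proof (induction v rule: fock_induct)
  case (single m f)
  let ?b = "\<lambda>n. 1 - inverse q ^ (2 * n)"
  have ann: "ann ?b (Suc 0) f = hconst (?b 1) * hderiv (Suc 0) f"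
    using ann_newton[of 1 ?b f] by simp
  \<comment> \<open>The annihilation coefficient of degree 1 has the factor 1 - q^(-2), and (1 -
    q^(-2)) / (q - 1/q) = 1/q.\<close>
  have "1 / (q - inverse q) * (q powi (2 * m + i) * ?b 1) = inverse q * q powi (2 * m + i)"
    using q_inverse nz(1) by (simp add: field_simps power2_eq_square)
  then show "Xp 0 (Xm 1 (Poly_Mapping.single m f)) - Xm 1 (Xp 0 (Poly_Mapping.single m f)) =
      inverse q \<cdot> Q 1 (fderiv (Poly_Mapping.single m f))"
    unfolding X_commutator q_partial_single fderiv_single fock_scale_single
    by (simp add: ann cre_neg hconst_mult_left)
qed (simp add: push add_diff_add ac_simps)

lemma X_commutator_m10: "Xp (- 1) (Xm 0 v) - Xm 0 (Xp (- 1) v) = (q * (q + inverse q)) \<cdot> Q (- 1) (fvar v)"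
proof (induction v rule: fock_induct)
  case (single m f)
  let ?a = "\<lambda>n. (inverse q ^ (2 * n) - q ^ (2 * n)) / of_nat n"
  have "- (2 * m + i - 1) = 1 + - (2 * m + i)"
    by simp
  then have "q powi (- (2 * m + i - 1)) = q * q powi (- (2 * m + i))"
    by (simp only: pw power_int_1_right)
  \<comment> \<open>The creation coefficient of degree 1 has the factor q^(-2) - q^2 = -(q - 1/q)(q
    + 1/q).\<close>
  then have "1 / (q - inverse q) * - (q powi (- (2 * m + i - 1)) * ?a 1) = q * (q + inverse q) * q powi (- (2 * m + i))"
    using q_inverse nz(1) by (simp add: field_simps power2_eq_square)
  then show "Xp (- 1) (Xm 0 (Poly_Mapping.single m f)) - Xm 0 (Xp (- 1) (Poly_Mapping.single m f)) =
      (q * (q + inverse q)) \<cdot> Q (- 1) (fvar (Poly_Mapping.single m f))"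
    unfolding X_commutator q_partial_single fvar_single fock_scale_single
    by (simp add: cre_1 mult.assoc hconst_mult_left flip: hconst_uminus mult_minus_left)
qed (simp add: push add_diff_add ac_simps)

lemma fderiv_Xp: "fderiv (Xp n v) = Xp n (fderiv v) + crP q 1 \<cdot> Xp (n + 1) v"
proof (induction v rule: fock_induct)
  case (single m f)
  have "- n - 1 - (2 * m + i) - int 1 = - (n + 1) - 1 - (2 * m + i)"
    by simp
  then show "fderiv (Xp n (Poly_Mapping.single m f)) =
      Xp n (fderiv (Poly_Mapping.single m f)) + crP q 1 \<cdot> Xp (n + 1) (Poly_Mapping.single m f)"
    unfolding Xp_single fderiv_single fock_scale_single single_add[symmetric] hderiv_vop[OF zero_less_one]
    by (simp only:)
qed (simp add: push add_diff_add ac_simps)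

lemma fderiv_Xm: "fderiv (Xm n v) = Xm n (fderiv v) + crM q 1 \<cdot> Xm (n + 1) v"
proof (induction v rule: fock_induct)
  case (single m f)
  have "- n - 1 + (2 * m + i) - int 1 = - (n + 1) - 1 + (2 * m + i)"
    by simp
  then show "fderiv (Xm n (Poly_Mapping.single m f)) =
      Xm n (fderiv (Poly_Mapping.single m f)) + crM q 1 \<cdot> Xm (n + 1) (Poly_Mapping.single m f)"
    unfolding Xm_single fderiv_single fock_scale_single single_add[symmetric] hderiv_vop[OF zero_less_one]
    by (simp only:)
qed (simp add: push add_diff_add ac_simps)

lemma Xp_fvar: "Xp n (fvar v) = fvar (Xp n v) + anP q 1 \<cdot> Xp (n - 1) v"
proof (induction v rule: fock_induct)
  case (single m f)
  have "- n - 1 - (2 * m + i) + 1 = - (n - 1) - 1 - (2 * m + i)"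
    by simp
  then show "Xp n (fvar (Poly_Mapping.single m f)) =
      fvar (Xp n (Poly_Mapping.single m f)) + anP q 1 \<cdot> Xp (n - 1) (Poly_Mapping.single m f)"
    unfolding fvar_single Xp_single fock_scale_single single_add[symmetric] vop_hvar
    by (simp only:)
qed (simp add: push add_diff_add ac_simps)

lemma Xm_fvar: "Xm n (fvar v) = fvar (Xm n v) + Xm (n - 1) v"
proof (induction v rule: fock_induct)
  case (single m f)
  have "- n - 1 + (2 * m + i) + 1 = - (n - 1) - 1 + (2 * m + i)"
    by simp
  then show "Xm n (fvar (Poly_Mapping.single m f)) =
      fvar (Xm n (Poly_Mapping.single m f)) + Xm (n - 1) (Poly_Mapping.single m f)"
    unfolding fvar_single Xm_single single_add[symmetric] vop_hvar
    by (simp only: hconst_1 mult_1)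
qed (simp add: push add_diff_add ac_simps)

lemma Q_Q: "Q s (Q t v) = Q (s + t) v"
  by (induction v rule: fock_induct) (simp_all add: push q_partial_single hconst_mult_left distrib_right pw)

lemma Q_0: "Q 0 v = v"
  by (induction v rule: fock_induct) (simp_all add: push add_diff_add ac_simps q_partial_single)

lemma Q_Xp: "Q s (Xp n v) = (q powi (2 * s)) \<cdot> Xp n (Q s v)"
proof (induction v rule: fock_induct)
  case (single m f)
  have "q powi (s * (2 * (m + 1) + i)) = q powi (2 * s) * q powi (s * (2 * m + i))"
    by (simp add: algebra_simps flip: pw)
  then show "Q s (Xp n (Poly_Mapping.single m f)) = (q powi (2 * s)) \<cdot> Xp n (Q s (Poly_Mapping.single m f))"
    unfolding q_partial_single Xp_single fock_scale_single hlinear_scale[OF vop_linear]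
    by (simp only: hconst_mult mult.assoc)
qed (simp add: push add_diff_add ac_simps)

lemma Q_Xm: "Q s (Xm n v) = (q powi (- 2 * s)) \<cdot> Xm n (Q s v)"
proof (induction v rule: fock_induct)
  case (single m f)
  have "q powi (s * (2 * (m - 1) + i)) = q powi (- 2 * s) * q powi (s * (2 * m + i))"
    by (simp add: algebra_simps flip: pw)
  then show "Q s (Xm n (Poly_Mapping.single m f)) = (q powi (- 2 * s)) \<cdot> Xm n (Q s (Poly_Mapping.single m f))"
    unfolding q_partial_single Xm_single fock_scale_single hlinear_scale[OF vop_linear]
    by (simp only: hconst_mult mult.assoc)
qed (simp add: push add_diff_add ac_simps)

lemma Q_fderiv: "Q s (fderiv v) = fderiv (Q s v)"
  by (induction v rule: fock_induct) (simp_all add: push q_partial_single fderiv_single hlinear_scale[OF hlinear_hderiv])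

lemma Q_fvar: "Q s (fvar v) = fvar (Q s v)"
  by (induction v rule: fock_induct) (simp_all add: push add_diff_add ac_simps q_partial_single fvar_single mult.left_commute)

lemma G_G: "G s (G t v) = G (s + t) v"
proof (induction v rule: fock_induct)
  case (single m f)
  have "hgrade q s c (hgrade q t c f) = hgrade q (s + t) c f" for c
    by (intro poly_mapping_eqI)
      (simp only: lookup_hgrade mult.assoc[symmetric] pw[symmetric], simp add: algebra_simps)
  then show "G s (G t (Poly_Mapping.single m f)) = G (s + t) (Poly_Mapping.single m f)"
    by (simp add: q_grading_single)
qed (simp add: push add_diff_add ac_simps)

lemma G_0: "G 0 v = v"
proof (induction v rule: fock_induct)
  case (single m f)
  have "hgrade q 0 c f = f" for c
    by (intro poly_mapping_eqI) (simp add: lookup_hgrade)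
  then show "G 0 (Poly_Mapping.single m f) = Poly_Mapping.single m f"
    by (simp add: q_grading_single)
qed (simp add: push add_diff_add ac_simps)

lemma G_Q: "G s (Q t v) = Q t (G s v)"
  by (induction v rule: fock_induct) (simp_all add: push q_partial_single q_grading_single hlinear_scale[OF hgrade_linear])

lemma G_Xp: "G s (Xp n v) = (q powi (s * n)) \<cdot> Xp n (G s v)"
proof (induction v rule: fock_induct)
  case (single m f)
  \<comment> \<open>The lattice degree grows by 2m + 1 + i, which cancels all of the weight change
    except -n; the normalisation of \<open>q_grading\<close> is chosen for this.\<close>
  have e: "- s * (- n - 1 - (2 * m + i) + ((m + 1)\<^sup>2 + i * (m + 1)) - (m\<^sup>2 + i * m)) = s * n"
    by (simp add: power2_eq_square algebra_simps)
  show "G s (Xp n (Poly_Mapping.single m f)) = (q powi (s * n)) \<cdot> Xp n (G s (Poly_Mapping.single m f))"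
    unfolding q_grading_single Xp_single fock_scale_single
    by (subst hgrade_vop[OF nz(1), of _ _ _ _ _ _ "m\<^sup>2 + i * m"]) (simp only: e)
qed (simp add: push add_diff_add ac_simps)

lemma G_Xm: "G s (Xm n v) = (q powi (s * n)) \<cdot> Xm n (G s v)"
proof (induction v rule: fock_induct)
  case (single m f)
  have e: "- s * (- n - 1 + (2 * m + i) + ((m - 1)\<^sup>2 + i * (m - 1)) - (m\<^sup>2 + i * m)) = s * n"
    by (simp add: power2_eq_square algebra_simps)
  show "G s (Xm n (Poly_Mapping.single m f)) = (q powi (s * n)) \<cdot> Xm n (G s (Poly_Mapping.single m f))"
    unfolding q_grading_single Xm_single fock_scale_single
    by (subst hgrade_vop[OF nz(1), of _ _ _ _ _ _ "m\<^sup>2 + i * m"]) (simp only: e)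
qed (simp add: push add_diff_add ac_simps)

end

section \<open>Serre relations and the module structure\<close>

lemma fock_scale_uminus_left: "fock_scale (- c) v = - fock_scale c v"
  using fock_scale_add_left[of c "- c" v] by (simp add: eq_neg_iff_add_eq_0 add.commute)

text \<open>With \<open>L\<close> and \<open>R\<close> denoting left and right multiplication by \<open>x\<close>, the Serre expression is
  \<open>(L - R) (L - R / p) (L - p R) y\<close>, where \<open>p\<close> is \<open>q\<^sup>2\<close> or \<open>q\<^sup>-\<^sup>2\<close>. The three factors are applied
  one after the other.\<close>

lemma serre_by_factors:
  fixes x y h Z :: "'a::field_char_0 fock \<Rightarrow> 'a fock"
  assumes x: "flinear x"
    and y: "\<And>v. x (y v) = fock_scale p (y (x v)) + fock_scale c (h v)"
    and h: "\<And>v. x (h v) = h (x v) + fock_scale c' (Z v)"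
    and Z: "\<And>v. x (Z v) = fock_scale (inverse p) (Z (x v))"
    and p: "p \<noteq> 0" and t: "t = 1 + p + inverse p"
  shows "x (x (x (y v))) - fock_scale t (x (x (y (x v)))) + fock_scale t (x (y (x (x v)))) - y (x (x (x v))) = 0"
proof -
  \<comment> \<open>Scalars become elements of the commutative ring of Fock vectors, so that the
    remaining identity is polynomial and \<open>algebra\<close> can decide it.\<close>
  define s :: "'a \<Rightarrow> 'a fock" where "s c = Poly_Mapping.single 0 (Poly_Mapping.single 0 c)" for c
  have sc: "fock_scale c v = s c * v" for c v
    by (simp add: s_def fock_scale_def)
  have "s p * s (inverse p) = 1"
    using p by (simp add: s_def mult_single)
  moreover have "s t = 1 + s p + s (inverse p)"
    by (simp add: t s_def single_add)
  ultimately show ?thesis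
    \<comment> \<open>The rewrites push every x to the innermost place and leave combinations of y,
      h and Z applied to iterates of x.\<close>
    by (simp only: y h Z flinear_add[OF x] flinear_scale[OF x], simp only: sc) algebra
qed

context vertex_module
begin

lemma q2: "inverse (q\<^sup>2) * q\<^sup>2 = 1" "q\<^sup>2 * inverse (q\<^sup>2) = 1" "q\<^sup>2 \<noteq> 0"
  using nz(1) by simp_all

lemma Q_X:
  "Q 1 (Xp n v) = q\<^sup>2 \<cdot> Xp n (Q 1 v)" "Q (- 1) (Xp n v) = inverse (q\<^sup>2) \<cdot> Xp n (Q (- 1) v)"
  "Q 1 (Xm n v) = inverse (q\<^sup>2) \<cdot> Xm n (Q 1 v)" "Q (- 1) (Xm n v) = q\<^sup>2 \<cdot> Xm n (Q (- 1) v)"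
  unfolding Q_Xp Q_Xm by (simp_all add: power_int_def power_inverse)

lemma Q_inverse: "Q 1 (Q (- 1) v) = v" "Q (- 1) (Q 1 v) = v"
  by (simp_all add: Q_Q Q_0)

text \<open>The quantum integer [3] as 1 + p + 1/p, for p = q^2 and for p = q^(-2).\<close>

lemma q_int_3: "q_int q 3 = 1 + q\<^sup>2 + inverse (q\<^sup>2)" "q_int q 3 = 1 + inverse (q\<^sup>2) + inverse (inverse (q\<^sup>2))"
proof -
  have "q ^ 3 - inverse q ^ 3 = (1 + q\<^sup>2 + inverse (q\<^sup>2)) * (q - inverse q)"
    using nz(1) by (simp add: field_simps eval_nat_numeral)
  then show "q_int q 3 = 1 + q\<^sup>2 + inverse (q\<^sup>2)"
    using q_inverse by (simp add: q_int_def)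
  then show "q_int q 3 = 1 + inverse (q\<^sup>2) + inverse (inverse (q\<^sup>2))"
    by simp
qed

text \<open>The q-commutator of e_1 and e_0 is a multiple of \<open>fderiv\<close>; commuting it
  with e_1 gives the next mode \<open>Xp 1\<close>, which q-commutes with \<open>Xp 0\<close> by the
  quadratic relation.\<close>

lemma serre_e1:
  "Xp 0 (Xp 0 (Xp 0 (Xm 1 (Q (- 1) v)))) - q_int q 3 \<cdot> Xp 0 (Xp 0 (Xm 1 (Q (- 1) (Xp 0 v))))
   + q_int q 3 \<cdot> Xp 0 (Xm 1 (Q (- 1) (Xp 0 (Xp 0 v)))) - Xm 1 (Q (- 1) (Xp 0 (Xp 0 (Xp 0 v)))) = 0"
proof (rule serre_by_factors[where y = "\<lambda>v. Xm 1 (Q (- 1) v)" and h = fderiv and Z = "Xp 1"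
      and p = "q\<^sup>2" and c = "inverse q" and c' = "- crP q 1", OF X_plus_flinear _ _ _ q2(3) q_int_3(1)])
  fix v
  show "Xp 0 (Xm 1 (Q (- 1) v)) = q\<^sup>2 \<cdot> Xm 1 (Q (- 1) (Xp 0 v)) + inverse q \<cdot> fderiv v"
    using X_commutator_01[of "Q (- 1) v"] by (simp add: Q_X push q2 Q_fderiv Q_inverse diff_eq_eq add.commute)
  show "Xp 0 (fderiv v) = fderiv (Xp 0 v) + (- crP q 1) \<cdot> Xp 1 v"
    using fderiv_Xp[of 0 v] by (simp add: fock_scale_uminus_left)
  show "Xp 0 (Xp 1 v) = inverse (q\<^sup>2) \<cdot> Xp 1 (Xp 0 v)"
    using Xp_quadratic[of 0 v] by (simp add: push q2)
qed

text \<open>The same chain with the roles exchanged: commuting \<open>fderiv\<close> with e_0 gives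
  the mode \<open>Xm 2\<close>, and the twists by \<open>Q\<close> turn p into q^(-2).\<close>

lemma serre_e0:
  "Xm 1 (Q (- 1) (Xm 1 (Q (- 1) (Xm 1 (Q (- 1) (Xp 0 v)))))) - q_int q 3 \<cdot> Xm 1 (Q (- 1) (Xm 1 (Q (- 1) (Xp 0 (Xm 1 (Q (- 1) v))))))
   + q_int q 3 \<cdot> Xm 1 (Q (- 1) (Xp 0 (Xm 1 (Q (- 1) (Xm 1 (Q (- 1) v)))))) - Xp 0 (Xm 1 (Q (- 1) (Xm 1 (Q (- 1) (Xm 1 (Q (- 1) v)))))) = 0"
proof (rule serre_by_factors[where x = "\<lambda>v. Xm 1 (Q (- 1) v)" and y = "Xp 0" and h = fderiv and Z = "\<lambda>v. Xm 2 (Q (- 1) v)"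
      and p = "inverse (q\<^sup>2)" and c = "- (inverse (q\<^sup>2) * inverse q)" and c' = "- crM q 1", OF _ _ _ _ _ q_int_3(2)])
  show "flinear (\<lambda>v. Xm 1 (Q (- 1) v))"
    using flinear_comp[OF X_minus_flinear q_partial_flinear] by (simp add: comp_def)
  show "inverse (q\<^sup>2) \<noteq> 0"
    using q2(3) by simp
  fix v
  have "Xm 1 (Xp 0 (Q (- 1) v)) = Xp 0 (Xm 1 (Q (- 1) v)) - inverse q \<cdot> fderiv v"
    using X_commutator_01[of "Q (- 1) v"] by (simp add: Q_fderiv Q_inverse algebra_simps)
  then have "inverse (q\<^sup>2) \<cdot> Xm 1 (Xp 0 (Q (- 1) v)) = inverse (q\<^sup>2) \<cdot> (Xp 0 (Xm 1 (Q (- 1) v)) - inverse q \<cdot> fderiv v)"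
    by (simp only:)
  then show "Xm 1 (Q (- 1) (Xp 0 v)) = inverse (q\<^sup>2) \<cdot> Xp 0 (Xm 1 (Q (- 1) v)) + (- (inverse (q\<^sup>2) * inverse q)) \<cdot> fderiv v"
    by (simp add: Q_X push fock_scale_uminus_left)
  show "Xm 1 (Q (- 1) (fderiv v)) = fderiv (Xm 1 (Q (- 1) v)) + (- crM q 1) \<cdot> Xm 2 (Q (- 1) v)"
    using fderiv_Xm[of 1 "Q (- 1) v"] by (simp add: Q_fderiv fock_scale_uminus_left)
  show "Xm 1 (Q (- 1) (Xm 2 (Q (- 1) v))) = inverse (inverse (q\<^sup>2)) \<cdot> Xm 2 (Q (- 1) (Xm 1 (Q (- 1) v)))"
    using Xm_quadratic[of 1 "Q (- 1) (Q (- 1) v)"] by (simp add: Q_X push)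
qed

text \<open>For the f the q-commutator is a multiple of \<open>fvar\<close>, which lowers modes:
  commuting it with f_1 gives \<open>Xm (- 1)\<close>.\<close>

lemma serre_f1:
  "Xm 0 (Xm 0 (Xm 0 (Q 1 (Xp (- 1) v)))) - q_int q 3 \<cdot> Xm 0 (Xm 0 (Q 1 (Xp (- 1) (Xm 0 v))))
   + q_int q 3 \<cdot> Xm 0 (Q 1 (Xp (- 1) (Xm 0 (Xm 0 v)))) - Q 1 (Xp (- 1) (Xm 0 (Xm 0 (Xm 0 v)))) = 0"
proof (rule serre_by_factors[where y = "\<lambda>v. Q 1 (Xp (- 1) v)" and h = fvar and Z = "Xm (- 1)"
      and p = "q\<^sup>2" and c = "- (q\<^sup>2 * (q * (q + inverse q)))" and c' = 1, OF X_minus_flinear _ _ _ q2(3) q_int_3(1)])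
  fix v
  have "Xm 0 (Xp (- 1) v) = Xp (- 1) (Xm 0 v) - (q * (q + inverse q)) \<cdot> Q (- 1) (fvar v)"
    using X_commutator_m10[of v] by (simp add: algebra_simps)
  then have "q\<^sup>2 \<cdot> Q 1 (Xm 0 (Xp (- 1) v)) = q\<^sup>2 \<cdot> Q 1 (Xp (- 1) (Xm 0 v) - (q * (q + inverse q)) \<cdot> Q (- 1) (fvar v))"
    by (simp only:)
  moreover have "q\<^sup>2 \<cdot> Q 1 (Xm 0 (Xp (- 1) v)) = Xm 0 (Q 1 (Xp (- 1) v))"
    unfolding Q_X(3) by (simp add: q2 flip: fock_scale_mult)
  moreover have "q\<^sup>2 \<cdot> Q 1 (Xp (- 1) (Xm 0 v) - (q * (q + inverse q)) \<cdot> Q (- 1) (fvar v)) =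
      q\<^sup>2 \<cdot> Q 1 (Xp (- 1) (Xm 0 v)) - (q\<^sup>2 * (q * (q + inverse q))) \<cdot> fvar v"
    unfolding flinear_diff[OF q_partial_flinear] flinear_scale[OF q_partial_flinear] Q_inverse fock_scale_diff
      fock_scale_mult[symmetric] ..
  ultimately show "Xm 0 (Q 1 (Xp (- 1) v)) = q\<^sup>2 \<cdot> Q 1 (Xp (- 1) (Xm 0 v)) + (- (q\<^sup>2 * (q * (q + inverse q)))) \<cdot> fvar v"
    by (simp add: fock_scale_uminus_left)
  show "Xm 0 (fvar v) = fvar (Xm 0 v) + 1 \<cdot> Xm (- 1) v"
    using Xm_fvar[of 0 v] by simp
  show "Xm 0 (Xm (- 1) v) = inverse (q\<^sup>2) \<cdot> Xm (- 1) (Xm 0 v)"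
    using Xm_quadratic[of "- 1" v] by (simp add: push q2)
qed

text \<open>Commuting \<open>fvar\<close> with f_0 gives the mode \<open>Xp (- 2)\<close>, again
  with a twist by \<open>Q\<close>.\<close>

lemma serre_f0:
  "Q 1 (Xp (- 1) (Q 1 (Xp (- 1) (Q 1 (Xp (- 1) (Xm 0 v)))))) - q_int q 3 \<cdot> Q 1 (Xp (- 1) (Q 1 (Xp (- 1) (Xm 0 (Q 1 (Xp (- 1) v))))))
   + q_int q 3 \<cdot> Q 1 (Xp (- 1) (Xm 0 (Q 1 (Xp (- 1) (Q 1 (Xp (- 1) v)))))) - Xm 0 (Q 1 (Xp (- 1) (Q 1 (Xp (- 1) (Q 1 (Xp (- 1) v)))))) = 0"
proof (rule serre_by_factors[where x = "\<lambda>v. Q 1 (Xp (- 1) v)" and y = "Xm 0" and h = fvar and Z = "\<lambda>v. Q 1 (Xp (- 2) v)"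
      and p = "inverse (q\<^sup>2)" and c = "q * (q + inverse q)" and c' = "anP q 1", OF _ _ _ _ _ q_int_3(2)])
  show "flinear (\<lambda>v. Q 1 (Xp (- 1) v))"
    using flinear_comp[OF q_partial_flinear X_plus_flinear] by (simp add: comp_def)
  show "inverse (q\<^sup>2) \<noteq> 0"
    using q2(3) by simp
  fix v
  have "Xp (- 1) (Xm 0 v) = Xm 0 (Xp (- 1) v) + (q * (q + inverse q)) \<cdot> Q (- 1) (fvar v)"
    using X_commutator_m10[of v] by (simp add: algebra_simps)
  then have "Q 1 (Xp (- 1) (Xm 0 v)) = Q 1 (Xm 0 (Xp (- 1) v)) + (q * (q + inverse q)) \<cdot> fvar v"
    by (simp only: flinear_add[OF q_partial_flinear] flinear_scale[OF q_partial_flinear] Q_inverse)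
  then show "Q 1 (Xp (- 1) (Xm 0 v)) = inverse (q\<^sup>2) \<cdot> Xm 0 (Q 1 (Xp (- 1) v)) + (q * (q + inverse q)) \<cdot> fvar v"
    by (simp only: Q_X(3))
  show "Q 1 (Xp (- 1) (fvar v)) = fvar (Q 1 (Xp (- 1) v)) + anP q 1 \<cdot> Q 1 (Xp (- 2) v)"
    unfolding Xp_fvar by (simp add: push Q_fvar)
  have "Xp (- 1) (Xp (- 2) w) = q\<^sup>2 \<cdot> Xp (- 2) (Xp (- 1) w)" for w
    using Xp_quadratic[of "- 2" w] by simp
  then show "Q 1 (Xp (- 1) (Q 1 (Xp (- 2) v))) = inverse (inverse (q\<^sup>2)) \<cdot> Q 1 (Xp (- 2) (Q 1 (Xp (- 1) v)))"
    by (simp add: Q_X push)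
qed

lemma vector_space_fock: "vector_space (fock_scale :: 'a \<Rightarrow> 'a fock \<Rightarrow> 'a fock)"
  by unfold_locales (simp_all add: fock_scale_add fock_scale_add_left fock_scale_mult)

lemma linear_fock: "flinear T \<Longrightarrow> Vector_Spaces.linear fock_scale fock_scale (T :: 'a fock \<Rightarrow> 'a fock)"
  by (simp add: Vector_Spaces.linear_def module_hom_def module_hom_axioms_def vector_space_fock
      vector_space_fock[unfolded vector_space_def module_def] module_def flinear_def)

text \<open>For different indices both operators are adjacent modes of the same current, and the
  power of q from moving \<open>Q\<close> turns the commutator into the quadratic relation. For
  equal indices the claim is an instance of \<open>X_commutator\<close>.\<close>

lemma e_f_commutator:
  assumes "k < 2" "l < 2"
  shows "fock_e q i k (fock_f q i l v) - fock_f q i l (fock_e q i k v) =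
    (if k = l then (1 / (q - inverse q)) \<cdot> (fock_K q i k v - fock_Kinv q i k v) else 0)"
proof -
  consider "k = 0" "l = 0" | "k = 0" "l = 1" | "k = 1" "l = 0" | "k = 1" "l = 1"
    using assms by (auto simp: less_2_cases_iff)
  then show ?thesis
  proof cases
    case 1
    have "Xm 1 (Xp (- 1) v) - Xp (- 1) (Xm 1 v) = (1 / (q - inverse q)) \<cdot> (q \<cdot> Q (- 1) v - inverse q \<cdot> Q 1 v)"
      using X_commutator_m11[of v] by (simp add: fock_scale_diff algebra_simps)
    moreover have "Q 1 (Xp (- 1) (Xm 1 (Q (- 1) v))) = Xp (- 1) (Xm 1 v)"
      by (simp add: Q_X push Q_inverse q2)
    ultimately show ?thesis
      using 1 by (simp add: fock_e_def fock_f_def fock_K_def fock_Kinv_def Q_inverse)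
  next
    case 2
    then show ?thesis
      using Xm_quadratic[of 0 "Q (- 1) v"] by (simp add: fock_e_def fock_f_def Q_X push)
  next
    case 3
    then show ?thesis
      using Xp_quadratic[of "- 1" "Q 1 v"] by (simp add: fock_e_def fock_f_def Q_X push)
  next
    case 4
    then show ?thesis
      using X_commutator_00[of v] by (simp add: fock_e_def fock_f_def fock_K_def fock_Kinv_def)
  qed
qed

theorem fock_module:
  "Uq_sl2_hat_module fock_scale q (fock_e q i) (fock_f q i) (fock_K q i) (fock_Kinv q i) (G 1) (G (- 1))"
proof -
  note gens = fock_e_def fock_f_def fock_K_def fock_Kinv_def
  have qq: "inverse q * q = 1" "q * inverse q = 1"
    using nz(1) by simp_all
  have qq': "q * (inverse q * c) = c" "inverse q * (q * c) = c" "inverse (q\<^sup>2) * (q\<^sup>2 * c) = c" for c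
    using nz(1) by (simp_all flip: mult.assoc)
  have powi: "q powi 2 = q\<^sup>2" "q powi - 2 = inverse (q\<^sup>2)"
    by (simp_all add: power_int_def power_inverse)
  show ?thesis
  proof (intro Uq_sl2_hat_module.intro Uq_sl2_hat_module_axioms.intro vector_space_fock)
    fix k l :: nat and v
    show "Vector_Spaces.linear fock_scale fock_scale (fock_e q i k)"
      "Vector_Spaces.linear fock_scale fock_scale (fock_f q i k)"
      "Vector_Spaces.linear fock_scale fock_scale (fock_K q i k)"
      "Vector_Spaces.linear fock_scale fock_scale (fock_Kinv q i k)"
      by (auto simp: gens intro!: linear_fock flinear_comp flin)
    show "Vector_Spaces.linear fock_scale fock_scale (G 1)" "Vector_Spaces.linear fock_scale fock_scale (G (- 1))"
      by (auto intro!: linear_fock flin)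
    show "fock_K q i k (fock_Kinv q i k v) = v" "fock_Kinv q i k (fock_K q i k v) = v"
      by (simp_all add: gens push Q_inverse qq)
    show "G 1 (G (- 1) v) = v" "G (- 1) (G 1 v) = v"
      by (simp_all add: G_G G_0)
    show "fock_K q i k (fock_K q i l v) = fock_K q i l (fock_K q i k v)"
      by (simp add: gens push Q_Q)
    show "fock_K q i k (G 1 v) = G 1 (fock_K q i k v)"
      by (simp add: gens push G_Q)
    show "G 1 (fock_e q i k (G (- 1) v)) = (if k = 0 then q else 1) \<cdot> fock_e q i k v"
      "G 1 (fock_f q i k (G (- 1) v)) = (if k = 0 then inverse q else 1) \<cdot> fock_f q i k v"
      by (simp_all add: gens G_Xp G_Xm G_Q G_G G_0 push power_int_minus)
    assume "k < 2" "l < 2"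
    then have kl: "k = 0 \<or> k = 1" "l = 0 \<or> l = 1"
      by auto
    show "fock_K q i k (fock_e q i l (fock_Kinv q i k v)) = (q powi cartan k l) \<cdot> fock_e q i l v"
      "fock_K q i k (fock_f q i l (fock_Kinv q i k v)) = (q powi - cartan k l) \<cdot> fock_f q i l v"
      using kl by (auto simp: gens cartan_def Q_X push Q_inverse Q_Q Q_0 qq qq' q2 powi mult.assoc)
    show "fock_e q i k (fock_f q i l v) - fock_f q i l (fock_e q i k v) =
         (if k = l then (1 / (q - inverse q)) \<cdot> (fock_K q i k v - fock_Kinv q i k v) else 0)"
      using \<open>k < 2\<close> \<open>l < 2\<close> by (rule e_f_commutator)
    assume "k \<noteq> l"
    with kl consider "k = 0" "l = 1" | "k = 1" "l = 0"
      by auto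
    then show "fock_e q i k (fock_e q i k (fock_e q i k (fock_e q i l v)))
         - q_int q 3 \<cdot> fock_e q i k (fock_e q i k (fock_e q i l (fock_e q i k v)))
         + q_int q 3 \<cdot> fock_e q i k (fock_e q i l (fock_e q i k (fock_e q i k v)))
         - fock_e q i l (fock_e q i k (fock_e q i k (fock_e q i k v))) = 0"
      "fock_f q i k (fock_f q i k (fock_f q i k (fock_f q i l v)))
         - q_int q 3 \<cdot> fock_f q i k (fock_f q i k (fock_f q i l (fock_f q i k v)))
         + q_int q 3 \<cdot> fock_f q i k (fock_f q i l (fock_f q i k (fock_f q i k v)))
         - fock_f q i l (fock_f q i k (fock_f q i k (fock_f q i k v))) = 0"
      using serre_e0[of v] serre_e1[of v] serre_f0[of v] serre_f1[of v]
      by (cases; simp only: gens comp_def one_neq_zero refl if_True if_False)+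
  qed
qed

end

section \<open>Bernstein operators\<close>

text \<open>Bernstein's operator: with p_n^perp = n d/dp_n the generating series is exp (sum p_n z^n
  / n) exp (- sum p_n^perp z^(-n) / n).\<close>

definition bern :: "int \<Rightarrow> 'a::field_char_0 heis_sym \<Rightarrow> 'a heis_sym" where
  "bern = vop (\<lambda>n. 1 / of_nat n) (\<lambda>_. - 1)"

definition hsym :: "int \<Rightarrow> 'a::field_char_0 heis_sym" where
  "hsym = cre (\<lambda>n. 1 / of_nat n)"

text \<open>\<open>hskew k\<close> and \<open>eskew k\<close> are the operators adjoint to multiplication by \<open>h\<^sub>k\<close> and \<open>e\<^sub>k\<close>.\<close>

definition hskew :: "nat \<Rightarrow> 'a::field_char_0 heis_sym \<Rightarrow> 'a heis_sym" where
  "hskew = ann (\<lambda>_. 1)"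

definition eskew :: "nat \<Rightarrow> 'a::field_char_0 heis_sym \<Rightarrow> 'a heis_sym" where
  "eskew = ann (\<lambda>n. - ((- 1) ^ n))"

definition sfun :: "int list \<Rightarrow> 'a::field_char_0 heis_sym" where
  "sfun \<nu> = foldr bern \<nu> 1"

abbreviation "spart \<mu> \<equiv> sfun (map int \<mu>)"

lemma sexp_one: 
  assumes "\<And>n. n > 0 \<Longrightarrow> c n = - (u ^ n / of_nat n)"
  shows "sexp c r = (if r = 0 then 1 else if r = 1 then - u else 0)"
proof -
  have "c n = - ((u ^ n + 0 ^ n) / of_nat n)" if "n > 0" for n
    using assms[OF that] that by simp
  then show ?thesis
    using sexp_two[of u 0 r] by (subst sexp_cong) auto
qed

lemma bern_linear: "hlinear (bern a)"
  unfolding bern_def by (rule vop_linear)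

lemma hskew_linear: "hlinear (hskew k)"
  unfolding hskew_def by (rule ann_linear)

text \<open>The contraction is 1 - w, so B_k B_l is a difference of two normally ordered products,
  and the symmetry of these exchanges the two sides.\<close>

lemma bern_swap: "bern a (bern b f) = - bern (b - 1) (bern (a + 1) f)"
proof -
  let ?a = "\<lambda>n. 1 / of_nat n :: 'a" and ?b = "\<lambda>_. - 1 :: 'a"
  have "bern k (bern l f) = nop ?a ?b ?a ?b k l f - nop ?a ?b ?a ?b (k + 1) (l - 1) f" for k l
    unfolding bern_def by (subst vop_vop_two[where u = 1 and v = 0]) (auto simp: power_0_left)
  then show ?thesis
    by (simp add: nop_commute[of ?a ?b ?a ?b "b - 1"] nop_commute[of ?a ?b ?a ?b b])
qed

text \<open>The fixed point of \<open>bern_swap\<close>: the product equals its own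
  negative.\<close>

lemma bern_degenerate: "bern (b - 1) (bern b f) = 0"
proof -
  have "bern (b - 1) (bern b f) + bern (b - 1) (bern b f) = 0"
    using bern_swap[of "b - 1" b f] by (simp add: eq_neg_iff_add_eq_0)
  then have "hconst 2 * bern (b - 1) (bern b f) = hconst 2 * 0"
    using hconst_add[of 1 1] by (simp add: distrib_right)
  then show ?thesis
    by (rule hconst_cancel[rotated]) simp
qed

text \<open>The contraction is 1 / (1 - w). Multiplying by 1 - w replaces the long sum by a
  recursion with two terms, the form used for induction on the first part.\<close>

lemma hskew_bern:
  "hskew k (bern a f) = bern a (hskew k f) + (if k = 0 then 0 else hskew (k - 1) (bern (a - 1) f))"
proof -
  have *: "hskew k (bern a f) = (\<Sum>i\<le>k. bern (a - int i) (hskew (k - i) f))" for k a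
    unfolding hskew_def bern_def ann_vop using sexp_geometric[of "1 :: 'a"] by simp
  show ?thesis
  proof (cases k)
    case (Suc k')
    then show ?thesis
      unfolding * by (simp only: sum.atMost_Suc_shift) (simp add: algebra_simps)
  qed (simp add: hskew_def)
qed

text \<open>Here the contraction is 1 + w.\<close>

lemma eskew_bern:
  "eskew k (bern a f) = bern a (eskew k f) + (if k = 0 then 0 else bern (a - 1) (eskew (k - 1) f))"
proof -
  let ?g = "\<lambda>i::nat. if i = 0 then 1 else if i = 1 then 1 else 0 :: 'a"
  have "sexp (\<lambda>n. - ((- 1) ^ n) * (1 / of_nat n)) i = ?g i" for i
    by (subst sexp_one[where u = "- 1"]) auto
  then have "eskew k (bern a f) = (\<Sum>i\<le>k. hconst (?g i) * bern (a - int i) (eskew (k - i) f))"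
    unfolding eskew_def bern_def ann_vop by simp
  also have "\<dots> = (\<Sum>i\<in>(if k = 0 then {0} else {0, 1}). hconst (?g i) * bern (a - int i) (eskew (k - i) f))"
    by (rule sum.mono_neutral_right) auto
  also have "\<dots> = bern a (eskew k f) + (if k = 0 then 0 else bern (a - 1) (eskew (k - 1) f))"
    by auto
  finally show ?thesis .
qed

text \<open>The contraction between B and the h_j is 1 - w; its second term is brought to the other
  side.\<close>

lemma hsym_bern: "hsym j * bern a f = bern a (hsym j * f) + hsym (j - 1) * bern (a + 1) f"
proof -
  let ?g = "\<lambda>i::nat. if i = 0 then 1 else if i = 1 then - 1 else 0 :: 'a"
  have "sexp (\<lambda>n. - 1 * (1 / of_nat n)) i = ?g i" for i
    by (subst sexp_one[where u = 1]) auto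
  then have "bern a (hsym j * f) = (\<Sum>i\<le>nat j + 1. hconst (?g i) * (hsym (j - int i) * bern (a + int i) f))"
    unfolding bern_def hsym_def by (subst vop_cre_mult[of j "nat j + 1"]) (auto simp: mult.assoc)
  also have "\<dots> = (\<Sum>i\<in>{0, 1}. hconst (?g i) * (hsym (j - int i) * bern (a + int i) f))"
    by (rule sum.mono_neutral_right) auto
  also have "\<dots> = hsym j * bern a f - hsym (j - 1) * bern (a + 1) f"
    by (simp add: hconst_uminus)
  finally show ?thesis
    by simp
qed

lemma bern_1: "bern k 1 = hsym k"
  by (simp add: bern_def hsym_def vop_1)

lemma hsym_neg: "k < 0 \<Longrightarrow> hsym k = 0" and hsym_0 [simp]: "hsym 0 = 1"
  by (simp_all add: hsym_def cre_neg)

lemma hwt_sfun: "hwt (\<lambda>w. w = sum_list \<nu>) (sfun \<nu> :: 'a::field_char_0 heis_sym)"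
proof (induction \<nu>)
  case (Cons a \<nu>)
  have "hwt (\<lambda>w. w - a = sum_list \<nu>) (bern a (sfun \<nu> :: 'a heis_sym))"
    unfolding bern_def by (rule hwt_vop[of "\<lambda>w. w = sum_list \<nu>", OF Cons])
  then show ?case
    by (auto simp: sfun_def elim!: hwt_mono)
qed (use hwt_hconst[of "\<lambda>w. w = 0" 1] in \<open>simp add: sfun_def\<close>)

section \<open>Partitions\<close>

lemma is_partition_Nil [simp]: "is_partition []"
  by (simp add: is_partition_def)

lemma is_partition_Cons: "is_partition (a # \<mu>) \<longleftrightarrow> a > 0 \<and> first_part \<mu> \<le> a \<and> is_partition \<mu>"
proof -
  have "is_partition (a # \<mu>) \<longleftrightarrow> a > 0 \<and> (\<forall>x\<in>set \<mu>. x \<le> a) \<and> is_partition \<mu>"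
    unfolding is_partition_def by simp blast
  moreover have "(\<forall>x\<in>set \<mu>. x \<le> a) \<longleftrightarrow> first_part \<mu> \<le> a" if "is_partition \<mu>"
  proof (cases \<mu>)
    case (Cons b \<nu>)
    then have "\<forall>x\<in>set \<nu>. x \<le> b"
      using that by (simp add: is_partition_def)
    then show ?thesis
      using Cons by (auto simp: first_part_def)
  qed (simp add: first_part_def)
  ultimately show ?thesis
    by blast
qed

lemma first_part_simps [simp]: "first_part [] = 0" "first_part (a # \<mu>) = a"
  by (simp_all add: first_part_def)

lemma first_part_eq_0: "is_partition \<mu> \<Longrightarrow> first_part \<mu> = 0 \<longleftrightarrow> \<mu> = []"
  by (cases \<mu>) (auto simp: is_partition_Cons)

lemma is_partition_tl: "is_partition \<mu> \<Longrightarrow> is_partition (tl \<mu>) \<and> first_part (tl \<mu>) \<le> first_part \<mu>"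
  by (cases \<mu>) (auto simp: is_partition_Cons)

lemma sum_list_tl: "sum_list (\<mu> :: nat list) = first_part \<mu> + sum_list (tl \<mu>)"
  by (cases \<mu>) auto

text \<open>Partitions carry no zero parts. When a bounds the parts of the partition, a = 0 forces
  it to be empty, and B_0 1 = 1 agrees with returning the empty list.\<close>

definition pcons :: "nat \<Rightarrow> nat list \<Rightarrow> nat list" where
  "pcons a \<mu> = (if a = 0 then [] else a # \<mu>)"

lemma pcons_simps:
  assumes "is_partition \<mu>" "first_part \<mu> \<le> a"
  shows "is_partition (pcons a \<mu>)" "first_part (pcons a \<mu>) = a" "tl (pcons a \<mu>) = \<mu>"
    "sum_list (pcons a \<mu>) = a + sum_list \<mu>" "spart (pcons a \<mu>) = bern (int a) (spart \<mu>)"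
  using assms by (auto simp: pcons_def is_partition_Cons first_part_eq_0 sfun_def bern_1)

lemma pcons_first_tl: "is_partition \<mu> \<Longrightarrow> pcons (first_part \<mu>) (tl \<mu>) = \<mu>"
  by (cases \<mu>) (auto simp: pcons_def is_partition_Cons)

text \<open>Either \<open>bern_degenerate\<close> applies, or the partition is empty and the value
  is h_(-1) = 0.\<close>

lemma bern_below_first:
  assumes "is_partition \<mu>" "k = int (first_part \<mu>) - 1"
  shows "bern k (spart \<mu>) = 0"
  using assms by (cases \<mu>) (auto simp: sfun_def bern_1 hsym_neg bern_degenerate)

lemma finite_partitions: "finite {\<kappa>. is_partition \<kappa> \<and> sum_list \<kappa> \<le> n}"
proof (rule finite_subset)
  show "{\<kappa>. is_partition \<kappa> \<and> sum_list \<kappa> \<le> n} \<subseteq> (\<Union>r\<le>n. {ns. 0 \<notin> set ns \<and> sum_list ns = r})"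
    by (auto simp: is_partition_def)
qed (auto intro: finite_compositions)

text \<open>Interlacing conditions with missing parts read as 0; \<open>horizontal_strip_iff\<close>
  and \<open>vertical_strip_iff\<close> compare them with the conditions on boxes. In this form
  strips are peeled off row by row.\<close>

definition hstrip :: "nat list \<Rightarrow> nat list \<Rightarrow> bool" where
  "hstrip \<kappa> \<rho> \<longleftrightarrow> (\<forall>i. nth_default 0 \<rho> i \<le> nth_default 0 \<kappa> i \<and> nth_default 0 \<kappa> (Suc i) \<le> nth_default 0 \<rho> i)"

definition vstrip :: "nat list \<Rightarrow> nat list \<Rightarrow> bool" where
  "vstrip \<kappa> \<rho> \<longleftrightarrow> (\<forall>i. nth_default 0 \<rho> i \<le> nth_default 0 \<kappa> i \<and> nth_default 0 \<kappa> i \<le> Suc (nth_default 0 \<rho> i))"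

lemma nth_default_first: "nth_default 0 \<mu> 0 = first_part \<mu>"
  and nth_default_tl: "nth_default 0 \<mu> (Suc i) = nth_default 0 (tl \<mu>) i"
  by (cases \<mu>; simp)+

lemma all_nat_split: "(\<forall>i. P i) \<longleftrightarrow> P 0 \<and> (\<forall>i. P (Suc i))"
  by (metis nat.exhaust)

lemma hstrip_rec:
  "hstrip \<kappa> \<rho> \<longleftrightarrow> first_part \<rho> \<le> first_part \<kappa> \<and> first_part (tl \<kappa>) \<le> first_part \<rho> \<and> hstrip (tl \<kappa>) (tl \<rho>)"
  unfolding hstrip_def by (subst all_nat_split) (auto simp: nth_default_first nth_default_tl)

lemma vstrip_rec:
  "vstrip \<kappa> \<rho> \<longleftrightarrow> first_part \<rho> \<le> first_part \<kappa> \<and> first_part \<kappa> \<le> Suc (first_part \<rho>) \<and> vstrip (tl \<kappa>) (tl \<rho>)"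
  unfolding vstrip_def by (subst all_nat_split) (auto simp: nth_default_first nth_default_tl)

lemma hstrip_Nil_left: "is_partition \<rho> \<Longrightarrow> hstrip [] \<rho> \<longleftrightarrow> \<rho> = []"
  by (cases \<rho>) (auto simp: hstrip_rec[of "[]" "_ # _"] is_partition_Cons, simp add: hstrip_def)

lemma hstrip_Nil_right: "is_partition \<kappa> \<Longrightarrow> hstrip \<kappa> [] \<longleftrightarrow> tl \<kappa> = []"
proof (induction \<kappa>)
  case (Cons a \<kappa>)
  have "is_partition \<kappa>" "first_part \<kappa> = 0 \<longleftrightarrow> \<kappa> = []"
    using Cons.prems by (auto simp: is_partition_Cons first_part_eq_0)
  with Cons.IH show ?case
    by (auto simp: hstrip_rec[of "_ # _"])
qed (simp add: hstrip_def)

lemma vstrip_Nil_left: "is_partition \<rho> \<Longrightarrow> vstrip [] \<rho> \<longleftrightarrow> \<rho> = []"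
  by (cases \<rho>) (auto simp: vstrip_rec[of "[]" "_ # _"] is_partition_Cons, simp add: vstrip_def)

lemma hstrip_sum_le: "hstrip \<kappa> \<rho> \<Longrightarrow> sum_list \<rho> \<le> sum_list \<kappa>"
proof (induction \<rho> arbitrary: \<kappa>)
  case (Cons a \<rho>)
  then have "sum_list \<rho> \<le> sum_list (tl \<kappa>)" "a \<le> first_part \<kappa>"
    using hstrip_rec[of \<kappa> "a # \<rho>"] by auto
  then show ?case
    by (simp add: sum_list_tl[of \<kappa>])
qed simp

lemma vstrip_sum_le: "vstrip \<kappa> \<rho> \<Longrightarrow> sum_list \<rho> \<le> sum_list \<kappa>"
proof (induction \<rho> arbitrary: \<kappa>)
  case (Cons a \<rho>)
  then have "sum_list \<rho> \<le> sum_list (tl \<kappa>)" "a \<le> first_part \<kappa>"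
    using vstrip_rec[of \<kappa> "a # \<rho>"] by auto
  then show ?case
    by (simp add: sum_list_tl[of \<kappa>])
qed simp

section \<open>Branching and Pieri rules\<close>

text \<open>\<open>hskew_bern\<close> lowers the first part of the shape and the number of boxes to
  be removed by one each. Iterating it runs through the possible first parts of the smaller
  partition, while the inner induction hypothesis treats the remaining rows.\<close>

theorem hskew_spart:
  assumes "is_partition \<mu>"
  shows "hskew k (spart \<mu> :: 'a::field_char_0 heis_sym) = (\<Sum>\<kappa> | is_partition \<kappa> \<and> hstrip \<mu> \<kappa> \<and> sum_list \<kappa> + k = sum_list \<mu>. spart \<kappa>)"
  using assms
proof (induction \<mu> arbitrary: k)
  case Nil
  have "{\<kappa>. is_partition \<kappa> \<and> hstrip [] \<kappa> \<and> sum_list \<kappa> + k = sum_list ([] :: nat list)} = (if k = 0 then {[]} else {})"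
    using hstrip_Nil_left by auto
  then show ?case
    by (simp add: sfun_def hskew_def ann_1)
next
  case (Cons b \<mu>)
  let ?s = "\<lambda>\<kappa>. spart \<kappa> :: 'a heis_sym"
  let ?S = "\<lambda>k \<mu>. {\<kappa>. is_partition \<kappa> \<and> hstrip \<mu> \<kappa> \<and> sum_list \<kappa> + k = sum_list \<mu>}"
  have \<mu>: "is_partition \<mu>" "first_part \<mu> \<le> b" "b > 0"
    using Cons.prems by (auto simp: is_partition_Cons)
  note IH = Cons.IH[OF \<mu>(1)]
  have fin: "finite (?S k \<mu>)" for k \<mu>
    by (rule finite_subset[OF _ finite_partitions[of "sum_list \<mu>"]]) auto
  have rec: "hstrip (pcons a \<mu>) \<kappa> \<longleftrightarrow> first_part \<kappa> \<le> a \<and> first_part \<mu> \<le> first_part \<kappa> \<and> hstrip \<mu> (tl \<kappa>)"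
    if "first_part \<mu> \<le> a" for a \<kappa>
    using pcons_simps[OF \<mu>(1) that] by (subst hstrip_rec) auto
  \<comment> \<open>Partitions that keep the full first part a are an arbitrary strip of \<mu> below
    it, which is the term where \<open>bern\<close> has moved to the left.\<close>
  have top: "(\<Sum>\<kappa> | \<kappa> \<in> ?S k (pcons a \<mu>) \<and> first_part \<kappa> = a. ?s \<kappa>) = bern (int a) (hskew k (?s \<mu>))"
    if a: "first_part \<mu> \<le> a" for a k
  proof -
    have first: "first_part \<nu> \<le> a" if "\<nu> \<in> ?S k \<mu>" for \<nu>
      using that a hstrip_rec[of \<mu> \<nu>] by auto
    have "(\<Sum>\<kappa> | \<kappa> \<in> ?S k (pcons a \<mu>) \<and> first_part \<kappa> = a. ?s \<kappa>) = (\<Sum>\<nu>\<in>?S k \<mu>. bern (int a) (?s \<nu>))"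
    proof (rule sum.reindex_bij_witness[of _ "pcons a" tl])
      fix \<kappa> assume \<kappa>: "\<kappa> \<in> {\<kappa>. \<kappa> \<in> ?S k (pcons a \<mu>) \<and> first_part \<kappa> = a}"
      then show "pcons a (tl \<kappa>) = \<kappa>"
        using pcons_first_tl by auto
      with \<kappa> show "tl \<kappa> \<in> ?S k \<mu>"
        using is_partition_tl[of \<kappa>] rec[OF a, of \<kappa>] pcons_simps[OF \<mu>(1) a] pcons_simps[of "tl \<kappa>" a] sum_list_tl[of \<kappa>] by auto
      show "bern (int a) (?s (tl \<kappa>)) = ?s \<kappa>"
        using pcons_simps(5)[of "tl \<kappa>" a, where ?'a = 'a] is_partition_tl[of \<kappa>] \<kappa> \<open>pcons a (tl \<kappa>) = \<kappa>\<close> by auto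
    next
      fix \<nu> assume \<nu>: "\<nu> \<in> ?S k \<mu>"
      then show "tl (pcons a \<nu>) = \<nu>" "pcons a \<nu> \<in> {\<kappa>. \<kappa> \<in> ?S k (pcons a \<mu>) \<and> first_part \<kappa> = a}"
        using pcons_simps[of \<nu> a] first[of \<nu>] rec[OF a, of "pcons a \<nu>"] a pcons_simps[OF \<mu>(1) a] by auto
    qed
    then show ?thesis
      by (simp add: IH hlinear_sum bern_linear)
  qed
  \<comment> \<open>The first part is generalised to any a that bounds \<mu>, so that induction can
    descend through the values of a.\<close>
  have "hskew k (bern (int a) (?s \<mu>)) = (\<Sum>\<kappa>\<in>?S k (pcons a \<mu>). ?s \<kappa>)" if "first_part \<mu> \<le> a" for a k
    using that
  proof (induction a arbitrary: k)
    case base: 0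
    have "?S k (pcons 0 \<mu>) = {\<kappa>. \<kappa> \<in> ?S k (pcons 0 \<mu>) \<and> first_part \<kappa> = 0}"
      using rec[OF base] by auto
    then have "(\<Sum>\<kappa>\<in>?S k (pcons 0 \<mu>). ?s \<kappa>) = bern (int 0) (hskew k (?s \<mu>))"
      using top[OF base, of k] by simp
    moreover have "bern (int 0 - 1) (?s \<mu>) = 0"
      by (rule bern_below_first[OF \<mu>(1)]) (use base in simp)
    ultimately show ?case
      by (subst hskew_bern) (simp add: hlinear_0 hskew_linear)
  next
    case step: (Suc a)
    let ?low = "if k = 0 then {} else ?S (k - 1) (pcons a \<mu>)"
    have fp: "first_part \<mu> \<le> Suc a" by (rule step.prems)
    show ?case
    \<comment> \<open>If \<mu> begins with \<open>Suc a\<close>, the lowered operator kills its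
      Schur function, and accordingly no strip leaves a shorter first row.\<close>
    proof (cases "first_part \<mu> = Suc a")
      case True
      have "?S k (pcons (Suc a) \<mu>) = {\<kappa>. \<kappa> \<in> ?S k (pcons (Suc a) \<mu>) \<and> first_part \<kappa> = Suc a}"
        using rec[OF fp] True by auto
      then have "(\<Sum>\<kappa>\<in>?S k (pcons (Suc a) \<mu>). ?s \<kappa>) = bern (int (Suc a)) (hskew k (?s \<mu>))"
        using top[OF fp, of k] by simp
      moreover have "bern (int (Suc a) - 1) (?s \<mu>) = 0"
        by (rule bern_below_first[OF \<mu>(1)]) (use True in simp)
      ultimately show ?thesis
        by (subst hskew_bern) (simp only: hlinear_0[OF hskew_linear] if_cancel add_0_right)
    next
      case False
      with fp have a: "first_part \<mu> \<le> a" by simp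
      \<comment> \<open>Leaving a first part of at most a means having lost one box of the first row
        already: a strip of the shape with first part a and k - 1 boxes.\<close>
      have split: "?S k (pcons (Suc a) \<mu>) = {\<kappa>. \<kappa> \<in> ?S k (pcons (Suc a) \<mu>) \<and> first_part \<kappa> = Suc a} \<union> ?low"
      proof (intro set_eqI)
        fix \<kappa>
        have "k \<noteq> 0" if "hstrip (pcons a \<mu>) \<kappa>" "sum_list \<kappa> + k = Suc a + sum_list \<mu>"
          using hstrip_sum_le[OF that(1)] that(2) pcons_simps(4)[OF \<mu>(1) a] by auto
        then show "\<kappa> \<in> ?S k (pcons (Suc a) \<mu>) \<longleftrightarrow> \<kappa> \<in> {\<kappa>. \<kappa> \<in> ?S k (pcons (Suc a) \<mu>) \<and> first_part \<kappa> = Suc a} \<union> ?low"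
          using rec[OF fp, of \<kappa>] rec[OF a, of \<kappa>] pcons_simps(4)[OF \<mu>(1) a] pcons_simps(4)[OF \<mu>(1) fp]
          by (auto simp: le_Suc_eq)
      qed
      have finlow: "finite ?low"
        by (simp only: fin finite.emptyI split: if_splits) simp
      have disj: "{\<kappa>. \<kappa> \<in> ?S k (pcons (Suc a) \<mu>) \<and> first_part \<kappa> = Suc a} \<inter> ?low = {}"
        using rec[OF a] by auto
      have "(\<Sum>\<kappa>\<in>?S k (pcons (Suc a) \<mu>). ?s \<kappa>) =
          (\<Sum>\<kappa> | \<kappa> \<in> ?S k (pcons (Suc a) \<mu>) \<and> first_part \<kappa> = Suc a. ?s \<kappa>) + (\<Sum>\<kappa>\<in>?low. ?s \<kappa>)"
        by (subst split) (rule sum.union_disjoint[OF finite_subset[OF _ fin[of "pcons (Suc a) \<mu>" k]] finlow disj], blast)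
      also have "\<dots> = hskew k (bern (int (Suc a)) (?s \<mu>))"
        unfolding top[OF fp] hskew_bern[of k "int (Suc a)"] using step.IH[OF a, of "k - 1"] by auto
      finally show ?thesis ..
    qed
  qed
  from this[OF \<mu>(2), of k] show ?case
    using \<mu>(3) pcons_simps(5)[OF \<mu>(1,2)] by (simp add: pcons_def sfun_def)
qed

text \<open>The two terms of \<open>eskew_bern\<close> are the two choices in the first row: it
  keeps its length or loses one box.\<close>

theorem eskew_spart:
  assumes "is_partition \<mu>"
  shows "eskew k (spart \<mu> :: 'a::field_char_0 heis_sym) =
    (\<Sum>\<kappa> | is_partition \<kappa> \<and> vstrip \<mu> \<kappa> \<and> sum_list \<kappa> + k = sum_list \<mu>. spart \<kappa>)"
  using assms
proof (induction \<mu> arbitrary: k)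
  case Nil
  have "{\<kappa>. is_partition \<kappa> \<and> vstrip [] \<kappa> \<and> sum_list \<kappa> + k = sum_list ([] :: nat list)} = (if k = 0 then {[]} else {})"
    using vstrip_Nil_left by auto
  then show ?case
    by (simp add: sfun_def eskew_def ann_1)
next
  case (Cons a \<mu>)
  let ?s = "\<lambda>\<kappa>. spart \<kappa> :: 'a heis_sym"
  let ?S = "\<lambda>k \<mu>. {\<kappa>. is_partition \<kappa> \<and> vstrip \<mu> \<kappa> \<and> sum_list \<kappa> + k = sum_list \<mu>}"
  have \<mu>: "is_partition \<mu>" "first_part \<mu> \<le> a" "a > 0"
    using Cons.prems by (auto simp: is_partition_Cons)
  note IH = Cons.IH[OF \<mu>(1)]
  have fin: "finite (?S k \<mu>)" for k \<mu>
    by (rule finite_subset[OF _ finite_partitions[of "sum_list \<mu>"]]) auto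
  have rec: "vstrip (a # \<mu>) \<kappa> \<longleftrightarrow> (first_part \<kappa> = a \<or> first_part \<kappa> = a - 1) \<and> vstrip \<mu> (tl \<kappa>)" for \<kappa>
    using \<mu>(3) by (subst vstrip_rec) auto
  \<comment> \<open>c is the new first part and j the number of boxes still to be removed from the
    lower rows.\<close>
  have part: "(\<Sum>\<kappa> | \<kappa> \<in> ?S k (a # \<mu>) \<and> first_part \<kappa> = c. ?s \<kappa>) = bern (int c) (eskew j (?s \<mu>))"
    if c: "c = a \<and> j = k \<or> c = a - 1 \<and> k = Suc j" for c j
  proof -
    have le: "first_part \<nu> \<le> Suc c" if "\<nu> \<in> ?S j \<mu>" for \<nu>
      using that c \<mu>(2) vstrip_rec[of \<mu> \<nu>] by auto
    \<comment> \<open>For c = a - 1 the second row may still have length c + 1; those terms vanish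
      by \<open>bern_below_first\<close>.\<close>
    have "(\<Sum>\<nu>\<in>?S j \<mu>. bern (int c) (?s \<nu>)) = (\<Sum>\<nu> | \<nu> \<in> ?S j \<mu> \<and> first_part \<nu> \<le> c. bern (int c) (?s \<nu>))"
    proof (intro sum.mono_neutral_right ballI)
      fix \<nu> assume \<nu>: "\<nu> \<in> ?S j \<mu> - {\<nu>. \<nu> \<in> ?S j \<mu> \<and> first_part \<nu> \<le> c}"
      then have "first_part \<nu> = Suc c"
        using le[of \<nu>] by auto
      then show "bern (int c) (?s \<nu>) = 0"
        using \<nu> by (intro bern_below_first) auto
    qed (auto simp: fin)
    also have "\<dots> = (\<Sum>\<kappa> | \<kappa> \<in> ?S k (a # \<mu>) \<and> first_part \<kappa> = c. ?s \<kappa>)"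
    proof (rule sum.reindex_bij_witness[of _ tl "pcons c"])
      fix \<kappa> assume \<kappa>: "\<kappa> \<in> {\<kappa>. \<kappa> \<in> ?S k (a # \<mu>) \<and> first_part \<kappa> = c}"
      then show "pcons c (tl \<kappa>) = \<kappa>"
        using pcons_first_tl by auto
      show "tl \<kappa> \<in> {\<nu>. \<nu> \<in> ?S j \<mu> \<and> first_part \<nu> \<le> c}"
        using \<kappa> c \<mu>(3) rec[of \<kappa>] is_partition_tl[of \<kappa>] sum_list_tl[of \<kappa>] by auto
    next
      fix \<nu> assume \<nu>: "\<nu> \<in> {\<nu>. \<nu> \<in> ?S j \<mu> \<and> first_part \<nu> \<le> c}"
      then have p: "is_partition \<nu>" "first_part \<nu> \<le> c"
        by auto
      show "tl (pcons c \<nu>) = \<nu>"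
        using pcons_simps[OF p] by simp
      show "pcons c \<nu> \<in> {\<kappa>. \<kappa> \<in> ?S k (a # \<mu>) \<and> first_part \<kappa> = c}"
        using \<nu> c \<mu>(3) rec[of "pcons c \<nu>"] pcons_simps(1-4)[OF p] by auto
      show "?s (pcons c \<nu>) = bern (int c) (?s \<nu>)"
        by (rule pcons_simps(5)[OF p])
    qed
    finally show ?thesis
      by (simp add: IH hlinear_sum bern_linear)
  qed
  let ?low = "{\<kappa>. \<kappa> \<in> ?S k (a # \<mu>) \<and> first_part \<kappa> = a - 1}"
  have "?S k (a # \<mu>) = {\<kappa>. \<kappa> \<in> ?S k (a # \<mu>) \<and> first_part \<kappa> = a} \<union> ?low"
    using rec by auto
  then have "(\<Sum>\<kappa>\<in>?S k (a # \<mu>). ?s \<kappa>) = (\<Sum>\<kappa> | \<kappa> \<in> ?S k (a # \<mu>) \<and> first_part \<kappa> = a. ?s \<kappa>) + sum ?s ?low"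
    by (rule ssubst, intro sum.union_disjoint)
      (use \<mu>(3) in \<open>auto intro: finite_subset[OF _ fin[of "a # \<mu>" k]]\<close>)
  also have "sum ?s ?low = (if k = 0 then 0 else bern (int (a - 1)) (eskew (k - 1) (?s \<mu>)))"
  proof (cases k)
    case 0
    have "?low = {}"
    proof (rule equals0I)
      fix \<kappa> assume "\<kappa> \<in> ?low"
      then have "vstrip \<mu> (tl \<kappa>)" "sum_list \<kappa> = a + sum_list \<mu>" "first_part \<kappa> = a - 1"
        using 0 rec[of \<kappa>] by auto
      then show False
        using vstrip_sum_le[of \<mu> "tl \<kappa>"] sum_list_tl[of \<kappa>] \<mu>(3) by simp
    qed
    then show ?thesis
      using 0 by (simp only: sum.empty if_True refl)
  next
    case (Suc j)
    then show ?thesis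
      using part[of "a - 1" j] by simp
  qed
  also have "(\<Sum>\<kappa> | \<kappa> \<in> ?S k (a # \<mu>) \<and> first_part \<kappa> = a. ?s \<kappa>) = bern (int a) (eskew k (?s \<mu>))"
    by (rule part) simp
  finally have "(\<Sum>\<kappa>\<in>?S k (a # \<mu>). ?s \<kappa>) = eskew k (bern (int a) (?s \<mu>))"
    using \<mu>(3) by (simp add: eskew_bern of_nat_diff)
  then show ?case
    by (simp add: sfun_def)
qed

text \<open>By \<open>hsym_bern\<close> the product is B_a applied to the Pieri expansion of the
  lower rows plus a product with fewer boxes and a longer first row. The tuples that are not
  partitions in the first sum cancel, by straightening, the surplus partitions in the
  second.\<close>

theorem pieri:
  assumes "is_partition \<rho>"
  shows "hsym (int j) * (spart \<rho> :: 'a::field_char_0 heis_sym) =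
    (\<Sum>\<kappa> | is_partition \<kappa> \<and> hstrip \<kappa> \<rho> \<and> sum_list \<kappa> = sum_list \<rho> + j. spart \<kappa>)"
  using assms
proof (induction \<rho> arbitrary: j)
  case Nil
  have "{\<kappa>. is_partition \<kappa> \<and> hstrip \<kappa> [] \<and> sum_list \<kappa> = sum_list ([] :: nat list) + j} = {pcons j []}"
  proof (intro set_eqI)
    fix \<kappa>
    show "\<kappa> \<in> {\<kappa>. is_partition \<kappa> \<and> hstrip \<kappa> [] \<and> sum_list \<kappa> = sum_list ([] :: nat list) + j} \<longleftrightarrow> \<kappa> \<in> {pcons j []}"
      using hstrip_Nil_right[of \<kappa>] hstrip_Nil_right[of "pcons j []"] pcons_simps[of "[]" j] pcons_first_tl[of \<kappa>] sum_list_tl[of \<kappa>]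
      by auto
  qed
  then show ?case
    using pcons_simps(5)[of "[]" j, where ?'a = 'a] by (simp add: sfun_def bern_1)
next
  case (Cons b \<mu>)
  let ?s = "\<lambda>\<kappa>. spart \<kappa> :: 'a heis_sym"
  let ?U = "\<lambda>j \<rho>. {\<kappa>. is_partition \<kappa> \<and> hstrip \<kappa> \<rho> \<and> sum_list \<kappa> = sum_list \<rho> + j}"
  have \<mu>: "is_partition \<mu>" "first_part \<mu> \<le> b" "b > 0"
    using Cons.prems by (auto simp: is_partition_Cons)
  note IH = Cons.IH[OF \<mu>(1)]
  have fin: "finite (?U j \<mu>)" for j \<mu>
    by (rule finite_subset[OF _ finite_partitions[of "sum_list \<mu> + j"]]) auto
  have rec: "hstrip \<kappa> (a # \<mu>) \<longleftrightarrow> a \<le> first_part \<kappa> \<and> first_part (tl \<kappa>) \<le> a \<and> hstrip (tl \<kappa>) \<mu>" for a \<kappa>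
    by (subst hstrip_rec) auto
  \<comment> \<open>a is left arbitrary because the step to \<open>Suc j\<close> uses the hypothesis
    at \<open>Suc a\<close>.\<close>
  have "hsym (int j) * bern (int a) (?s \<mu>) = (\<Sum>\<kappa>\<in>?U j (a # \<mu>). ?s \<kappa>)" if "first_part \<mu> \<le> a" "a > 0" for a j
    using that
  proof (induction j arbitrary: a)
    case 0
    have "?U 0 (a # \<mu>) = {a # \<mu>}"
    proof -
      have "\<kappa> = \<rho>" if "hstrip \<kappa> \<rho>" "sum_list \<kappa> = sum_list \<rho>" "is_partition \<kappa>" "is_partition \<rho>" for \<kappa> \<rho>
        using that
      proof (induction \<rho> arbitrary: \<kappa>)
        case Nil
        then show ?case
          by (cases \<kappa>) (auto simp: is_partition_Cons)
      next
        case (Cons c \<rho>)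
        have h: "c \<le> first_part \<kappa>" "hstrip (tl \<kappa>) \<rho>"
          using Cons.prems(1) hstrip_rec[of \<kappa> "c # \<rho>"] by auto
        have "sum_list \<rho> \<le> sum_list (tl \<kappa>)"
          using h(2) by (rule hstrip_sum_le)
        then have "first_part \<kappa> = c" "sum_list (tl \<kappa>) = sum_list \<rho>"
          using Cons.prems(2) h(1) by (auto simp: sum_list_tl[of \<kappa>])
        then show ?case
          using Cons.IH[OF h(2)] Cons.prems(3,4) is_partition_tl[of \<kappa>] pcons_first_tl[of \<kappa>]
          by (auto simp: is_partition_Cons pcons_def)
      qed
      moreover have "hstrip \<rho> \<rho>" if "is_partition \<rho>" for \<rho>
        using that by (induction \<rho>) (auto simp: hstrip_rec[of "_ # _"] is_partition_Cons, simp add: hstrip_def)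
      ultimately show ?thesis
        using 0 \<mu>(1) by (auto simp: is_partition_Cons)
    qed
    then show ?case
      by (simp add: sfun_def)
  next
    case (Suc j)
    have a: "first_part \<mu> \<le> a" "a > 0"
      by (rule Suc.prems)+
    \<comment> \<open>\<open>?X\<close> and \<open>?X'\<close> split the terms of B_a (h_(j+1)
      s_\<mu>), \<open>?Y\<close> and \<open>?Y'\<close> those of h_j B_(a+1) s_\<mu>. The unprimed
      sets give the strips with first part a and above a; the primed ones cancel.\<close>
    let ?X = "{\<nu>. \<nu> \<in> ?U (Suc j) \<mu> \<and> first_part \<nu> \<le> a}" and ?X' = "{\<nu>. \<nu> \<in> ?U (Suc j) \<mu> \<and> first_part \<nu> > a}"
    let ?Y = "{\<kappa>. \<kappa> \<in> ?U j (Suc a # \<mu>) \<and> first_part (tl \<kappa>) \<le> a}" and ?Y' = "{\<kappa>. \<kappa> \<in> ?U j (Suc a # \<mu>) \<and> first_part (tl \<kappa>) > a}"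
    have finX: "finite ?X" "finite ?X'" "finite ?Y" "finite ?Y'"
      by (rule finite_subset[OF _ fin[of \<mu> "Suc j"]], blast, rule finite_subset[OF _ fin[of \<mu> "Suc j"]], blast,
        rule finite_subset[OF _ fin[of "Suc a # \<mu>" j]], blast, rule finite_subset[OF _ fin[of "Suc a # \<mu>" j]], blast)
    have "(\<Sum>\<nu>\<in>?U (Suc j) \<mu>. bern (int a) (?s \<nu>)) = (\<Sum>\<nu>\<in>?X \<union> ?X'. bern (int a) (?s \<nu>))"
      by (rule sum.cong) auto
    also have "\<dots> = (\<Sum>\<nu>\<in>?X. bern (int a) (?s \<nu>)) + (\<Sum>\<nu>\<in>?X'. bern (int a) (?s \<nu>))"
      by (rule sum.union_disjoint) (use finX in auto)
    finally have X: "(\<Sum>\<nu>\<in>?U (Suc j) \<mu>. bern (int a) (?s \<nu>)) = \<dots>" .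
    have "(\<Sum>\<kappa>\<in>?U j (Suc a # \<mu>). ?s \<kappa>) = (\<Sum>\<kappa>\<in>?Y \<union> ?Y'. ?s \<kappa>)"
      by (rule sum.cong) auto
    also have "\<dots> = (\<Sum>\<kappa>\<in>?Y. ?s \<kappa>) + (\<Sum>\<kappa>\<in>?Y'. ?s \<kappa>)"
      by (rule sum.union_disjoint) (use finX in auto)
    finally have Y: "(\<Sum>\<kappa>\<in>?U j (Suc a # \<mu>). ?s \<kappa>) = \<dots>" .
    let ?Z = "{\<kappa>. \<kappa> \<in> ?U (Suc j) (a # \<mu>) \<and> first_part \<kappa> = a}"
    have Z: "(\<Sum>\<nu>\<in>?X. bern (int a) (?s \<nu>)) = (\<Sum>\<kappa>\<in>?Z. ?s \<kappa>)"
    proof (rule sum.reindex_bij_witness[of _ tl "pcons a"])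
      fix \<kappa> assume \<kappa>: "\<kappa> \<in> ?Z"
      then show "pcons a (tl \<kappa>) = \<kappa>"
        using pcons_first_tl by auto
      show "tl \<kappa> \<in> ?X"
        using \<kappa> rec[of \<kappa> a] is_partition_tl[of \<kappa>] sum_list_tl[of \<kappa>] by auto
    next
      fix \<nu> assume \<nu>: "\<nu> \<in> ?X"
      then have p: "is_partition \<nu>" "first_part \<nu> \<le> a"
        by auto
      show "tl (pcons a \<nu>) = \<nu>"
        using pcons_simps[OF p] by simp
      show "pcons a \<nu> \<in> ?Z"
        using \<nu> rec[of "pcons a \<nu>" a] pcons_simps(1-4)[OF p] by auto
      show "?s (pcons a \<nu>) = bern (int a) (?s \<nu>)"
        by (rule pcons_simps(5)[OF p])
    qed
    have "?U (Suc j) (a # \<mu>) = ?Z \<union> ?Y"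
    proof (intro set_eqI)
      fix \<kappa>
      show "\<kappa> \<in> ?U (Suc j) (a # \<mu>) \<longleftrightarrow> \<kappa> \<in> ?Z \<union> ?Y"
        using rec[of \<kappa> a] rec[of \<kappa> "Suc a"] by (cases "first_part \<kappa> = a") auto
    qed
    moreover have "?Z \<inter> ?Y = {}"
      using rec by auto
    ultimately have ZY: "(\<Sum>\<kappa>\<in>?U (Suc j) (a # \<mu>). ?s \<kappa>) = (\<Sum>\<kappa>\<in>?Z. ?s \<kappa>) + (\<Sum>\<kappa>\<in>?Y. ?s \<kappa>)"
      using sum.union_disjoint[of ?Z ?Y ?s] finX finite_subset[OF _ fin[of "a # \<mu>" "Suc j"], of ?Z]
      by (simp only:) blast
    \<comment> \<open>A first part equal to a + 1 contributes B_a B_(a+1) = 0.\<close>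
    have "(\<Sum>\<nu>\<in>?X'. bern (int a) (?s \<nu>)) = (\<Sum>\<nu> | \<nu> \<in> ?X' \<and> first_part \<nu> > Suc a. bern (int a) (?s \<nu>))"
    proof (intro sum.mono_neutral_right ballI finX)
      fix \<nu> assume "\<nu> \<in> ?X' - {\<nu>. \<nu> \<in> ?X' \<and> first_part \<nu> > Suc a}"
      then show "bern (int a) (?s \<nu>) = 0"
        by (intro bern_below_first) auto
    qed blast
    \<comment> \<open>B_a B_c = - B_(c-1) B_(a+1) matches the first part c with the pair (c - 1, a +
      1); in \<open>?Y'\<close> the second part exceeds a and is at most a + 1, hence equals
      it.\<close>
    also have "\<dots> = (\<Sum>\<kappa>\<in>?Y'. - ?s \<kappa>)"
    proof (rule sum.reindex_bij_witness[of _ "\<lambda>\<kappa>. (hd \<kappa> + 1) # tl (tl \<kappa>)" "\<lambda>\<nu>. (hd \<nu> - 1) # Suc a # tl \<nu>"])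
      fix \<nu> assume "\<nu> \<in> {\<nu>. \<nu> \<in> ?X' \<and> first_part \<nu> > Suc a}"
      then obtain c \<nu>' where \<nu>: "\<nu> = c # \<nu>'" "c > Suc a" "is_partition \<nu>" "hstrip \<nu> \<mu>" "sum_list \<nu> = sum_list \<mu> + Suc j"
        by (cases \<nu>) auto
      have h: "hstrip (x # \<nu>') \<mu> \<longleftrightarrow> first_part \<mu> \<le> x \<and> first_part \<nu>' \<le> first_part \<mu> \<and> hstrip \<nu>' (tl \<mu>)" for x
        by (subst hstrip_rec) simp
      have "int (c - 1) = int c - 1" "int (Suc a) = int a + 1"
        using \<nu>(2) by auto
      then show "- ?s ((hd \<nu> - 1) # Suc a # tl \<nu>) = bern (int a) (?s \<nu>)"
        unfolding \<nu>(1) by (simp add: sfun_def bern_swap[of "int a" "int c"] add.commute)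
      show "(hd ((hd \<nu> - 1) # Suc a # tl \<nu>) + 1) # tl (tl ((hd \<nu> - 1) # Suc a # tl \<nu>)) = \<nu>"
        using \<nu>(1,2) by simp
      show "(hd \<nu> - 1) # Suc a # tl \<nu> \<in> ?Y'"
        using \<nu> h[of c] h[of "Suc a"] a by (auto simp: rec is_partition_Cons)
    next
      fix \<kappa> assume \<kappa>: "\<kappa> \<in> ?Y'"
      obtain c \<kappa>' where c: "\<kappa> = c # \<kappa>'"
        using \<kappa> by (cases \<kappa>) auto
      obtain x \<nu>' where x: "\<kappa>' = x # \<nu>'"
        using \<kappa> c by (cases \<kappa>') auto
      have h: "hstrip (x # \<nu>') \<mu> \<longleftrightarrow> first_part \<mu> \<le> x \<and> first_part \<nu>' \<le> first_part \<mu> \<and> hstrip \<nu>' (tl \<mu>)" for x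
        by (subst hstrip_rec) simp
      have xa: "x = Suc a"
        using \<kappa> c x rec[of \<kappa> "Suc a"] by auto
      show "(hd ((hd \<kappa> + 1) # tl (tl \<kappa>)) - 1) # Suc a # tl ((hd \<kappa> + 1) # tl (tl \<kappa>)) = \<kappa>"
        using c x xa by simp
      show "(hd \<kappa> + 1) # tl (tl \<kappa>) \<in> {\<nu>. \<nu> \<in> ?X' \<and> first_part \<nu> > Suc a}"
        using \<kappa> c x xa rec[of \<kappa> "Suc a"] h[of x] h[of "Suc c"] a by (auto simp: is_partition_Cons)
    qed
    also have "\<dots> = - (\<Sum>\<kappa>\<in>?Y'. ?s \<kappa>)"
      by (rule sum_negf)
    finally have cancel: "(\<Sum>\<nu>\<in>?X'. bern (int a) (?s \<nu>)) = - (\<Sum>\<kappa>\<in>?Y'. ?s \<kappa>)" .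
    have "hsym (int (Suc j)) * bern (int a) (?s \<mu>) =
        bern (int a) (hsym (int (Suc j)) * ?s \<mu>) + hsym (int j) * bern (int (Suc a)) (?s \<mu>)"
      by (subst hsym_bern) (simp add: add.commute)
    also have "hsym (int j) * bern (int (Suc a)) (?s \<mu>) = (\<Sum>\<kappa>\<in>?U j (Suc a # \<mu>). ?s \<kappa>)"
      by (rule Suc.IH) (use a in auto)
    also have "bern (int a) (hsym (int (Suc j)) * ?s \<mu>) = (\<Sum>\<nu>\<in>?U (Suc j) \<mu>. bern (int a) (?s \<nu>))"
      by (simp only: IH hlinear_sum[OF bern_linear])
    finally show ?case
      unfolding X Y cancel ZY Z by simp
  qed
  from this[OF \<mu>(2,3), of j] show ?case
    by (simp add: sfun_def)
qed

section \<open>The embedding into symmetric series\<close>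

lemma mcoeff_simps [simp]:
  "mcoeff 0 e = 0" "mcoeff 1 e = (if e = 0 then 1 else 0)" "mcoeff (F + G) e = mcoeff F e + mcoeff G e"
  by (simp_all add: zero_mseries_def one_mseries_def plus_mseries_def)

lemma mcoeff_sum: "mcoeff (sum g A) e = (\<Sum>x\<in>A. mcoeff (g x) e)"
  by (induction A rule: infinite_finite_induct) auto

lemma mcoeff_mult: "mcoeff (F * G) e = (\<Sum>x | fst x + snd x = e. mcoeff F (fst x) * mcoeff G (snd x))"
  by (simp add: times_mseries_def case_prod_unfold)

lemma finite_splittings': "finite {x. fst x + snd x = (e :: nat \<Rightarrow>\<^sub>0 nat)}"
  using finite_splittings[of e] by (simp add: case_prod_unfold)

lemma mcoeff_mconst_mult: "mcoeff (mconst c * F) e = c * mcoeff F e"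
proof -
  have "mcoeff (mconst c * F) e = (\<Sum>x\<in>{(0, e)}. mcoeff (mconst c) (fst x) * mcoeff F (snd x))"
    unfolding mcoeff_mult
    by (intro sum.mono_neutral_right finite_splittings') (auto simp: mconst_def)
  then show ?thesis
    by (simp add: mconst_def)
qed

lemma mconst_0 [simp]: "mconst 0 = 0" and mconst_1 [simp]: "mconst 1 = 1"
  and mconst_add: "mconst (a + b) = mconst a + mconst b"
  by (auto simp: mconst_def intro!: mseries_eqI)

lemma mconst_mult: "mconst (a * b) = mconst a * mconst b"
  by (rule mseries_eqI) (auto simp: mcoeff_mconst_mult, simp_all add: mconst_def)

definition lambda_mono :: "(nat \<Rightarrow>\<^sub>0 nat) \<Rightarrow> 'a::comm_ring_1 mseries" where
  "lambda_mono t = (\<Prod>k\<in>Poly_Mapping.keys t. power_sum (Suc k) ^ Poly_Mapping.lookup t k)"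

lemma lambda_mono_superset:
  "finite A \<Longrightarrow> Poly_Mapping.keys t \<subseteq> A \<Longrightarrow>
    lambda_mono t = (\<Prod>k\<in>A. power_sum (Suc k) ^ Poly_Mapping.lookup t k)"
  unfolding lambda_mono_def by (rule prod.mono_neutral_left) (auto simp: in_keys_iff)

lemma lambda_mono_add: "lambda_mono (s + t) = lambda_mono s * lambda_mono t"
proof -
  let ?A = "Poly_Mapping.keys s \<union> Poly_Mapping.keys t"
  have A: "finite ?A" "Poly_Mapping.keys s \<subseteq> ?A" "Poly_Mapping.keys t \<subseteq> ?A" "Poly_Mapping.keys (s + t) \<subseteq> ?A"
    using Poly_Mapping.keys_add[of s t] by auto
  show ?thesis
    unfolding lambda_mono_superset[OF A(1,2)] lambda_mono_superset[OF A(1,3)] lambda_mono_superset[OF A(1,4)]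
    by (simp add: lookup_add power_add prod.distrib)
qed

lemma to_Lambda_superset:
  "finite A \<Longrightarrow> Poly_Mapping.keys f \<subseteq> A \<Longrightarrow>
    to_Lambda f = (\<Sum>t\<in>A. mconst (Poly_Mapping.lookup f t) * lambda_mono t)"
  unfolding to_Lambda_def lambda_mono_def[symmetric]
  by (rule sum.mono_neutral_left) (auto simp: in_keys_iff)

lemma to_Lambda_0 [simp]: "to_Lambda 0 = 0"
  by (simp add: to_Lambda_def)

lemma to_Lambda_add: "to_Lambda (f + g) = to_Lambda f + to_Lambda g"
proof -
  let ?A = "Poly_Mapping.keys f \<union> Poly_Mapping.keys g"
  have A: "finite ?A" "Poly_Mapping.keys f \<subseteq> ?A" "Poly_Mapping.keys g \<subseteq> ?A" "Poly_Mapping.keys (f + g) \<subseteq> ?A"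
    using Poly_Mapping.keys_add[of f g] by auto
  show ?thesis
    unfolding to_Lambda_superset[OF A(1,2)] to_Lambda_superset[OF A(1,3)] to_Lambda_superset[OF A(1,4)]
    by (simp add: lookup_add mconst_add sum.distrib distrib_right)
qed

lemma to_Lambda_single: "to_Lambda (Poly_Mapping.single t c) = mconst c * lambda_mono t"
  by (subst to_Lambda_superset[of "{t}"]) auto

lemma to_Lambda_mult: "to_Lambda (f * g) = to_Lambda f * to_Lambda g"
proof (induction f rule: poly_mapping_sum_induct)
  case (3 s a)
  show ?case
    by (induction g rule: poly_mapping_sum_induct)
      (simp_all add: to_Lambda_add mult_single to_Lambda_single mconst_mult lambda_mono_add algebra_simps)
qed (simp_all add: to_Lambda_add distrib_right)

lemma lambda_mono_0 [simp]: "lambda_mono 0 = 1"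
  by (simp add: lambda_mono_def)

lemma to_Lambda_hconst: "to_Lambda (hconst c) = mconst c"
  by (simp add: hconst_def to_Lambda_single)

lemma to_Lambda_hvar: "n > 0 \<Longrightarrow> to_Lambda (hvar n) = power_sum n"
  by (simp add: hvar_def to_Lambda_single lambda_mono_def)

lemma to_Lambda_sum: "to_Lambda (sum g A) = (\<Sum>x\<in>A. to_Lambda (g x))"
  by (induction A rule: infinite_finite_induct) (auto simp: to_Lambda_add)

lemma to_Lambda_diff: "to_Lambda (f - g) = to_Lambda f - to_Lambda g"
  using to_Lambda_add[of "f - g" g] by simp

lemma heis_sym_induct [case_names const var add mult]:
  fixes f :: "'a::comm_ring_1 heis_sym"
  assumes "\<And>c. P (hconst c)" "\<And>n. n > 0 \<Longrightarrow> P (hvar n)"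
    and "\<And>f g. P f \<Longrightarrow> P g \<Longrightarrow> P (f + g)" "\<And>f g. P f \<Longrightarrow> P g \<Longrightarrow> P (f * g)"
  shows "P f"
proof -
  have mono: "P (Poly_Mapping.single t 1)" for t :: "nat \<Rightarrow>\<^sub>0 nat"
  proof (induction t rule: poly_mapping_sum_induct)
    case 1
    show ?case using assms(1)[of 1] by simp
  next
    case (2 s t)
    then have "P (Poly_Mapping.single s 1 * Poly_Mapping.single t 1)"
      by (rule assms(4))
    then show ?case by (simp add: mult_single)
  next
    case (3 k n)
    show ?case
    proof (induction n)
      case 0
      show ?case using assms(1)[of 1] by simp
    next
      case (Suc n)
      then have "P (Poly_Mapping.single (Poly_Mapping.single k n) 1 * hvar (Suc k))"
        by (intro assms(4) assms(2)) auto
      then show ?case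
        by (simp add: hvar_def mult_single flip: single_add)
    qed
  qed
  have "P (Poly_Mapping.single t c)" for t c
    using assms(4)[OF assms(1)[of c] mono[of t]] by (simp add: hconst_def mult_single)
  then show ?thesis
    using assms(1)[of 0] assms(3) by (induction f rule: poly_mapping_sum_induct) auto
qed

text \<open>The coefficient of x_v^k, as a series in the other variables. For k = 0 this sets x_v to
  0.\<close>

definition mslice :: "nat \<Rightarrow> nat \<Rightarrow> 'a::comm_ring_1 mseries \<Rightarrow> 'a mseries" where
  "mslice v k F = MSeries (\<lambda>e. if v \<in> Poly_Mapping.keys e then 0 else mcoeff F (e + Poly_Mapping.single v k))"

lemma mcoeff_mslice:
  "mcoeff (mslice v k F) e = (if v \<in> Poly_Mapping.keys e then 0 else mcoeff F (e + Poly_Mapping.single v k))"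
  by (simp add: mslice_def)

lemma mslice_add: "mslice v k (F + G) = mslice v k F + mslice v k G"
  by (rule mseries_eqI) (simp add: mcoeff_mslice)

lemma mslice_sum: "mslice v k (sum g A) = (\<Sum>x\<in>A. mslice v k (g x))"
  by (rule mseries_eqI) (simp add: mcoeff_mslice mcoeff_sum)

text \<open>The Cauchy product with respect to x_v alone.\<close>

lemma mslice_mult: "mslice v k (F * G) = (\<Sum>i\<le>k. mslice v i F * mslice v (k - i) G)"
proof (rule mseries_eqI)
  fix e :: "nat \<Rightarrow>\<^sub>0 nat"
  let ?e = "Poly_Mapping.single v"
  show "mcoeff (mslice v k (F * G)) e = mcoeff (\<Sum>i\<le>k. mslice v i F * mslice v (k - i) G) e"
  proof (cases "v \<in> Poly_Mapping.keys e")
    case True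
    then have *: "v \<in> Poly_Mapping.keys (fst x) \<or> v \<in> Poly_Mapping.keys (snd x)" if "fst x + snd x = e" for x
      using that by (auto simp: in_keys_iff lookup_add)
    have "mcoeff (mslice v i F * mslice v (k - i) G) e = 0" for i
      unfolding mcoeff_mult
    proof (intro sum.neutral ballI)
      fix x assume "x \<in> {x. fst x + snd x = e}"
      then show "mcoeff (mslice v i F) (fst x) * mcoeff (mslice v (k - i) G) (snd x) = 0"
        using *[of x] by (auto simp: mcoeff_mslice)
    qed
    with True show ?thesis
      by (simp add: mcoeff_sum mcoeff_mslice)
  next
    case False
    then have v: "Poly_Mapping.lookup e v = 0"
      by (simp add: in_keys_iff)
    have nv: "Poly_Mapping.lookup (fst x) v = 0" "Poly_Mapping.lookup (snd x) v = 0" if "fst x + snd x = e" for x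
      using that v by (auto simp: lookup_add)
    have "mcoeff (\<Sum>i\<le>k. mslice v i F * mslice v (k - i) G) e =
        (\<Sum>i\<le>k. \<Sum>x | fst x + snd x = e. mcoeff F (fst x + ?e i) * mcoeff G (snd x + ?e (k - i)))"
      unfolding mcoeff_sum mcoeff_mult
      by (intro sum.cong refl) (use nv in \<open>auto simp: mcoeff_mslice in_keys_iff\<close>)
    also have "\<dots> = (\<Sum>(i, x)\<in>{..k} \<times> {x. fst x + snd x = e}. mcoeff F (fst x + ?e i) * mcoeff G (snd x + ?e (k - i)))"
      by (rule sum.cartesian_product)
    also have "\<dots> = (\<Sum>y | fst y + snd y = e + ?e k. mcoeff F (fst y) * mcoeff G (snd y))"
    \<comment> \<open>A splitting of the whole exponent is a splitting k = i + (k - i) of the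
      exponent of v together with a splitting of e.\<close>
    proof (rule sum.reindex_bij_witness[of _
          "\<lambda>y. (Poly_Mapping.lookup (fst y) v,
             (fst y - ?e (Poly_Mapping.lookup (fst y) v), snd y - ?e (Poly_Mapping.lookup (snd y) v)))"
          "\<lambda>(i, x). (fst x + ?e i, snd x + ?e (k - i))"], goal_cases)
      case (1 a)
      then show ?case
        using nv by (auto simp: lookup_add)
    next
      case (2 a)
      then obtain i x where a: "a = (i, x)" "i \<le> k" "fst x + snd x = e"
        by auto
      have "fst x + ?e i + (snd x + ?e (k - i)) = (fst x + snd x) + (?e i + ?e (k - i))"
        by (simp add: ac_simps)
      also have "?e i + ?e (k - i) = ?e k"
        using a(2) by (simp flip: single_add)
      finally show ?case
        using a by simp
    next
      case (3 y)
      have s: "u - ?e (Poly_Mapping.lookup u v) + ?e (Poly_Mapping.lookup u v) = u" for u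
        by (rule poly_mapping_eqI) (simp add: lookup_add lookup_minus lookup_single when_def)
      have "Poly_Mapping.lookup (fst y) v + Poly_Mapping.lookup (snd y) v = k"
        using 3 v by (simp flip: lookup_add) (simp add: lookup_add)
      then have "k - Poly_Mapping.lookup (fst y) v = Poly_Mapping.lookup (snd y) v"
        by simp
      then show ?case
        by (simp add: s)
    next
      case (4 y)
      have eq: "Poly_Mapping.lookup (fst y) u + Poly_Mapping.lookup (snd y) u = Poly_Mapping.lookup (e + ?e k) u" for u
        using 4 by (simp flip: lookup_add)
      have "(fst y - ?e (Poly_Mapping.lookup (fst y) v)) + (snd y - ?e (Poly_Mapping.lookup (snd y) v)) = e"
      proof (rule poly_mapping_eqI)
        fix u
        show "Poly_Mapping.lookup ((fst y - ?e (Poly_Mapping.lookup (fst y) v)) + (snd y - ?e (Poly_Mapping.lookup (snd y) v))) u =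
            Poly_Mapping.lookup e u"
          using eq[of u] v by (cases "u = v") (auto simp: lookup_add lookup_minus lookup_single when_def)
      qed
      moreover have "Poly_Mapping.lookup (fst y) v \<le> k"
        using eq[of v] v by (simp add: lookup_add)
      ultimately show ?case
        by simp
    next
      case (5 a)
      then show ?case
        by auto
    qed
    also have "\<dots> = mcoeff (mslice v k (F * G)) e"
      using False by (simp add: mcoeff_mslice mcoeff_mult)
    finally show ?thesis ..
  qed
qed

text \<open>x_v enters p_n only through the summand x_v^n.\<close>

lemma mslice_power_sum:
  assumes "n > 0"
  shows "mslice v k (power_sum n) = (if k = 0 then mslice v 0 (power_sum n) else if k = n then 1 else 0)"
proof (cases "k = 0")
  case False
  show ?thesis
  proof (rule mseries_eqI)
    fix e :: "nat \<Rightarrow>\<^sub>0 nat"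
    have "(\<exists>j. e + Poly_Mapping.single v k = Poly_Mapping.single j n) \<longleftrightarrow> e = 0 \<and> k = n"
      if "Poly_Mapping.lookup e v = 0"
    proof
      assume "\<exists>j. e + Poly_Mapping.single v k = Poly_Mapping.single j n"
      then obtain j where j: "e + Poly_Mapping.single v k = Poly_Mapping.single j n" ..
      then have "Poly_Mapping.lookup (e + Poly_Mapping.single v k) v = Poly_Mapping.lookup (Poly_Mapping.single j n) v"
        by simp
      then have "j = v" "k = n"
        using False that by (auto simp: lookup_add lookup_single when_def split: if_splits)
      with j show "e = 0 \<and> k = n"
        by simp
    qed auto
    then show "mcoeff (mslice v k (power_sum n)) e =
        mcoeff (if k = 0 then mslice v 0 (power_sum n) else if k = n then 1 else 0) e"
      using False by (auto simp: mcoeff_mslice power_sum_def in_keys_iff)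
  qed
qed simp

lemma hskew_0: "hskew 0 f = f"
  by (simp add: hskew_def)

lemma hskew_hvar: "n > 0 \<Longrightarrow> hskew k (hvar n) = (if k = 0 then hvar n else if k = n then 1 else 0)"
proof -
  assume n: "n > 0"
  let ?G = "\<lambda>k. if k = 0 then hvar n else if k = n then 1 else 0 :: 'a heis_sym"
  have "ann (\<lambda>_. 1) k (hvar n) = ?G k"
  proof (rule ann_unique)
    fix r :: nat assume r: "r > 0"
    have d1: "hderiv m 1 = (0 :: 'a heis_sym)" for m
      using hderiv_hconst[of m 1] by simp
    have "(\<Sum>m = 1..r. hconst (of_nat m) * (hconst 1 * hderiv m (?G (r - m)))) =
        (\<Sum>m\<in>{r}. hconst (of_nat m) * (hconst 1 * hderiv m (?G (r - m))))"
      by (rule sum.mono_neutral_right) (use r in \<open>auto simp: d1 hlinear_0 hlinear_hderiv\<close>)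
    also have "\<dots> = hconst (of_nat r) * ?G r"
      using r n by (auto simp: hderiv_hvar)
    finally show "hconst (of_nat r) * ?G r = (\<Sum>m = 1..r. hconst (of_nat m) * (hconst 1 * hderiv m (?G (r - m))))" ..
  qed simp
  then show ?thesis
    by (simp add: hskew_def)
qed

lemma mslice_mconst: "mslice v k (mconst c) = (if k = 0 then mslice v 0 (mconst c) else 0)"
proof (rule mseries_eqI)
  fix e :: "nat \<Rightarrow>\<^sub>0 nat"
  have "e + Poly_Mapping.single v k = 0 \<Longrightarrow> k = 0"
    by (metis add_is_0 lookup_add lookup_single_eq lookup_zero)
  then show "mcoeff (mslice v k (mconst c)) e = mcoeff (if k = 0 then mslice v 0 (mconst c) else 0) e"
    by (auto simp: mcoeff_mslice mconst_def)
qed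

text \<open>Separating one variable: f is the sum of x_v^k times (h_k^perp f) in the remaining
  variables. Both sides obey the same product rule, so it is enough to check constants and power
  sums.\<close>

lemma mslice_to_Lambda: "mslice v k (to_Lambda f) = mslice v 0 (to_Lambda (hskew k f))"
proof (induction f arbitrary: k rule: heis_sym_induct)
  case (const c)
  have "mslice v 0 0 = (0 :: 'a mseries)"
    by (rule mseries_eqI) (simp add: mcoeff_mslice)
  then show ?case
    by (subst to_Lambda_hconst, subst mslice_mconst) (auto simp: hskew_def ann_hconst to_Lambda_hconst)
next
  case (var n)
  have "mslice v 0 0 = (0 :: 'a mseries)" "mslice v 0 1 = (1 :: 'a mseries)"
    by (auto intro!: mseries_eqI simp: mcoeff_mslice)
  moreover have "to_Lambda 1 = (1 :: 'a mseries)"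
    using to_Lambda_hconst[of 1] by simp
  ultimately show ?case
    using var by (subst to_Lambda_hvar, simp, subst mslice_power_sum) (auto simp: hskew_hvar to_Lambda_hvar)
next
  case (add f g)
  then show ?case
    by (simp add: to_Lambda_add mslice_add hlinear_add[OF hskew_linear])
next
  case (mult f g)
  have "mslice v k (to_Lambda (f * g)) = (\<Sum>i\<le>k. mslice v 0 (to_Lambda (hskew i f)) * mslice v 0 (to_Lambda (hskew (k - i) g)))"
    unfolding to_Lambda_mult mslice_mult by (simp only: mult)
  also have "\<dots> = (\<Sum>i\<le>k. mslice v 0 (to_Lambda (hskew i f * hskew (k - i) g)))"
    unfolding to_Lambda_mult by (subst mslice_mult) simp
  also have "\<dots> = mslice v 0 (to_Lambda (hskew k (f * g)))"
    unfolding hskew_def ann_mult by (simp only: to_Lambda_sum mslice_sum)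
  finally show ?case .
qed

lemma mcoeff_to_Lambda_hskew:
  assumes "Poly_Mapping.lookup e v = 0"
  shows "mcoeff (to_Lambda f) (e + Poly_Mapping.single v k) = mcoeff (to_Lambda (hskew k f)) e"
  using arg_cong[OF mslice_to_Lambda[of v k f], of "\<lambda>F. mcoeff F e"] assms
  by (simp add: mcoeff_mslice in_keys_iff)

lemma mcoeff_0_mult: "mcoeff (F * G) 0 = mcoeff F 0 * mcoeff G 0"
proof -
  have "s + t = 0 \<longleftrightarrow> s = 0 \<and> t = 0" for s t :: "nat \<Rightarrow>\<^sub>0 nat"
    by (metis add.right_neutral add_is_0 lookup_add lookup_zero poly_mapping_eqI)
  then have "{x. fst x + snd x = (0 :: nat \<Rightarrow>\<^sub>0 nat)} = {(0, 0)}"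
    by auto
  then show ?thesis
    by (simp add: mcoeff_mult)
qed

lemma mcoeff_0_to_Lambda: "mcoeff (to_Lambda f) 0 = Poly_Mapping.lookup f 0"
proof (induction f rule: poly_mapping_sum_induct)
  case (3 t c)
  have "mcoeff (lambda_mono t) 0 = (if t = 0 then 1 else 0 :: 'a)"
  proof (cases "t = 0")
    case False
    then obtain k where k: "Poly_Mapping.lookup t k \<noteq> 0"
      by (metis lookup_zero poly_mapping_eqI)
    have t: "t = (t - Poly_Mapping.single k 1) + Poly_Mapping.single k 1"
      using k by (intro poly_mapping_eqI) (auto simp: lookup_add lookup_minus lookup_single when_def)
    have "0 \<noteq> Poly_Mapping.single j (Suc k)" for j :: nat
      by (metis lookup_single_eq lookup_zero nat.distinct(1))
    then have "mcoeff (lambda_mono (Poly_Mapping.single k 1)) 0 = (0 :: 'a)"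
      by (auto simp: lambda_mono_def power_sum_def)
    then show ?thesis
      using False by (subst t) (simp add: lambda_mono_add mcoeff_0_mult)
  qed simp
  then show ?case
    by (auto simp: to_Lambda_single mcoeff_mconst_mult lookup_single when_def)
qed (simp_all add: to_Lambda_add lookup_add)

lemma lookup_partial_deriv:
  "Poly_Mapping.lookup (partial_deriv k f) s =
    of_nat (Poly_Mapping.lookup s k + 1) * Poly_Mapping.lookup f (s + Poly_Mapping.single k 1)"
proof (induction f rule: poly_mapping_sum_induct)
  case (3 t c)
  have "t - Poly_Mapping.single k 1 = s \<longleftrightarrow> t = s + Poly_Mapping.single k 1" if "Poly_Mapping.lookup t k \<noteq> 0"
  proof
    assume "t - Poly_Mapping.single k 1 = s"
    then show "t = s + Poly_Mapping.single k 1"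
      using that by (intro poly_mapping_eqI) (auto simp: lookup_add lookup_minus lookup_single when_def)
  qed simp
  then show ?case
    by (cases "Poly_Mapping.lookup t k = 0")
      (auto simp: partial_deriv_single lookup_single when_def lookup_add)
qed (simp_all add: partial_deriv_0 partial_deriv_add lookup_add algebra_simps)

lemma hderiv_eq_0_imp:
  fixes f :: "'a::field_char_0 heis_sym"
  assumes "\<And>n. n > 0 \<Longrightarrow> hderiv n f = 0" and "Poly_Mapping.lookup f 0 = 0"
  shows "f = 0"
proof (rule poly_mapping_eqI)
  fix t
  show "Poly_Mapping.lookup f t = Poly_Mapping.lookup 0 t"
  proof (cases "t = 0")
    case False
    then obtain k where k: "Poly_Mapping.lookup t k \<noteq> 0"
      by (metis lookup_zero poly_mapping_eqI)
    have t: "t = (t - Poly_Mapping.single k 1) + Poly_Mapping.single k 1"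
      using k by (intro poly_mapping_eqI) (auto simp: lookup_add lookup_minus lookup_single when_def)
    have "Poly_Mapping.lookup (partial_deriv k f) (t - Poly_Mapping.single k 1) = 0"
      using assms(1)[of "Suc k"] by (simp add: hderiv_def)
    then have "of_nat (Poly_Mapping.lookup (t - Poly_Mapping.single k 1) k + 1) * Poly_Mapping.lookup f t = 0"
      unfolding lookup_partial_deriv t[symmetric] .
    then show ?thesis
      unfolding mult_eq_0_iff of_nat_eq_0_iff by simp
  qed (simp add: assms)
qed

text \<open>Infinitely many variables are essential here: for a monomial e there is a variable v
  outside it, and the coefficient at e is read off from f at e times x_v^k.\<close>

lemma to_Lambda_hskew_eq_0:
  assumes "to_Lambda f = 0"
  shows "to_Lambda (hskew k f) = 0"
proof (rule mseries_eqI)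
  fix e :: "nat \<Rightarrow>\<^sub>0 nat"
  obtain v where "v \<notin> Poly_Mapping.keys e"
    using ex_new_if_finite[OF infinite_UNIV_nat finite_keys] by blast
  then show "mcoeff (to_Lambda (hskew k f)) e = mcoeff 0 e"
    using mcoeff_to_Lambda_hskew[of e v f k] by (simp add: assms in_keys_iff)
qed

text \<open>Newton's recursion expresses \<open>hderiv n\<close> through \<open>hskew n\<close> and
  derivatives of smaller index, and all of these preserve the kernel.\<close>

lemma to_Lambda_hderiv_eq_0:
  fixes f :: "'a::field_char_0 heis_sym"
  assumes "to_Lambda f = 0" "n > 0"
  shows "to_Lambda (hderiv n f) = 0"
  using assms
proof (induction n arbitrary: f rule: less_induct)
  case (less n)
  let ?g = "\<lambda>m. hconst (of_nat m) * (hconst 1 * hderiv m (hskew (n - m) f))"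
  have "to_Lambda (?g m) = 0" if "m \<in> {1..n} - {n}" for m
    using less.IH[of m "hskew (n - m) f"] that to_Lambda_hskew_eq_0[OF less.prems(1)] by (simp add: to_Lambda_mult)
  then have "(\<Sum>m\<in>{1..n} - {n}. to_Lambda (?g m)) = 0"
    by (intro sum.neutral) blast
  then have "to_Lambda (\<Sum>m = 1..n. ?g m) = to_Lambda (?g n)"
    unfolding to_Lambda_sum using less.prems(2) by (subst sum.remove[of _ n]) auto
  moreover have "(\<Sum>m = 1..n. ?g m) = hconst (of_nat n) * hskew n f"
    unfolding hskew_def by (rule ann_newton[symmetric])
  ultimately have "mconst (of_nat n) * to_Lambda (hderiv n f) = 0"
    by (simp add: to_Lambda_mult to_Lambda_hconst to_Lambda_hskew_eq_0[OF less.prems(1)] hskew_0)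
  then have "of_nat n * mcoeff (to_Lambda (hderiv n f)) e = 0" for e
    by (metis mcoeff_mconst_mult mcoeff_simps(1))
  then show ?case
    using less.prems(2) by (intro mseries_eqI) simp
qed

text \<open>Algebraic independence of the power sums: the kernel is closed under all derivatives,
  these lower the weight, and the constant term is visible in the image.\<close>

lemma to_Lambda_eq_0_imp:
  fixes f :: "'a::field_char_0 heis_sym"
  assumes "to_Lambda f = 0"
  shows "f = 0"
proof -
  obtain d where "hwt (\<lambda>w. w \<le> int d) f"
    using hwt_bounded by blast
  then show ?thesis
    using assms
  proof (induction d arbitrary: f rule: less_induct)
    case (less d)
    show ?case
    proof (rule hderiv_eq_0_imp)
      fix n :: nat assume n: "n > 0"
      have w: "hwt (\<lambda>w. w + int n \<le> int d) (hderiv n f)"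
        by (rule hwt_hderiv[OF n less.prems(1)])
      have L: "to_Lambda (hderiv n f) = 0"
        by (rule to_Lambda_hderiv_eq_0[OF less.prems(2) n])
      show "hderiv n f = 0"
      proof (cases "n \<le> d")
        case True
        then show ?thesis
          using n by (intro less.IH[of "d - n"] hwt_mono[OF w] L) auto
      next
        case False
        then show ?thesis
          by (intro hwt_bot hwt_mono[OF w]) auto
      qed
    qed (use mcoeff_0_to_Lambda[of f] less.prems(2) in simp)
  qed
qed

lemma inj_to_Lambda: "inj (to_Lambda :: 'a::field_char_0 heis_sym \<Rightarrow> 'a mseries)"
proof (rule injI)
  fix f g :: "'a heis_sym" assume "to_Lambda f = to_Lambda g"
  then have "to_Lambda (f - g) = 0"
    by (simp add: to_Lambda_diff)
  then show "f = g"
    using to_Lambda_eq_0_imp by fastforce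
qed

text \<open>If all h_k^perp f with k > 0 vanish, only the term with m = n survives in Newton's
  recursion, so all derivatives vanish. This serves to compare \<open>omega\<close> of Schur
  functions.\<close>

lemma hskew_eq_0_imp:
  fixes f :: "'a::field_char_0 heis_sym"
  assumes "\<And>k. k > 0 \<Longrightarrow> hskew k f = 0" and "Poly_Mapping.lookup f 0 = 0"
  shows "f = 0"
proof (rule hderiv_eq_0_imp[OF _ assms(2)])
  fix n :: nat assume n: "n > 0"
  let ?g = "\<lambda>m. hconst (of_nat m) * (hconst 1 * hderiv m (hskew (n - m) f))"
  have "(\<Sum>m = 1..n. ?g m) = (\<Sum>m\<in>{n}. ?g m)"
    by (rule sum.mono_neutral_right) (use n in \<open>auto simp: assms(1) hlinear_0[OF hlinear_hderiv]\<close>)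
  moreover have "(\<Sum>m = 1..n. ?g m) = hconst (of_nat n) * hskew n f"
    unfolding hskew_def by (rule ann_newton[symmetric])
  ultimately have "hconst (of_nat n) * hderiv n f = hconst (of_nat n) * 0"
    using assms(1)[OF n] by (simp add: hskew_0)
  then show "hderiv n f = 0"
    by (rule hconst_cancel[rotated]) (use n in simp)
qed

section \<open>Diagrams\<close>

lemma mem_diagram: "(r, c) \<in> diagram \<mu> \<longleftrightarrow> c < nth_default 0 \<mu> r"
  by (simp add: diagram_def nth_default_def)

lemma finite_diagram: "finite (diagram \<mu>)"
proof (rule finite_subset)
  show "diagram \<mu> \<subseteq> (SIGMA r:{..<length \<mu>}. {..<\<mu> ! r})"
    by (auto simp: diagram_def)
qed auto

lemma card_diagram: "card (diagram \<mu>) = sum_list \<mu>"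
proof -
  have "diagram \<mu> = (SIGMA r:{..<length \<mu>}. {..<\<mu> ! r})"
    by (auto simp: diagram_def)
  then show ?thesis
    by (simp add: sum_list_sum_nth atLeast0LessThan)
qed

lemma nth_default_antimono_step:
  assumes "is_partition \<mu>"
  shows "nth_default 0 \<mu> (Suc i) \<le> nth_default 0 \<mu> i"
  using assms
proof (induction \<mu> arbitrary: i)
  case (Cons a \<mu>)
  then show ?case
    by (cases i) (auto simp: is_partition_Cons nth_default_first)
qed simp

lemma nth_default_antimono: "is_partition \<mu> \<Longrightarrow> i \<le> j \<Longrightarrow> nth_default 0 \<mu> j \<le> nth_default 0 \<mu> i"
  by (rule lift_Suc_antimono_le) (rule nth_default_antimono_step)

lemma diagram_downward:
  "is_partition \<mu> \<Longrightarrow> (r, c) \<in> diagram \<mu> \<Longrightarrow> r' \<le> r \<Longrightarrow> c' \<le> c \<Longrightarrow> (r', c') \<in> diagram \<mu>"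
  using nth_default_antimono[of \<mu> r' r] by (auto simp: mem_diagram)

text \<open>The inverse of \<open>diagram\<close> on finite sets closed towards the corner.\<close>

definition shape_of :: "(nat \<times> nat) set \<Rightarrow> nat list" where
  "shape_of D = map (\<lambda>r. card {c. (r, c) \<in> D}) [0..<card {r. (r, 0) \<in> D}]"

lemma downward_closed_nat_set:
  assumes "finite A" "\<And>x y. x \<in> A \<Longrightarrow> y \<le> x \<Longrightarrow> y \<in> A"
  shows "A = {..<card (A :: nat set)}"
proof (cases "A = {}")
  case False
  have "A = {..Max A}"
    using assms False by (auto intro: Max_ge Max_in)
  then have "A = {..<Suc (Max A)}"
    by (simp only: lessThan_Suc_atMost)
  then show ?thesis
    by (metis card_lessThan)
qed simp

lemma shape_of_props:
  assumes fin: "finite D" and down: "\<And>r c r' c'. (r, c) \<in> D \<Longrightarrow> r' \<le> r \<Longrightarrow> c' \<le> c \<Longrightarrow> (r', c') \<in> D"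
  shows "is_partition (shape_of D)" "diagram (shape_of D) = D"
proof -
  have finr: "finite {c. (r, c) \<in> D}" for r
    by (rule finite_subset[of _ "snd ` D"]) (auto simp: fin image_iff, force)
  have finc: "finite {r. (r, c) \<in> D}" for c
    by (rule finite_subset[of _ "fst ` D"]) (auto simp: fin image_iff, force)
  have row: "{c. (r, c) \<in> D} = {..<card {c. (r, c) \<in> D}}" for r
    by (rule downward_closed_nat_set[OF finr]) (use down in auto)
  have col: "{r. (r, 0) \<in> D} = {..<card {r. (r, 0) \<in> D}}"
    by (rule downward_closed_nat_set[OF finc]) (use down in auto)
  have rowD: "(r, c) \<in> D \<longleftrightarrow> c < card {c. (r, c) \<in> D}" for r c
    using row[of r] by auto
  have colD: "(r, 0) \<in> D \<longleftrightarrow> r < card {r. (r, 0) \<in> D}" for r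
    using col by auto
  have nd: "nth_default 0 (shape_of D) r = card {c. (r, c) \<in> D}" for r
  proof (cases "r < card {r. (r, 0) \<in> D}")
    case False
    then have "(r, 0) \<notin> D"
      using colD[of r] by simp
    then have "(r, c) \<notin> D" for c
      using down[of r c r 0] by auto
    then have "{c. (r, c) \<in> D} = {}"
      by simp
    with False show ?thesis
      by (simp add: shape_of_def nth_default_def)
  qed (simp add: shape_of_def nth_default_def)
  show "diagram (shape_of D) = D"
    by (auto simp: mem_diagram nd rowD[symmetric])
  have "card {c. (b, c) \<in> D} \<le> card {c. (a, c) \<in> D}" if "a \<le> b" for a b
    using down that by (intro card_mono finr) auto
  then have "sorted_wrt (\<ge>) (shape_of D)"
    by (simp add: shape_of_def sorted_wrt_map sorted_wrt_iff_nth_less)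
  moreover have "card {c. (r, c) \<in> D} \<noteq> 0" if "r < card {r. (r, 0) \<in> D}" for r
    using that colD[of r] rowD[of r 0] by simp
  then have "0 \<notin> set (shape_of D)"
    unfolding shape_of_def by (metis (no_types, lifting) atLeastLessThan_iff imageE set_map set_upt)
  ultimately show "is_partition (shape_of D)"
    by (simp add: is_partition_def)
qed

lemma shape_of_diagram:
  assumes "is_partition \<mu>"
  shows "shape_of (diagram \<mu>) = \<mu>"
proof -
  have row: "{c. (r, c) \<in> diagram \<mu>} = {..<nth_default 0 \<mu> r}" for r
    by (auto simp: mem_diagram)
  have "{r. (r, 0) \<in> diagram \<mu>} = {..<length \<mu>}"
    using assms by (auto simp: diagram_def is_partition_def in_set_conv_nth intro: Suc_leI gr0I)
  then have "shape_of (diagram \<mu>) = map (nth_default 0 \<mu>) [0..<length \<mu>]"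
    unfolding shape_of_def row by simp
  also have "\<dots> = \<mu>"
    by (rule nth_equalityI) (simp_all add: nth_default_nth)
  finally show ?thesis .
qed

lemma diagram_subset_iff: "diagram \<rho> \<subseteq> diagram \<kappa> \<longleftrightarrow> (\<forall>r. nth_default 0 \<rho> r \<le> nth_default 0 \<kappa> r)"
proof
  assume sub: "diagram \<rho> \<subseteq> diagram \<kappa>"
  show "\<forall>r. nth_default 0 \<rho> r \<le> nth_default 0 \<kappa> r"
  proof (rule allI, rule ccontr)
    fix r assume "\<not> nth_default 0 \<rho> r \<le> nth_default 0 \<kappa> r"
    then have "(r, nth_default 0 \<kappa> r) \<in> diagram \<rho>"
      by (simp add: mem_diagram)
    with sub have "(r, nth_default 0 \<kappa> r) \<in> diagram \<kappa>"
      by blast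
    then show False
      by (simp add: mem_diagram)
  qed
next
  assume "\<forall>r. nth_default 0 \<rho> r \<le> nth_default 0 \<kappa> r"
  then show "diagram \<rho> \<subseteq> diagram \<kappa>"
    by (auto simp: mem_diagram) (meson less_le_trans)
qed

lemma card_diagram_diff:
  assumes "diagram \<rho> \<subseteq> diagram \<kappa>"
  shows "card (diagram \<kappa> - diagram \<rho>) = j \<longleftrightarrow> sum_list \<kappa> = sum_list \<rho> + j"
  using card_Diff_subset[OF finite_diagram assms] card_mono[OF finite_diagram assms]
  by (auto simp: card_diagram)

lemma horizontal_strip_iff:
  assumes "is_partition \<kappa>" "is_partition \<rho>"
  shows "horizontal_strip j \<kappa> \<rho> \<longleftrightarrow> hstrip \<kappa> \<rho> \<and> sum_list \<kappa> = sum_list \<rho> + j"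
proof -
  let ?D = "diagram \<kappa> - diagram \<rho>"
  have "(\<forall>x\<in>?D. \<forall>y\<in>?D. snd x = snd y \<longrightarrow> x = y) \<longleftrightarrow> (\<forall>i. nth_default 0 \<kappa> (Suc i) \<le> nth_default 0 \<rho> i)"
  proof
    assume inj: "\<forall>x\<in>?D. \<forall>y\<in>?D. snd x = snd y \<longrightarrow> x = y"
    show "\<forall>i. nth_default 0 \<kappa> (Suc i) \<le> nth_default 0 \<rho> i"
    proof (rule allI, rule ccontr)
      fix i
      \<comment> \<open>The first column to the right of row i of \<rho>; if the inequality fails,
        rows i and i + 1 both have a new box there.\<close>
      let ?c = "nth_default 0 \<rho> i"
      assume "\<not> nth_default 0 \<kappa> (Suc i) \<le> ?c"
      then have "(Suc i, ?c) \<in> ?D" "(i, ?c) \<in> ?D"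
        using nth_default_antimono_step[OF assms(1), of i] nth_default_antimono_step[OF assms(2), of i]
        by (auto simp: mem_diagram)
      from inj[rule_format, OF this] show False
        by simp
    qed
  next
    assume le: "\<forall>i. nth_default 0 \<kappa> (Suc i) \<le> nth_default 0 \<rho> i"
    have no: False if "(r, c) \<in> ?D" "(r', c) \<in> ?D" "r < r'" for r r' c
    proof -
      have "nth_default 0 \<kappa> r' \<le> nth_default 0 \<kappa> (Suc r)"
        using that by (intro nth_default_antimono assms) simp
      also have "\<dots> \<le> nth_default 0 \<rho> r"
        using le by blast
      finally show False
        using that by (auto simp: mem_diagram)
    qed
    show "\<forall>x\<in>?D. \<forall>y\<in>?D. snd x = snd y \<longrightarrow> x = y"
    proof (intro ballI impI)
      fix x y assume "x \<in> ?D" "y \<in> ?D" "snd x = snd y"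
      then show "x = y"
        using no[of "fst x" "snd x" "fst y"] no[of "fst y" "snd x" "fst x"]
        by (cases x; cases y) (metis fst_conv snd_conv linorder_neqE_nat)
    qed
  qed
  then show ?thesis
    using card_diagram_diff[of \<rho> \<kappa> j]
    by (auto simp: horizontal_strip_def hstrip_def diagram_subset_iff)
qed

lemma vertical_strip_iff:
  "vertical_strip j \<kappa> \<rho> \<longleftrightarrow> vstrip \<kappa> \<rho> \<and> sum_list \<kappa> = sum_list \<rho> + j"
proof -
  let ?D = "diagram \<kappa> - diagram \<rho>"
  have "(\<forall>x\<in>?D. \<forall>y\<in>?D. fst x = fst y \<longrightarrow> x = y) \<longleftrightarrow> (\<forall>i. nth_default 0 \<kappa> i \<le> Suc (nth_default 0 \<rho> i))"
  proof
    assume inj: "\<forall>x\<in>?D. \<forall>y\<in>?D. fst x = fst y \<longrightarrow> x = y"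
    show "\<forall>i. nth_default 0 \<kappa> i \<le> Suc (nth_default 0 \<rho> i)"
    proof (rule allI, rule ccontr)
      fix i
      let ?c = "nth_default 0 \<rho> i"
      assume "\<not> nth_default 0 \<kappa> i \<le> Suc ?c"
      then have "(i, Suc ?c) \<in> ?D" "(i, ?c) \<in> ?D"
        by (auto simp: mem_diagram)
      from inj[rule_format, OF this] show False
        by simp
    qed
  next
    assume le: "\<forall>i. nth_default 0 \<kappa> i \<le> Suc (nth_default 0 \<rho> i)"
    have "c = nth_default 0 \<rho> r" if "(r, c) \<in> ?D" for r c
      using that le[rule_format, of r] by (auto simp: mem_diagram)
    then show "\<forall>x\<in>?D. \<forall>y\<in>?D. fst x = fst y \<longrightarrow> x = y"
      by (metis prod.collapse)
  qed
  then show ?thesis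
    using card_diagram_diff[of \<rho> \<kappa> j]
    by (auto simp: vertical_strip_def vstrip_def diagram_subset_iff)
qed

lemma conjugate_eq_shape: "conjugate \<mu> = shape_of (prod.swap ` diagram \<mu>)"
proof -
  have swap: "(c, r) \<in> prod.swap ` diagram \<mu> \<longleftrightarrow> (r, c) \<in> diagram \<mu>" for r c
    by force
  have "{c. (0, c) \<in> diagram \<mu>} = {..<first_part \<mu>}"
    by (auto simp: mem_diagram nth_default_first)
  moreover have "{r. (r, c) \<in> diagram \<mu>} = {r. r < length \<mu> \<and> c < \<mu> ! r}" for c
    by (auto simp: diagram_def)
  ultimately show ?thesis
    by (simp add: conjugate_def shape_of_def swap)
qed

lemma conjugate_props:
  assumes "is_partition \<mu>"
  shows "is_partition (conjugate \<mu>)" "diagram (conjugate \<mu>) = prod.swap ` diagram \<mu>"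
    "conjugate (conjugate \<mu>) = \<mu>" "sum_list (conjugate \<mu>) = sum_list \<mu>"
proof -
  show *: "is_partition (conjugate \<mu>)" "diagram (conjugate \<mu>) = prod.swap ` diagram \<mu>"
    unfolding conjugate_eq_shape
    by (intro shape_of_props; use diagram_downward[OF assms] in \<open>force simp: finite_diagram\<close>)+
  show "conjugate (conjugate \<mu>) = \<mu>"
    unfolding conjugate_eq_shape[of "conjugate \<mu>"] *(2) by (simp add: image_comp shape_of_diagram[OF assms])
  show "sum_list (conjugate \<mu>) = sum_list \<mu>"
    unfolding card_diagram[symmetric] *(2) by (simp add: card_image)
qed

lemma strip_conjugate:
  assumes "is_partition \<kappa>" "is_partition \<rho>"
  shows "horizontal_strip j (conjugate \<kappa>) (conjugate \<rho>) \<longleftrightarrow> vertical_strip j \<kappa> \<rho>"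
proof -
  let ?D = "diagram \<kappa> - diagram \<rho>"
  have inj: "inj (prod.swap :: nat \<times> nat \<Rightarrow> nat \<times> nat)"
    by (auto intro: injI)
  have "prod.swap ` diagram \<kappa> - prod.swap ` diagram \<rho> = prod.swap ` ?D"
    by (rule image_set_diff[OF inj, symmetric])
  moreover have "card (prod.swap ` ?D) = card ?D"
    by (rule card_image) (auto intro: inj_onI)
  moreover have "prod.swap ` diagram \<rho> \<subseteq> prod.swap ` diagram \<kappa> \<longleftrightarrow> diagram \<rho> \<subseteq> diagram \<kappa>"
    by (rule inj_image_subset_iff[OF inj])
  moreover have "(\<forall>x\<in>prod.swap ` ?D. \<forall>y\<in>prod.swap ` ?D. snd x = snd y \<longrightarrow> x = y) \<longleftrightarrow>
      (\<forall>x\<in>?D. \<forall>y\<in>?D. fst x = fst y \<longrightarrow> x = y)"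
    by (simp only: ball_simps inj_eq[OF inj] snd_swap)
  ultimately show ?thesis
    unfolding horizontal_strip_def vertical_strip_def conjugate_props(2)[OF assms(1)] conjugate_props(2)[OF assms(2)]
    by (simp only:)
qed

lemma length_conjugate: "length (conjugate \<mu>) = first_part \<mu>"
  by (simp add: conjugate_def)

section \<open>Schur functions\<close>

definition tab_content :: "nat list \<Rightarrow> (nat \<times> nat \<Rightarrow> nat) \<Rightarrow> (nat \<Rightarrow>\<^sub>0 nat)" where
  "tab_content \<kappa> T = (\<Sum>x\<in>diagram \<kappa>. Poly_Mapping.single (T x) 1)"

definition tableaux :: "nat list \<Rightarrow> (nat \<Rightarrow>\<^sub>0 nat) \<Rightarrow> (nat \<times> nat \<Rightarrow> nat) set" where
  "tableaux \<kappa> e = {T \<in> diagram \<kappa> \<rightarrow>\<^sub>E UNIV. semistandard \<kappa> T \<and> tab_content \<kappa> T = e}"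

lemma mcoeff_schur: "mcoeff (schur \<kappa>) e = of_nat (card (tableaux \<kappa> e))"
  by (simp add: schur_def tableaux_def tab_content_def)

lemma lookup_tab_content: "Poly_Mapping.lookup (tab_content \<kappa> T) v = card {x \<in> diagram \<kappa>. T x = v}"
proof -
  have "Poly_Mapping.lookup (tab_content \<kappa> T) v = (\<Sum>x\<in>diagram \<kappa>. if T x = v then Suc 0 else 0)"
    by (simp add: tab_content_def lookup_sum lookup_single when_def del: sum.delta sum.delta')
  also have "\<dots> = (\<Sum>x | x \<in> diagram \<kappa> \<and> T x = v. Suc 0)"
    by (rule sum.inter_filter[OF finite_diagram, symmetric])
  finally show ?thesis
    by simp
qed

lemma tab_content_keys:
  assumes "x \<in> diagram \<kappa>"
  shows "T x \<in> Poly_Mapping.keys (tab_content \<kappa> T)"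
proof -
  have "{y \<in> diagram \<kappa>. T y = T x} \<noteq> {}"
    using assms by blast
  then show ?thesis
    by (simp add: in_keys_iff lookup_tab_content finite_diagram)
qed

lemma finite_tableaux: "finite (tableaux \<kappa> e)"
proof (rule finite_subset)
  show "tableaux \<kappa> e \<subseteq> (\<Pi>\<^sub>E x\<in>diagram \<kappa>. Poly_Mapping.keys e)"
  proof
    fix T assume "T \<in> tableaux \<kappa> e"
    then have "T \<in> diagram \<kappa> \<rightarrow>\<^sub>E UNIV" "tab_content \<kappa> T = e"
      by (auto simp: tableaux_def)
    then show "T \<in> (\<Pi>\<^sub>E x\<in>diagram \<kappa>. Poly_Mapping.keys e)"
      using tab_content_keys[of _ \<kappa> T] by (auto simp: PiE_iff)
  qed
qed (intro finite_PiE finite_diagram, simp)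

text \<open>v exceeds all other entries, so the boxes with entry v form a horizontal strip, and the
  remaining boxes form a tableau of smaller shape with content e.\<close>

lemma card_tableaux_branching:
  assumes \<kappa>: "is_partition \<kappa>" and e: "\<And>u. u \<in> Poly_Mapping.keys e \<Longrightarrow> u < v"
  shows "card (tableaux \<kappa> (e + Poly_Mapping.single v k)) =
    (\<Sum>\<rho> | is_partition \<rho> \<and> horizontal_strip k \<kappa> \<rho>. card (tableaux \<rho> e))"
proof -
  let ?R = "{\<rho>. is_partition \<rho> \<and> horizontal_strip k \<kappa> \<rho>}"
  let ?E = "e + Poly_Mapping.single v k"
  let ?low = "\<lambda>T. {x \<in> diagram \<kappa>. T x < v}"
  \<comment> \<open>\<open>ext\<close> fills the strip with v and \<open>cut\<close> keeps the
    entries below v. The value \<open>undefined\<close> outside the diagram makes the tableaux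
    extensional.\<close>
  define ext where "ext = (\<lambda>(\<rho>, T) x. if x \<in> diagram \<rho> then T x else if x \<in> diagram \<kappa> then v else undefined)"
  define cut where "cut T = (shape_of (?low T), restrict T (?low T))" for T :: "nat \<times> nat \<Rightarrow> nat"
  have ev: "Poly_Mapping.lookup e v = 0"
    using e[of v] by (auto simp: in_keys_iff)
  have finR: "finite ?R"
    by (rule finite_subset[OF _ finite_partitions[of "sum_list \<kappa>"]]) (auto simp: horizontal_strip_iff[OF \<kappa>])
  have split: "tab_content \<kappa> T = (\<Sum>x\<in>D. Poly_Mapping.single (T x) 1) + (\<Sum>x\<in>diagram \<kappa> - D. Poly_Mapping.single (T x) 1)"
    if "D \<subseteq> diagram \<kappa>" for D T
    unfolding tab_content_def using sum.subset_diff[OF that finite_diagram, of "\<lambda>x. Poly_Mapping.single (T x) 1"]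
    by (simp only: add.commute)
  have const: "(\<Sum>x\<in>A. Poly_Mapping.single v (1 :: nat)) = Poly_Mapping.single v (card A)" for A :: "(nat \<times> nat) set"
    by (induction A rule: infinite_finite_induct) (simp_all add: single_add[symmetric] del: sum_constant)
  have ext: "ext (\<rho>, T) \<in> tableaux \<kappa> ?E" "?low (ext (\<rho>, T)) = diagram \<rho>"
    if \<rho>: "\<rho> \<in> ?R" and T: "T \<in> tableaux \<rho> e" for \<rho> T
  proof -
    have sub: "diagram \<rho> \<subseteq> diagram \<kappa>" and cd: "card (diagram \<kappa> - diagram \<rho>) = k"
      and col: "\<And>x y. x \<in> diagram \<kappa> - diagram \<rho> \<Longrightarrow> y \<in> diagram \<kappa> - diagram \<rho> \<Longrightarrow> snd x = snd y \<Longrightarrow> x = y"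
      and p: "is_partition \<rho>"
      using \<rho> by (auto simp: horizontal_strip_def)
    have ss: "semistandard \<rho> T" and ct: "tab_content \<rho> T = e"
      using T by (auto simp: tableaux_def)
    have less: "T x < v" if "x \<in> diagram \<rho>" for x
      using tab_content_keys[OF that, of T] ct e by auto
    show low: "?low (ext (\<rho>, T)) = diagram \<rho>"
      using sub less by (auto simp: ext_def)
    have "tab_content \<kappa> (ext (\<rho>, T)) = ?E"
    proof -
      have "(\<Sum>x\<in>diagram \<rho>. Poly_Mapping.single (ext (\<rho>, T) x) 1) = e"
        unfolding ct[symmetric] tab_content_def by (rule sum.cong) (auto simp: ext_def)
      moreover have "(\<Sum>x\<in>diagram \<kappa> - diagram \<rho>. Poly_Mapping.single (ext (\<rho>, T) x) 1) =
          (\<Sum>x\<in>diagram \<kappa> - diagram \<rho>. Poly_Mapping.single v (1 :: nat))"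
        by (rule sum.cong) (auto simp: ext_def)
      ultimately show ?thesis
        unfolding split[OF sub] const cd by simp
    qed
    moreover have "semistandard \<kappa> (ext (\<rho>, T))"
      unfolding semistandard_def
    proof (intro conjI allI impI)
      fix r c c' assume *: "c < c' \<and> (r, c) \<in> diagram \<kappa> \<and> (r, c') \<in> diagram \<kappa>"
      show "ext (\<rho>, T) (r, c) \<le> ext (\<rho>, T) (r, c')"
      proof (cases "(r, c') \<in> diagram \<rho>")
        case True
        then have "(r, c) \<in> diagram \<rho>"
          using diagram_downward[OF p True, of r c] * by simp
        then show ?thesis
          using ss True * by (auto simp: ext_def semistandard_def)
      next
        case False
        then show ?thesis
          using * less[of "(r, c)"] by (auto simp: ext_def)
      qed
    next
      fix r r' c assume *: "r < r' \<and> (r, c) \<in> diagram \<kappa> \<and> (r', c) \<in> diagram \<kappa>"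
      show "ext (\<rho>, T) (r, c) < ext (\<rho>, T) (r', c)"
      proof (cases "(r', c) \<in> diagram \<rho>")
        case True
        then have "(r, c) \<in> diagram \<rho>"
          using diagram_downward[OF p True, of r c] * by simp
        then show ?thesis
          using ss True * by (auto simp: ext_def semistandard_def)
      next
        case False
        then have "(r, c) \<in> diagram \<rho>"
          using col[of "(r, c)" "(r', c)"] * by auto
        then show ?thesis
          using False * less[of "(r, c)"] by (auto simp: ext_def)
      qed
    qed
    moreover have "ext (\<rho>, T) \<in> diagram \<kappa> \<rightarrow>\<^sub>E UNIV"
      using sub by (auto simp: ext_def PiE_iff extensional_def)
    ultimately show "ext (\<rho>, T) \<in> tableaux \<kappa> ?E"
      by (simp add: tableaux_def)
  qed
  have cut: "cut T \<in> Sigma ?R (\<lambda>\<rho>. tableaux \<rho> e)" "ext (cut T) = T" if T: "T \<in> tableaux \<kappa> ?E" for T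
  proof -
    have ss: "semistandard \<kappa> T" and ct: "tab_content \<kappa> T = ?E" and PiE: "T \<in> diagram \<kappa> \<rightarrow>\<^sub>E UNIV"
      using T by (auto simp: tableaux_def)
    let ?D = "?low T" and ?\<rho> = "shape_of (?low T)"
    have le: "T x \<le> v" if "x \<in> diagram \<kappa>" for x
    proof -
      have "T x \<in> Poly_Mapping.keys e \<union> Poly_Mapping.keys (Poly_Mapping.single v k)"
        using tab_content_keys[OF that, of T] Poly_Mapping.keys_add[of e "Poly_Mapping.single v k"] unfolding ct by blast
      then show ?thesis
        using e[of "T x"] by (auto split: if_splits)
    qed
    have row: "T (r, c) \<le> T (r, c')" if "c \<le> c'" "(r, c) \<in> diagram \<kappa>" "(r, c') \<in> diagram \<kappa>" for r c c'
      using ss that unfolding semistandard_def by (cases "c = c'") simp_all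
    have col: "T (r, c) < T (r', c)" if "r < r'" "(r, c) \<in> diagram \<kappa>" "(r', c) \<in> diagram \<kappa>" for r r' c
      using ss that unfolding semistandard_def by simp
    have finD: "finite ?D"
      by (simp add: finite_diagram)
    \<comment> \<open>Entries increase weakly along rows and strictly down columns, so those below v
      form the diagram of a partition.\<close>
    have down: "(r', c') \<in> ?D" if D: "(r, c) \<in> ?D" and "r' \<le> r" "c' \<le> c" for r c r' c'
    proof -
      have "(r', c') \<in> diagram \<kappa>" "(r, c') \<in> diagram \<kappa>"
        using that diagram_downward[OF \<kappa>, of r c] by auto
      then have "T (r', c') \<le> T (r, c')" "T (r, c') \<le> T (r, c)"
        using col[of r' r c'] row[of c' c r] D \<open>r' \<le> r\<close> \<open>c' \<le> c\<close> by (cases "r' = r"; simp)+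
      then show ?thesis
        using D \<open>(r', c') \<in> diagram \<kappa>\<close> by auto
    qed
    have shape: "is_partition ?\<rho>" "diagram ?\<rho> = ?D"
      by (rule shape_of_props[OF finD], erule down, assumption+)+
    have strip: "T x = v" if "x \<in> diagram \<kappa> - ?D" for x
      using that le[of x] by auto
    have "{x \<in> diagram \<kappa>. T x = v} = diagram \<kappa> - ?D"
      using strip by auto
    then have cd: "card (diagram \<kappa> - ?D) = k"
      using lookup_tab_content[of \<kappa> T v] ev unfolding ct by (simp add: lookup_add)
    have inj: "\<forall>x\<in>diagram \<kappa> - ?D. \<forall>y\<in>diagram \<kappa> - ?D. snd x = snd y \<longrightarrow> x = y"
    proof (intro ballI impI)
      fix x y assume x: "x \<in> diagram \<kappa> - ?D" and y: "y \<in> diagram \<kappa> - ?D" and xy: "snd x = snd y"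
      have "T x = v" "T y = v"
        using strip[OF x] strip[OF y] by simp_all
      moreover obtain r r' c where "x = (r, c)" "y = (r', c)"
        using xy by (metis prod.collapse)
      ultimately show "x = y"
        using col[of r r' c] col[of r' r c] x y by (cases r r' rule: linorder_cases) simp_all
    qed
    have "horizontal_strip k \<kappa> ?\<rho>"
      unfolding horizontal_strip_def shape(2) by (intro conjI cd inj) auto
    moreover have "restrict T ?D \<in> tableaux ?\<rho> e"
    proof -
      have "semistandard ?\<rho> (restrict T ?D)"
        using ss unfolding semistandard_def shape(2) by auto
      moreover have "tab_content ?\<rho> (restrict T ?D) = (\<Sum>x\<in>?D. Poly_Mapping.single (T x) 1)"
        unfolding tab_content_def shape(2) by (rule sum.cong) auto
      moreover have "(\<Sum>x\<in>?D. Poly_Mapping.single (T x) 1) + Poly_Mapping.single v k = ?E"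
      proof -
        have "(\<Sum>x\<in>diagram \<kappa> - ?D. Poly_Mapping.single (T x) 1) = (\<Sum>x\<in>diagram \<kappa> - ?D. Poly_Mapping.single v (1 :: nat))"
          by (rule sum.cong[OF refl]) (simp only: strip)
        then show ?thesis
          unfolding ct[symmetric] using split[of ?D T] const[of "diagram \<kappa> - ?D"] cd by auto
      qed
      ultimately show ?thesis
        by (simp add: tableaux_def shape(2) restrict_PiE_iff)
    qed
    ultimately show "cut T \<in> Sigma ?R (\<lambda>\<rho>. tableaux \<rho> e)"
      using shape(1) by (simp add: cut_def)
    show "ext (cut T) = T"
    proof
      fix x
      show "ext (cut T) x = T x"
        using strip[of x] PiE by (cases x) (auto simp: ext_def cut_def shape(2) PiE_iff extensional_def)
    qed
  qed
  have "bij_betw ext (Sigma ?R (\<lambda>\<rho>. tableaux \<rho> e)) (tableaux \<kappa> ?E)"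
  proof (rule bij_betw_byWitness[where f' = cut])
    show "\<forall>a\<in>Sigma ?R (\<lambda>\<rho>. tableaux \<rho> e). cut (ext a) = a"
    proof (clarify)
      fix \<rho> T assume \<rho>: "is_partition \<rho>" "horizontal_strip k \<kappa> \<rho>" and T: "T \<in> tableaux \<rho> e"
      then have R: "\<rho> \<in> ?R"
        by simp
      have low: "?low (ext (\<rho>, T)) = diagram \<rho>"
        by (rule ext(2)[OF R T])
      have "restrict (ext (\<rho>, T)) (diagram \<rho>) = T"
        using T by (auto simp: ext_def tableaux_def PiE_iff extensional_def restrict_def)
      then show "cut (ext (\<rho>, T)) = (\<rho>, T)"
        unfolding cut_def low shape_of_diagram[OF \<rho>(1)] by simp
    qed
    show "\<forall>T\<in>tableaux \<kappa> ?E. ext (cut T) = T"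
      using cut(2) by blast
    show "ext ` Sigma ?R (\<lambda>\<rho>. tableaux \<rho> e) \<subseteq> tableaux \<kappa> ?E"
      using ext(1) by blast
    show "cut ` tableaux \<kappa> ?E \<subseteq> Sigma ?R (\<lambda>\<rho>. tableaux \<rho> e)"
      using cut(1) by (rule image_subsetI)
  qed
  then have "card (tableaux \<kappa> ?E) = card (Sigma ?R (\<lambda>\<rho>. tableaux \<rho> e))"
    by (metis bij_betw_same_card)
  then show ?thesis
    using finR by (simp add: card_SigmaI finite_tableaux)
qed

lemma mcoeff_schur_branching:
  assumes "is_partition \<kappa>" "\<And>u. u \<in> Poly_Mapping.keys e \<Longrightarrow> u < v"
  shows "mcoeff (schur \<kappa>) (e + Poly_Mapping.single v k) =
    (\<Sum>\<rho> | is_partition \<rho> \<and> hstrip \<kappa> \<rho> \<and> sum_list \<rho> + k = sum_list \<kappa>. mcoeff (schur \<rho>) e)"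
proof -
  have "{\<rho>. is_partition \<rho> \<and> hstrip \<kappa> \<rho> \<and> sum_list \<rho> + k = sum_list \<kappa>} = {\<rho>. is_partition \<rho> \<and> horizontal_strip k \<kappa> \<rho>}"
    using horizontal_strip_iff[OF assms(1)] by auto
  then show ?thesis
    using assms by (simp add: mcoeff_schur card_tableaux_branching)
qed

lemma sum_list_map_int: "sum_list (map int \<kappa>) = int (sum_list \<kappa>)"
  by (induction \<kappa>) auto

text \<open>Splitting off the last variable of the monomial gives the same recursion on both sides:
  h_k^perp on the Bernstein product and removal of the largest entries from tableaux. The induction
  is on the number of variables in e.\<close>

theorem to_Lambda_spart:
  assumes "is_partition \<kappa>"
  shows "to_Lambda (spart \<kappa> :: 'a::field_char_0 heis_sym) = schur \<kappa>"
proof (rule mseries_eqI)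
  fix e :: "nat \<Rightarrow>\<^sub>0 nat"
  show "mcoeff (to_Lambda (spart \<kappa> :: 'a heis_sym)) e = mcoeff (schur \<kappa>) e"
    using assms
  proof (induction "card (Poly_Mapping.keys e)" arbitrary: e \<kappa> rule: less_induct)
    case less
    show ?case
    proof (cases "e = 0")
      case True
      have hw: "hwt (\<lambda>w. w = int (sum_list \<kappa>)) (spart \<kappa> :: 'a heis_sym)"
        using hwt_sfun[of "map int \<kappa>", where ?'a = 'a] by (simp only: sum_list_map_int)
      show ?thesis
      proof (cases "\<kappa> = []")
        case Nil: True
        have "tableaux [] 0 = {\<lambda>_. undefined}"
          by (auto simp: tableaux_def diagram_def semistandard_def tab_content_def)
        then show ?thesis
          using True Nil by (simp add: mcoeff_0_to_Lambda sfun_def mcoeff_schur)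
      next
        case False
        then have pos: "sum_list \<kappa> > 0" and d: "(0, 0) \<in> diagram \<kappa>"
          using less.prems by (cases \<kappa>; auto simp: is_partition_Cons mem_diagram)+
        have "0 \<notin> Poly_Mapping.keys (spart \<kappa> :: 'a heis_sym)"
        proof
          assume "0 \<in> Poly_Mapping.keys (spart \<kappa> :: 'a heis_sym)"
          with hw have "int (exponent_weight 0) = int (sum_list \<kappa>)"
            unfolding hwt_def by blast
          then show False
            using pos by (metis exponent_weight_0 less_irrefl of_nat_eq_iff)
        qed
        moreover have "tab_content \<kappa> T \<noteq> 0" for T
          using tab_content_keys[OF d, of T] by auto
        then have "tableaux \<kappa> 0 = {}"
          by (simp add: tableaux_def)
        ultimately show ?thesis
          using True by (simp add: mcoeff_0_to_Lambda mcoeff_schur in_keys_iff)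
      qed
    next
      case False
      \<comment> \<open>The largest variable is taken because branching of tableaux removes the
        largest entry.\<close>
      define v where "v = Max (Poly_Mapping.keys e)"
      define k where "k = Poly_Mapping.lookup e v"
      define e' where "e' = e - Poly_Mapping.single v k"
      have v: "v \<in> Poly_Mapping.keys e"
        unfolding v_def using False by (intro Max_in) auto
      have e: "e = e' + Poly_Mapping.single v k" and ev: "Poly_Mapping.lookup e' v = 0"
        by (auto simp: e'_def k_def lookup_add lookup_minus lookup_single when_def intro!: poly_mapping_eqI)
      have keys: "Poly_Mapping.keys e' = Poly_Mapping.keys e - {v}"
        by (auto simp: e'_def k_def in_keys_iff lookup_minus lookup_single when_def split: if_splits)
      have below: "u < v" if "u \<in> Poly_Mapping.keys e'" for u
        using that unfolding keys v_def by (metis DiffD1 DiffD2 Max_ge finite_keys insertI1 le_neq_implies_less)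
      have card: "card (Poly_Mapping.keys e') < card (Poly_Mapping.keys e)"
        unfolding keys using v by (intro psubset_card_mono) auto
      have "mcoeff (to_Lambda (spart \<kappa> :: 'a heis_sym)) e =
          (\<Sum>\<rho> | is_partition \<rho> \<and> hstrip \<kappa> \<rho> \<and> sum_list \<rho> + k = sum_list \<kappa>. mcoeff (to_Lambda (spart \<rho> :: 'a heis_sym)) e')"
        unfolding e mcoeff_to_Lambda_hskew[OF ev] hskew_spart[OF less.prems] by (simp only: to_Lambda_sum mcoeff_sum)
      also have "\<dots> = (\<Sum>\<rho> | is_partition \<rho> \<and> hstrip \<kappa> \<rho> \<and> sum_list \<rho> + k = sum_list \<kappa>. mcoeff (schur \<rho>) e')"
        using less.hyps[OF card] by (intro sum.cong) auto
      also have "\<dots> = mcoeff (schur \<kappa>) e"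
        unfolding e by (rule mcoeff_schur_branching[OF less.prems below, symmetric])
      finally show ?thesis .
    qed
  qed
qed

corollary schur_sym_eq: "is_partition \<kappa> \<Longrightarrow> schur_sym \<kappa> = (spart \<kappa> :: 'a::field_char_0 heis_sym)"
  unfolding schur_sym_def to_Lambda_spart[symmetric] by (rule the_inv_f_f[OF inj_to_Lambda])

section \<open>The involution \<open>\<omega>\<close>\<close>

text \<open>The variable with index \<open>k\<close> stands for \<open>p\<^sub>k\<^sub>+\<^sub>1\<close>, so the sign below is that of
  \<open>\<omega> p\<^sub>n = (-1)\<^sup>n\<^sup>-\<^sup>1 p\<^sub>n\<close>.\<close>

definition osign :: "(nat \<Rightarrow>\<^sub>0 nat) \<Rightarrow> nat" where
  "osign t = (\<Sum>k\<in>Poly_Mapping.keys t. k * Poly_Mapping.lookup t k)"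

definition omega :: "'a::comm_ring_1 heis_sym \<Rightarrow> 'a heis_sym" where
  "omega = Poly_Mapping.mapp (\<lambda>t c. (- 1) ^ osign t * c)"

lemma osign_superset:
  "finite A \<Longrightarrow> Poly_Mapping.keys t \<subseteq> A \<Longrightarrow> osign t = (\<Sum>k\<in>A. k * Poly_Mapping.lookup t k)"
  unfolding osign_def by (rule sum.mono_neutral_left) (auto simp: in_keys_iff)

lemma osign_add: "osign (s + t) = osign s + osign t"
proof -
  let ?A = "Poly_Mapping.keys s \<union> Poly_Mapping.keys t"
  have "osign u = (\<Sum>k\<in>?A. k * Poly_Mapping.lookup u k)" if "u \<in> {s, t, s + t}" for u
    using that Poly_Mapping.keys_add[of s t] by (intro osign_superset) auto
  then show ?thesis
    by (simp add: lookup_add sum.distrib algebra_simps)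
qed

lemma osign_single: "osign (Poly_Mapping.single k n) = k * n"
  by (cases "n = 0") (simp_all add: osign_def)

lemma lookup_omega: "Poly_Mapping.lookup (omega f) t = (- 1) ^ osign t * Poly_Mapping.lookup f t"
  by (auto simp: omega_def lookup_mapp when_def in_keys_iff)

lemma omega_add: "omega (f + g) = omega f + omega g"
  by (rule poly_mapping_eqI) (simp add: lookup_omega lookup_add distrib_left)

lemma omega_0 [simp]: "omega 0 = 0"
  by (rule poly_mapping_eqI) (simp add: lookup_omega)

lemma omega_omega [simp]: "omega (omega f) = f"
  by (rule poly_mapping_eqI) (simp add: lookup_omega flip: mult.assoc power_mult_distrib)

lemma omega_single: "omega (Poly_Mapping.single t c) = Poly_Mapping.single t ((- 1) ^ osign t * c)"
  by (rule poly_mapping_eqI) (simp add: lookup_omega lookup_single when_def)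

lemma omega_mult: "omega (f * g) = omega f * omega g"
proof (induction f rule: poly_mapping_sum_induct)
  case (3 s a)
  show ?case
    by (induction g rule: poly_mapping_sum_induct)
      (simp_all add: omega_add omega_single mult_single osign_add power_add algebra_simps)
qed (simp_all add: omega_add distrib_right)

lemma omega_hconst [simp]: "omega (hconst c) = hconst c"
  by (simp add: hconst_def omega_single osign_def)

lemma omega_1 [simp]: "omega 1 = 1"
  using omega_hconst[of 1] by simp

lemma omega_linear: "hlinear omega"
  by (simp add: hlinear_def omega_add omega_mult)

lemma omega_hvar: "omega (hvar n) = hconst ((- 1) ^ (n - 1)) * hvar n"
  by (simp add: hvar_def hconst_def omega_single mult_single osign_single)

lemma omega_hderiv: "omega (hderiv n f) = hconst ((- 1) ^ (n - 1)) * hderiv n (omega f)"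
proof (rule hlinear_eqI[where S = "\<lambda>f. omega (hderiv n f)"])
  show "hlinear (\<lambda>f. omega (hderiv n f))"
    by (intro hlinear_comp[OF omega_linear] hlinear_hderiv)
  show "hlinear (\<lambda>f. hconst ((- 1) ^ (n - 1)) * hderiv n (omega f))"
    by (intro hlinear_mult_left hlinear_comp[OF hlinear_hderiv] omega_linear)
  fix t :: "nat \<Rightarrow>\<^sub>0 nat"
  let ?k = "n - 1" and ?u = "t - Poly_Mapping.single (n - 1) 1"
  show "omega (hderiv n (Poly_Mapping.single t 1)) = hconst ((- 1) ^ (n - 1)) * hderiv n (omega (Poly_Mapping.single t (1 :: 'a)))"
  proof (cases "Poly_Mapping.lookup t ?k = 0")
    case False
    have t: "t = ?u + Poly_Mapping.single ?k 1"
      using False by (intro poly_mapping_eqI) (auto simp: lookup_add lookup_minus lookup_single when_def)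
    have "osign t = osign ?u + ?k"
      by (subst t) (simp only: osign_add osign_single mult_1_right)
    moreover have "(- 1 :: 'a) ^ u = (- 1) ^ k * (- 1) ^ (u + k)" for u k
      by (cases "even k") (simp_all add: power_add)
    ultimately have "(- 1 :: 'a) ^ osign ?u = (- 1) ^ ?k * (- 1) ^ osign t"
      by (simp only:)
    then show ?thesis
      by (simp add: hderiv_def omega_single partial_deriv_single hconst_def mult_single mult_ac)
  qed (simp add: hderiv_def partial_deriv_single omega_single)
qed

lemma omega_ann: "omega (ann b s f) = ann (\<lambda>n. (- 1) ^ (n - 1) * b n) s (omega f)"
proof (rule ann_unique[symmetric])
  fix r :: nat
  have "hconst (of_nat r) * omega (ann b r f) = omega (hconst (of_nat r) * ann b r f)"
    by (simp add: omega_mult)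
  also have "\<dots> = (\<Sum>n = 1..r. hconst (of_nat n) * (hconst ((- 1) ^ (n - 1) * b n) * hderiv n (omega (ann b (r - n) f))))"
    unfolding ann_newton hlinear_sum[OF omega_linear]
    by (intro sum.cong refl) (simp add: omega_mult omega_hderiv hconst_mult mult_ac)
  finally show "hconst (of_nat r) * omega (ann b r f) = \<dots>" .
qed simp

lemma omega_cre: "omega (cre a r) = cre (\<lambda>n. (- 1) ^ (n - 1) * a n) r"
proof (rule cre_unique[symmetric])
  fix r :: nat
  have "hconst (of_nat r) * omega (cre a (int r)) = omega (hconst (of_int (int r)) * cre a (int r))"
    by (simp add: omega_mult)
  also have "\<dots> = (\<Sum>n = 1..r. hconst (of_nat n) * (hconst ((- 1) ^ (n - 1) * a n) * (hvar n * omega (cre a (int r - int n)))))"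
    unfolding cre_newton[OF order_refl] hlinear_sum[OF omega_linear]
    by (intro sum.cong refl) (simp add: omega_mult omega_hvar hconst_mult mult_ac)
  finally show "hconst (of_nat r) * omega (cre a (int r)) = \<dots>" .
qed (simp_all add: cre_neg)

lemma hwt_omega: "hwt P (omega f) = hwt P (f :: 'a::field_char_0 heis_sym)"
  by (auto simp: hwt_def in_keys_iff lookup_omega)

lemma omega_vop:
  "omega (vop a b k f) = vop (\<lambda>n. (- 1) ^ (n - 1) * a n) (\<lambda>n. (- 1) ^ (n - 1) * b n) k (omega f)"
proof -
  obtain d where d: "hwt (\<lambda>w. w \<le> int d) f"
    using hwt_bounded by blast
  then have d': "hwt (\<lambda>w. w \<le> int d) (omega f)"
    by (simp only: hwt_omega)
  show ?thesis
    unfolding vop_eq[OF d] vop_eq[OF d'] hlinear_sum[OF omega_linear]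
    by (simp only: omega_mult omega_cre omega_ann)
qed

text \<open>\<open>omega\<close> exchanges the e_k and the h_k, hence also their adjoints; in
  coefficients, (-1)^(n-1) times -(-1)^n is 1.\<close>

lemma omega_eskew: "omega (eskew k f) = hskew k (omega f)"
  unfolding eskew_def hskew_def omega_ann
proof (rule ann_cong)
  fix n :: nat assume "n > 0"
  then have "(- 1 :: 'a) ^ n = (- 1) ^ (n - 1) * - 1"
    by (cases n) auto
  then show "(- 1) ^ (n - 1) * - ((- 1) ^ n) = (1 :: 'a)"
    by (simp flip: power_mult_distrib)
qed

text \<open>h_k^perp turns the left side into a sum over vertical strips of the conjugate and the
  right side into one over horizontal strips. Transposition and the induction hypothesis match these
  sums for all k > 0, and the constant terms vanish on both sides.\<close>

theorem omega_spart:
  "is_partition \<mu> \<Longrightarrow> omega (spart (conjugate \<mu>)) = (spart \<mu> :: 'a::field_char_0 heis_sym)"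
proof (induction "sum_list \<mu>" arbitrary: \<mu> rule: less_induct)
  case less
  let ?s = "\<lambda>\<mu>. spart \<mu> :: 'a heis_sym"
  note conj = conjugate_props[OF less.prems]
  show ?case
  proof (cases "\<mu> = []")
    case False
    then have pos: "sum_list \<mu> > 0"
      using less.prems by (cases \<mu>) (auto simp: is_partition_Cons)
    have const: "Poly_Mapping.lookup (?s \<nu>) 0 = 0" if "sum_list \<nu> > 0" for \<nu>
    proof -
      have "hwt (\<lambda>w. w = int (sum_list \<nu>)) (?s \<nu>)"
        using hwt_sfun[of "map int \<nu>", where ?'a = 'a] by (simp only: sum_list_map_int)
      then have "0 \<in> Poly_Mapping.keys (?s \<nu>) \<Longrightarrow> int (exponent_weight 0) = int (sum_list \<nu>)"
        unfolding hwt_def by blast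
      then have "0 \<notin> Poly_Mapping.keys (?s \<nu>)"
        using that by (metis exponent_weight_0 less_irrefl of_nat_eq_iff)
      then show ?thesis
        by (simp add: in_keys_iff)
    qed
    have "omega (?s (conjugate \<mu>)) - ?s \<mu> = 0"
    proof (rule hskew_eq_0_imp)
      fix k :: nat assume k: "k > 0"
      have "hskew k (omega (?s (conjugate \<mu>))) = omega (eskew k (?s (conjugate \<mu>)))"
        by (simp only: omega_eskew)
      also have "\<dots> = (\<Sum>\<sigma> | is_partition \<sigma> \<and> vstrip (conjugate \<mu>) \<sigma> \<and> sum_list \<sigma> + k = sum_list (conjugate \<mu>). omega (?s \<sigma>))"
        by (simp only: eskew_spart[OF conj(1)] hlinear_sum[OF omega_linear])
      also have "\<dots> = (\<Sum>\<rho> | is_partition \<rho> \<and> hstrip \<mu> \<rho> \<and> sum_list \<rho> + k = sum_list \<mu>. ?s \<rho>)"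
      proof (rule sum.reindex_bij_witness[of _ conjugate conjugate])
        fix \<sigma> assume \<sigma>: "\<sigma> \<in> {\<sigma>. is_partition \<sigma> \<and> vstrip (conjugate \<mu>) \<sigma> \<and> sum_list \<sigma> + k = sum_list (conjugate \<mu>)}"
        then have c\<sigma>: "is_partition \<sigma>" by simp
        note cs = conjugate_props[OF c\<sigma>]
        have "vertical_strip k (conjugate \<mu>) \<sigma>"
          using \<sigma> by (simp add: vertical_strip_iff)
        then have "horizontal_strip k \<mu> (conjugate \<sigma>)"
          using strip_conjugate[OF conj(1) c\<sigma>] by (simp only: conj(3))
        then show "conjugate \<sigma> \<in> {\<rho>. is_partition \<rho> \<and> hstrip \<mu> \<rho> \<and> sum_list \<rho> + k = sum_list \<mu>}"
          using cs by (simp add: horizontal_strip_iff[OF less.prems])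
        show "conjugate (conjugate \<sigma>) = \<sigma>"
          by (rule cs(3))
        \<comment> \<open>k > 0 boxes have been removed, so the induction hypothesis
          applies.\<close>
        have "sum_list (conjugate \<sigma>) < sum_list \<mu>"
          using \<sigma> k by (simp add: cs(4) conj(4))
        from less.hyps[OF this cs(1)] show "?s (conjugate \<sigma>) = omega (?s \<sigma>)"
          by (simp only: cs(3))
      next
        fix \<rho> assume \<rho>: "\<rho> \<in> {\<rho>. is_partition \<rho> \<and> hstrip \<mu> \<rho> \<and> sum_list \<rho> + k = sum_list \<mu>}"
        then have p\<rho>: "is_partition \<rho>" by simp
        note cr = conjugate_props[OF p\<rho>]
        show "conjugate (conjugate \<rho>) = \<rho>"
          by (rule cr(3))
        have "horizontal_strip k \<mu> \<rho>"
          using \<rho> by (simp add: horizontal_strip_iff[OF less.prems])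
        then have "vertical_strip k (conjugate \<mu>) (conjugate \<rho>)"
          using strip_conjugate[OF conj(1) cr(1)] by (simp only: conj(3) cr(3))
        then show "conjugate \<rho> \<in> {\<sigma>. is_partition \<sigma> \<and> vstrip (conjugate \<mu>) \<sigma> \<and> sum_list \<sigma> + k = sum_list (conjugate \<mu>)}"
          using cr by (simp add: vertical_strip_iff)
      qed
      also have "\<dots> = hskew k (?s \<mu>)"
        by (rule hskew_spart[OF less.prems, symmetric])
      finally show "hskew k (omega (?s (conjugate \<mu>)) - ?s \<mu>) = 0"
        by (simp add: hlinear_diff[OF hskew_linear])
    next
      show "Poly_Mapping.lookup (omega (?s (conjugate \<mu>)) - ?s \<mu>) 0 = 0"
        using const[of \<mu>] const[of "conjugate \<mu>"] pos by (simp add: lookup_minus lookup_omega conj(4))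
    qed
    then show ?thesis
      by simp
  qed (simp add: conjugate_def sfun_def)
qed

section \<open>Straightening\<close>

lemma sfun_Cons: "sfun (a # \<nu>) = bern a (sfun \<nu>)"
  by (simp add: sfun_def)

lemma sfun_append_eq_0: "sfun \<nu> = (0 :: 'a::field_char_0 heis_sym) \<Longrightarrow> sfun (\<kappa> @ \<nu>) = (0 :: 'a heis_sym)"
  by (induction \<kappa>) (simp_all add: sfun_Cons hlinear_0 bern_linear)

text \<open>p applications of \<open>bern_swap\<close>: each entry that is passed loses 1, the
  moving entry gains 1, and the sign changes.\<close>

lemma sfun_move:
  "p \<le> length \<nu> \<Longrightarrow>
    sfun (a # \<nu>) = (- 1) ^ p * (sfun (map (\<lambda>x. x - 1) (take p \<nu>) @ (a + int p) # drop p \<nu>) :: 'a::field_char_0 heis_sym)"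
proof (induction p arbitrary: a \<nu>)
  case (Suc p)
  then obtain b \<kappa> where \<nu>: "\<nu> = b # \<kappa>" "p \<le> length \<kappa>"
    by (cases \<nu>) auto
  have "hlinear (\<lambda>f. bern (b - 1) f :: 'a heis_sym)"
    by (rule bern_linear)
  then have "bern (b - 1) ((- 1) ^ p * f) = (- 1) ^ p * (bern (b - 1) f :: 'a heis_sym)" for f
    by (cases "even p") (simp_all add: hlinear_uminus)
  moreover have "sfun (a # \<nu>) = - (bern (b - 1) (sfun ((a + 1) # \<kappa>)) :: 'a heis_sym)"
    by (simp add: \<nu>(1) sfun_Cons bern_swap[of a b])
  ultimately show ?case
    using Suc.IH[OF \<nu>(2), of "a + 1"] by (simp add: \<nu>(1) sfun_Cons add.assoc)
qed simp

text \<open>In a decreasing list of nonnegative entries zeros can only be trailing, and they act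
  trivially since B_0 1 = 1.\<close>

lemma sfun_nonneg:
  assumes "sorted_wrt (\<ge>) \<tau>" "\<And>x. x \<in> set \<tau> \<Longrightarrow> x \<ge> 0"
  shows "is_partition (filter (\<lambda>x. x \<noteq> 0) (map nat \<tau>)) \<and>
    sfun \<tau> = (spart (filter (\<lambda>x. x \<noteq> 0) (map nat \<tau>)) :: 'a::field_char_0 heis_sym)"
  using assms
proof (induction \<tau>)
  case (Cons x \<tau>)
  then have IH: "is_partition (filter (\<lambda>x. x \<noteq> 0) (map nat \<tau>))"
      "sfun \<tau> = (spart (filter (\<lambda>x. x \<noteq> 0) (map nat \<tau>)) :: 'a heis_sym)"
    by auto
  show ?case
  proof (cases "x = 0")
    case True
    have "y = 0" if "y \<in> set \<tau>" for y
      using Cons.prems that True by force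
    then have "filter (\<lambda>x. x \<noteq> 0) (map nat (x # \<tau>)) = []" "filter (\<lambda>x. x \<noteq> 0) (map nat \<tau>) = []"
      using True by (auto simp: filter_empty_conv)
    then show ?thesis
      using IH True by (simp add: sfun_Cons) (simp add: sfun_def bern_1)
  next
    case False
    then have x: "x > 0" "int (nat x) = x" "nat x \<noteq> 0"
      using Cons.prems(2)[of x] by auto
    let ?\<rho> = "filter (\<lambda>x. x \<noteq> 0) (map nat \<tau>)"
    have "y \<le> nat x" if "y \<in> set ?\<rho>" for y
      using that Cons.prems(1) by (auto intro: nat_mono)
    then have "first_part ?\<rho> \<le> nat x"
      by (cases ?\<rho>) (simp, metis first_part_simps(2) list.set_intros(1))
    then show ?thesis
      using IH x by (simp add: is_partition_Cons sfun_Cons)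
  qed
qed (simp add: sfun_def)

lemma length_staircase [simp]: "length (staircase l) = l"
  by (simp add: staircase_def)

lemma nth_staircase: "k < l \<Longrightarrow> staircase l ! k = int l - 1 - int k"
  by (simp add: staircase_def of_nat_diff)

text \<open>Undoing the staircase makes a weakly decreasing result strictly decreasing. Distinct
  entries have one such order, and it determines the permutation; this gives the description in
  \<open>straightening_perm\<close> its meaning.\<close>

lemma straighten_unique:
  fixes \<nu> :: "int list"
  defines "w \<equiv> map2 (+) \<nu> (staircase (length \<nu>))"
  assumes dist: "distinct w"
    and \<sigma>: "\<sigma> permutes {..<length \<nu>}" "sorted_wrt (\<ge>) (straighten_by \<sigma> \<nu>)"
    and \<tau>: "\<tau> permutes {..<length \<nu>}" "sorted_wrt (\<ge>) (straighten_by \<tau> \<nu>)"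
  shows "\<sigma> = \<tau>"
proof -
  have len: "length w = length \<nu>"
    by (simp add: w_def)
  have strict: "sorted_wrt (>) (permute_list \<rho> w)"
    if "\<rho> permutes {..<length \<nu>}" "sorted_wrt (\<ge>) (straighten_by \<rho> \<nu>)" for \<rho>
    unfolding sorted_wrt_iff_nth_less
  proof (intro allI impI)
    fix x y assume xy: "x < y" "y < length (permute_list \<rho> w)"
    then have "straighten_by \<rho> \<nu> ! x \<ge> straighten_by \<rho> \<nu> ! y"
      using that(2) unfolding sorted_wrt_iff_nth_less by (auto simp: straighten_by_def w_def)
    then show "permute_list \<rho> w ! x > permute_list \<rho> w ! y"
      using xy unfolding straighten_by_def w_def[symmetric] by (auto simp: len nth_staircase)
  qed
  have "rev (permute_list \<sigma> w) = rev (permute_list \<tau> w)"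
  proof (rule strict_sorted_equal)
    show "sorted_wrt (<) (rev (permute_list \<sigma> w))" "sorted_wrt (<) (rev (permute_list \<tau> w))"
      using strict[OF \<sigma>] strict[OF \<tau>] by (simp_all add: sorted_wrt_rev)
    show "set (rev (permute_list \<sigma> w)) = set (rev (permute_list \<tau> w))"
      using \<sigma>(1) \<tau>(1) by (simp add: len)
  qed
  then have eq: "permute_list \<sigma> w = permute_list \<tau> w"
    by simp
  show ?thesis
  proof
    fix x
    show "\<sigma> x = \<tau> x"
    proof (cases "x < length \<nu>")
      case True
      then have "w ! \<sigma> x = w ! \<tau> x"
        using arg_cong[OF eq, of "\<lambda>xs. xs ! x"] \<sigma>(1) \<tau>(1) by (simp add: permute_list_nth len)
      moreover have "\<sigma> x < length w" "\<tau> x < length w"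
        using True permutes_in_image[OF \<sigma>(1), of x] permutes_in_image[OF \<tau>(1), of x] by (auto simp: len)
      ultimately show ?thesis
        using dist by (simp add: nth_eq_iff_index_eq)
    next
      case False
      then show ?thesis
        using \<sigma>(1) \<tau>(1) by (simp add: permutes_def)
    qed
  qed
qed

text \<open>Moved behind all parts of \<mu>, the operator acts on 1 as h_(a + l) with negative
  index.\<close>

lemma bern_very_negative:
  assumes "a < - int (length \<mu>)"
  shows "bern a (spart \<mu>) = (0 :: 'a::field_char_0 heis_sym)"
proof -
  have "sfun [a + int (length \<mu>)] = (0 :: 'a heis_sym)"
    using assms by (simp add: sfun_def bern_1 hsym_neg)
  then have "sfun (map (\<lambda>x. x - 1) (map int \<mu>) @ [a + int (length \<mu>)]) = (0 :: 'a heis_sym)"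
    by (rule sfun_append_eq_0)
  then show ?thesis
    using sfun_move[of "length \<mu>" "map int \<mu>" a, where ?'a = 'a] by (simp add: sfun_Cons)
qed

text \<open>\<mu> is already decreasing, so straightening only inserts the first entry at its place
  p. Inserting it by \<open>sfun_move\<close> produces the same tuple and the same sign.\<close>

theorem bern_straighten:
  assumes \<mu>: "is_partition \<mu>" and a: "- int (length \<mu>) \<le> a"
  defines "\<nu> \<equiv> juxtapose a \<mu>"
  shows "bern a (spart \<mu>) = hconst (of_int (tuple_sgn \<nu>)) * (spart (tuple_part \<nu>) :: 'a::field_char_0 heis_sym)"
    and "tuple_sgn \<nu> \<noteq> 0 \<Longrightarrow> is_partition (tuple_part \<nu>)"
proof -
  define l where "l = length \<mu>"
  define w where "w = map2 (+) \<nu> (staircase (length \<nu>))"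
  have len: "length \<nu> = Suc l" "length w = Suc l"
    by (simp_all add: \<nu>_def juxtapose_def l_def w_def)
  have w0: "w ! 0 = a + int l"
    by (simp add: w_def \<nu>_def juxtapose_def l_def nth_staircase)
  have wS: "w ! Suc k = int (\<mu> ! k) + int l - 1 - int k" if "k < l" for k
    using that by (simp add: w_def \<nu>_def juxtapose_def l_def nth_staircase)
  have antimono: "\<mu> ! y \<le> \<mu> ! x" if "x \<le> y" "y < l" for x y
    using nth_default_antimono[OF \<mu> that(1)] that by (simp add: nth_default_def l_def)
  have wdec: "w ! Suc y < w ! Suc x" if "x < y" "y < l" for x y
    using antimono[of x y] that by (simp add: wS)
  have distinct_tail: "w ! Suc x \<noteq> w ! Suc y" if "x \<noteq> y" "x < l" "y < l" for x y
    using wdec[of x y] wdec[of y x] that by (cases x y rule: linorder_cases) auto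
  have deg_iff: "degenerate \<nu> \<longleftrightarrow> \<not> distinct w"
    by (simp add: degenerate_def w_def)
  have dist_iff: "distinct w \<longleftrightarrow> (\<forall>x<Suc l. \<forall>y<Suc l. x \<noteq> y \<longrightarrow> w ! x \<noteq> w ! y)"
    by (simp only: distinct_conv_nth len)
  \<comment> \<open>The entries coming from \<mu> are strictly decreasing, so a repetition involves
    the first entry.\<close>
  have deg: "degenerate \<nu> \<longleftrightarrow> (\<exists>k<l. w ! Suc k = w ! 0)"
  proof
    assume "degenerate \<nu>"
    then obtain x y where xy: "x < Suc l" "y < Suc l" "x \<noteq> y" "w ! x = w ! y"
      unfolding deg_iff dist_iff by blast
    show "\<exists>k<l. w ! Suc k = w ! 0"
    proof (cases x)
      case 0
      with xy show ?thesis
        by (cases y) auto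
    next
      case (Suc x')
      with xy distinct_tail[of x'] show ?thesis
        by (cases y) auto
    qed
  next
    assume "\<exists>k<l. w ! Suc k = w ! 0"
    then obtain k where "Suc k < Suc l" "0 < Suc l" "Suc k \<noteq> 0" "w ! Suc k = w ! 0"
      by auto
    then show "degenerate \<nu>"
      unfolding deg_iff dist_iff by blast
  qed
  have "bern a (spart \<mu>) = hconst (of_int (tuple_sgn \<nu>)) * (spart (tuple_part \<nu>) :: 'a heis_sym) \<and>
    (tuple_sgn \<nu> \<noteq> 0 \<longrightarrow> is_partition (tuple_part \<nu>))"
  proof (cases "degenerate \<nu>")
    case True
    then obtain k where k: "k < l" "int (\<mu> ! k) = a + int k + 1"
      using deg wS w0 by force
    \<comment> \<open>After passing k entries the moving index a + k is one less than the next
      entry, so \<open>bern_degenerate\<close> applies.\<close>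
    have "drop k (map int \<mu>) = int (\<mu> ! k) # drop (Suc k) (map int \<mu>)"
      using k(1) by (simp add: l_def Cons_nth_drop_Suc[symmetric])
    then have "sfun ((a + int k) # drop k (map int \<mu>)) = (0 :: 'a heis_sym)"
      using bern_degenerate[of "int (\<mu> ! k)"] by (simp add: sfun_Cons k(2))
    then have "sfun (map (\<lambda>x. x - 1) (take k (map int \<mu>)) @ (a + int k) # drop k (map int \<mu>)) = (0 :: 'a heis_sym)"
      by (rule sfun_append_eq_0)
    then have "bern a (spart \<mu>) = (0 :: 'a heis_sym)"
      using sfun_move[of k "map int \<mu>" a, where ?'a = 'a] k(1) by (simp add: sfun_Cons l_def)
    with True show ?thesis
      by (simp add: tuple_sgn_def)
  next
    case False
    \<comment> \<open>The number of shifted entries above the first one, that is, the position at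
      which it must be inserted.\<close>
    define p where "p = card {k. k < l \<and> w ! 0 < w ! Suc k}"
    have "{k. k < l \<and> w ! 0 < w ! Suc k} = {..<p}"
      unfolding p_def
    proof (rule downward_closed_nat_set)
      fix x y assume "x \<in> {k. k < l \<and> w ! 0 < w ! Suc k}" "y \<le> x"
      then show "y \<in> {k. k < l \<and> w ! 0 < w ! Suc k}"
        using wdec[of y x] by (cases "y = x") auto
    qed simp
    then have p1: "k < p \<longleftrightarrow> k < l \<and> w ! 0 < w ! Suc k" for k
      by auto
    then have pl: "p \<le> l"
      using p1[of l] by (simp add: not_less[symmetric])
    have p2: "w ! Suc k < w ! 0" if "p \<le> k" "k < l" for k
      using that p1[of k] False deg by force
    \<comment> \<open>The cycle that takes entry 0 to position p and moves the p entries after it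
      one place forward.\<close>
    define \<sigma> where "\<sigma> x = (if x < p then Suc x else if x = p then 0 else x)" for x
    define \<tau> where "\<tau> = map (\<lambda>x. x - 1) (take p (map int \<mu>)) @ (a + int p) # drop p (map int \<mu>)"
    have len\<tau>: "length \<tau> = Suc l"
      using pl by (simp add: \<tau>_def l_def)
    have \<sigma>_perm: "\<sigma> permutes {..<length \<nu>}"
    proof (rule bij_imp_permutes)
      show "bij_betw \<sigma> {..<length \<nu>} {..<length \<nu>}"
        by (rule bij_betw_byWitness[where f' = "\<lambda>y. if y = 0 then p else if y \<le> p then y - 1 else y"])
          (use pl in \<open>auto simp: \<sigma>_def len\<close>)
      show "\<sigma> x = x" if "x \<notin> {..<length \<nu>}" for x
        using that pl by (auto simp: \<sigma>_def len)
    qed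
    have nth\<tau>: "\<tau> ! x = w ! \<sigma> x - (int l - int x)" if x: "x < Suc l" for x
    proof -
      consider "x < p" | "x = p" | "p < x" by linarith
      then show ?thesis
      proof cases
        case 1
        then show ?thesis
          using pl wS[of x] by (simp add: \<tau>_def \<sigma>_def nth_append l_def)
      next
        case 2
        then show ?thesis
          using pl w0 by (simp add: \<tau>_def \<sigma>_def nth_append l_def)
      next
        case 3
        then obtain x' where x': "x = Suc x'" "p \<le> x'" "x' < l"
          using x by (cases x) auto
        then show ?thesis
          using 3 pl wS[of x'] by (simp add: \<tau>_def \<sigma>_def nth_append l_def Suc_diff_le)
      qed
    qed
    have strict: "w ! \<sigma> y < w ! \<sigma> x" if xy: "x < y" "y < Suc l" for x y
    proof -
      consider "y < p" | "y = p" | "x < p" "p < y" | "x = p" "p < y" | "p < x" using xy by linarith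
      then show ?thesis
      proof cases
        case 1
        then show ?thesis
          using xy pl wdec[of x y] by (simp add: \<sigma>_def)
      next
        case 2
        then show ?thesis
          using xy p1[of x] by (simp add: \<sigma>_def)
      next
        case 3
        then obtain y' where "y = Suc y'" "p \<le> y'" "y' < l"
          using xy by (cases y) auto
        then show ?thesis
          using 3 p1[of x] p2[of y'] by (simp add: \<sigma>_def)
      next
        case 4
        then obtain y' where "y = Suc y'" "p \<le> y'" "y' < l"
          using xy by (cases y) auto
        then show ?thesis
          using 4 p2[of y'] by (simp add: \<sigma>_def)
      next
        case 5
        then obtain x' y' where "x = Suc x'" "y = Suc y'" "x' < y'" "y' < l"
          using xy by (cases x; cases y) auto
        then show ?thesis
          using 5 xy wdec[of x' y'] by (simp add: \<sigma>_def)
      qed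
    qed
    have straight: "straighten_by \<sigma> \<nu> = \<tau>"
    proof (rule nth_equalityI)
      show "length (straighten_by \<sigma> \<nu>) = length \<tau>"
        unfolding straighten_by_def w_def[symmetric] by (simp add: len len\<tau>)
      fix x assume "x < length (straighten_by \<sigma> \<nu>)"
      then have x: "x < Suc l"
        unfolding straighten_by_def w_def[symmetric] by (simp add: len)
      have "permute_list \<sigma> w ! x = w ! \<sigma> x"
        by (rule permute_list_nth) (use \<sigma>_perm x in \<open>simp_all add: len\<close>)
      then show "straighten_by \<sigma> \<nu> ! x = \<tau> ! x"
        using x unfolding straighten_by_def w_def[symmetric] by (simp add: len nth\<tau> nth_staircase)
    qed
    have sorted: "sorted_wrt (\<ge>) \<tau>"
      unfolding sorted_wrt_iff_nth_less
    proof (intro allI impI)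
      fix x y assume xy: "x < y" "y < length \<tau>"
      \<comment> \<open>A strictly decreasing integer sequence drops by at least the number of
        steps, which compensates the staircase.\<close>
      have mono: "w ! \<sigma> y \<le> w ! \<sigma> x - (int y - int x)"
        using xy
      proof (induction y)
        case (Suc y)
        show ?case
        proof (cases "x = y")
          case True
          then show ?thesis
            using strict[of x "Suc y"] Suc.prems len\<tau> by simp
        next
          case False
          then show ?thesis
            using strict[of y "Suc y"] Suc len\<tau> by simp
        qed
      qed simp
      then show "\<tau> ! y \<le> \<tau> ! x"
        using nth\<tau>[of x] nth\<tau>[of y] xy len\<tau> by simp
    qed
    \<comment> \<open>The lower bound on a enters here: if the first entry travels to the end, it
      becomes a + l. Otherwise the last entry is the last part of \<mu>.\<close>
    have last: "\<tau> ! l \<ge> 0"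
    proof (cases "p = l")
      case True
      then show ?thesis
        using a pl by (simp add: \<tau>_def nth_append l_def)
    next
      case False
      then obtain l' where l': "l = Suc l'"
        using pl by (cases l) auto
      have "\<not> l < p" "l \<noteq> p"
        using False pl by auto
      then show ?thesis
        using nth\<tau>[of l] wS[of l'] l' by (simp add: \<sigma>_def)
    qed
    have nonneg: "x \<ge> 0" if mem: "x \<in> set \<tau>" for x
    proof -
      obtain y where y: "y < Suc l" "x = \<tau> ! y"
        using mem by (auto simp: in_set_conv_nth len\<tau>)
      have "\<tau> ! l \<le> \<tau> ! y"
        using sorted y(1) unfolding sorted_wrt_iff_nth_less by (cases "y = l") (auto simp: len\<tau>)
      with last y show ?thesis
        by simp
    qed
    have perm: "straightening_perm \<nu> = \<sigma>"
      unfolding straightening_perm_def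
    proof (rule the_equality)
      show "\<sigma> permutes {..<length \<nu>} \<and> sorted_wrt (\<ge>) (straighten_by \<sigma> \<nu>)"
        using \<sigma>_perm sorted straight by simp
      fix \<rho> assume \<rho>: "\<rho> permutes {..<length \<nu>} \<and> sorted_wrt (\<ge>) (straighten_by \<rho> \<nu>)"
      show "\<rho> = \<sigma>"
        by (rule straighten_unique[of \<nu>]) (use \<rho> \<sigma>_perm sorted straight False in \<open>simp_all add: degenerate_def\<close>)
    qed
    \<comment> \<open>The inversions of the cycle are the p pairs formed by position p and an
      earlier position.\<close>
    have "{(x, y). x < y \<and> y < Suc l \<and> \<sigma> y < \<sigma> x} = (\<lambda>x. (x, p)) ` {..<p}"
      using pl by (auto simp: \<sigma>_def split: if_splits)
    then have "perm_length (length \<nu>) \<sigma> = p"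
      by (simp add: perm_length_def len card_image inj_on_def)
    then have sgn: "tuple_sgn \<nu> = (- 1) ^ p"
      using False by (simp add: tuple_sgn_def perm)
    have part: "tuple_part \<nu> = filter (\<lambda>x. x \<noteq> 0) (map nat \<tau>)"
      by (simp add: tuple_part_def perm straight)
    have "hconst (of_int ((- 1) ^ p)) = ((- 1) ^ p :: 'a heis_sym)"
      by (cases "even p") (simp_all add: hconst_uminus)
    moreover have "bern a (spart \<mu>) = (- 1) ^ p * (sfun \<tau> :: 'a heis_sym)"
      using sfun_move[of p "map int \<mu>" a, where ?'a = 'a] pl by (simp add: sfun_Cons \<tau>_def l_def)
    ultimately show ?thesis
      using sfun_nonneg[OF sorted nonneg, where ?'a = 'a] by (simp add: sgn part)
  qed
  then show "bern a (spart \<mu>) = hconst (of_int (tuple_sgn \<nu>)) * (spart (tuple_part \<nu>) :: 'a heis_sym)"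
    "tuple_sgn \<nu> \<noteq> 0 \<Longrightarrow> is_partition (tuple_part \<nu>)"
    by blast+
qed

section \<open>The action on Schur functions\<close>

text \<open>The substitution of u z for z.\<close>

lemma vop_scale:
  assumes "u \<noteq> 0"
  shows "vop (\<lambda>n. u ^ n * a n) (\<lambda>n. inverse u ^ n * b n) k f = hconst (u powi k) * vop a b k f"
proof -
  obtain d where d: "hwt (\<lambda>w. w \<le> int d) f"
    using hwt_bounded by blast
  have "hconst (u ^ nat (k + int s)) * cre a (k + int s) * (hconst (inverse u ^ s) * ann b s f) =
      hconst (u powi k) * (cre a (k + int s) * ann b s f)" for s
  proof (cases "k + int s < 0")
    case False
    then have "u ^ nat (k + int s) = u powi (k + int s)"
      by (simp add: power_int_def)
    also have "\<dots> = u powi k * u ^ s"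
      using assms by (simp add: power_int_add)
    finally have "u ^ nat (k + int s) * inverse u ^ s = u powi k"
      using assms by (simp add: power_inverse)
    then have "hconst (u powi k) = hconst (u ^ nat (k + int s)) * hconst (inverse u ^ s)"
      by (simp only: hconst_mult[symmetric])
    then show ?thesis
      by (simp only: mult_ac)
  qed (simp add: cre_neg)
  then show ?thesis
    unfolding vop_eq[OF d] cre_scale ann_scale by (simp only: sum_distrib_left)
qed

lemma vop_factor:
  assumes d: "hwt (\<lambda>w. w \<le> int d) f" and N: "k + int d \<le> int N"
  shows "vop (\<lambda>n. a n + a' n) b k f = (\<Sum>j\<le>N. cre a (int j) * vop a' b (k - int j) f)"
proof -
  have "vop (\<lambda>n. a n + a' n) b k f = (\<Sum>s\<le>d. \<Sum>j\<le>N. cre a (int j) * (cre a' (k - int j + int s) * ann b s f))"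
    unfolding vop_eq[OF d]
  proof (intro sum.cong refl)
    fix s assume "s \<in> {..d}"
    then have "k + int s \<le> int N"
      using N by auto
    note add = cre_add[OF this]
    have e: "k + int s - int j = k - int j + int s" for j
      by simp
    show "cre (\<lambda>n. a n + a' n) (k + int s) * ann b s f = (\<Sum>j\<le>N. cre a (int j) * (cre a' (k - int j + int s) * ann b s f))"
      by (simp only: add sum_distrib_right mult.assoc e)
  qed
  also have "\<dots> = (\<Sum>j\<le>N. \<Sum>s\<le>d. cre a (int j) * (cre a' (k - int j + int s) * ann b s f))"
    by (rule sum.swap)
  also have "\<dots> = (\<Sum>j\<le>N. cre a (int j) * vop a' b (k - int j) f)"
    by (simp only: vop_eq[OF d] sum_distrib_left)
  finally show ?thesis .
qed

lemma cre_geometric: "cre (\<lambda>n. u ^ n / of_nat n) (int j) = hconst (u ^ j) * hsym (int j)"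
  using cre_scale[of u "\<lambda>n. 1 / of_nat n" "int j"] by (simp add: hsym_def)

text \<open>In generating functions, \<open>X\<^sup>+(z)\<close> is \<open>H(z/q) B(q z)\<close> and \<open>\<omega> X\<^sup>-(z) \<omega>\<close> is \<open>H(-q\<^sup>2 z) B(-z)\<close>, where \<open>H\<close> is
  the generating function of the \<open>h\<^sub>j\<close> and \<open>B\<close> that of the Bernstein operators.\<close>

lemma vop_plus_bern:
  assumes q: "q \<noteq> 0" and d: "hwt (\<lambda>w. w \<le> int d) f" and N: "k + int d \<le> int N"
  shows "vop (crP q) (anP q) k f =
    (\<Sum>j\<le>N. hconst (q powi (k - 2 * int j)) * (hsym (int j) * bern (k - int j) f))"
proof -
  have "vop (crP q) (anP q) k f = vop (\<lambda>n. inverse q ^ n / of_nat n + q ^ n / of_nat n) (\<lambda>n. inverse q ^ n * - 1) k f"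
    by (rule vop_cong) (simp_all add: crP_def anP_def add_divide_distrib add.commute)
  also have "\<dots> = (\<Sum>j\<le>N. cre (\<lambda>n. inverse q ^ n / of_nat n) (int j) *
      vop (\<lambda>n. q ^ n / of_nat n) (\<lambda>n. inverse q ^ n * - 1) (k - int j) f)"
    by (rule vop_factor[OF d N])
  also have "\<dots> = (\<Sum>j\<le>N. hconst (q powi (k - 2 * int j)) * (hsym (int j) * bern (k - int j) f))"
  proof (intro sum.cong refl)
    fix j
    have "vop (\<lambda>n. q ^ n / of_nat n) (\<lambda>n. inverse q ^ n * - 1) (k - int j) f = hconst (q powi (k - int j)) * bern (k - int j) f"
      using vop_scale[OF q, of "\<lambda>n. 1 / of_nat n" "\<lambda>_. - 1" "k - int j" f] by (simp add: bern_def)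
    moreover have "q powi (k - 2 * int j) = inverse q ^ j * q powi (k - int j)"
    proof -
      have e: "k - 2 * int j = - int j + (k - int j)"
        by simp
      have "q powi (- int j + (k - int j)) = q powi (- int j) * q powi (k - int j)"
        using q by (intro power_int_add) simp
      moreover have "q powi (- int j) = inverse q ^ j"
        by (simp add: power_int_minus power_inverse)
      ultimately show ?thesis
        by (simp only: e)
    qed
    ultimately show "cre (\<lambda>n. inverse q ^ n / of_nat n) (int j) * vop (\<lambda>n. q ^ n / of_nat n) (\<lambda>n. inverse q ^ n * - 1) (k - int j) f =
        hconst (q powi (k - 2 * int j)) * (hsym (int j) * bern (k - int j) f)"
      unfolding cre_geometric by (simp only: hconst_mult mult_ac)
  qed
  finally show ?thesis .
qed

lemma vop_minus_bern:
  assumes d: "hwt (\<lambda>w. w \<le> int d) f" and N: "k + int d \<le> int N"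
  shows "omega (vop (crM q) (\<lambda>_. 1) k f) =
    hconst ((- 1) powi k) * (\<Sum>j\<le>N. hconst (q ^ (2 * j)) * (hsym (int j) * bern (k - int j) (omega f)))"
proof -
  have d': "hwt (\<lambda>w. w \<le> int d) (omega f)"
    using d by (simp only: hwt_omega)
  \<comment> \<open>The sign of \<open>omega\<close> is minus (-1)^n: the minus cancels the one in
    \<open>crM\<close> and gives the -1 of the Bernstein operator, and (-1)^n is the substitution of
    -z for z.\<close>
  have sgn: "(- 1) ^ (n - 1) = - ((- 1) ^ n :: 'a)" if "n > 0" for n
    using that by (cases n) auto
  have "omega (vop (crM q) (\<lambda>_. 1) k f) =
      vop (\<lambda>n. (- 1) ^ n * ((q\<^sup>2) ^ n / of_nat n + 1 / of_nat n)) (\<lambda>n. inverse (- 1) ^ n * - 1) k (omega f)"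
    unfolding omega_vop
  proof (rule vop_cong)
    fix n :: nat assume n: "n > 0"
    show "(- 1) ^ (n - 1) * crM q n = (- 1) ^ n * ((q\<^sup>2) ^ n / of_nat n + 1 / of_nat n)"
      unfolding sgn[OF n] crM_def minus_mult_minus by (simp only: add_divide_distrib add.commute)
    show "(- 1) ^ (n - 1) * 1 = inverse (- 1) ^ n * (- 1 :: 'a)"
      unfolding sgn[OF n] by simp
  qed
  also have "\<dots> = hconst ((- 1) powi k) * vop (\<lambda>n. (q\<^sup>2) ^ n / of_nat n + 1 / of_nat n) (\<lambda>_. - 1) k (omega f)"
    by (rule vop_scale) simp
  also have "vop (\<lambda>n. (q\<^sup>2) ^ n / of_nat n + 1 / of_nat n) (\<lambda>_. - 1) k (omega f) =
      (\<Sum>j\<le>N. cre (\<lambda>n. (q\<^sup>2) ^ n / of_nat n) (int j) * vop (\<lambda>n. 1 / of_nat n) (\<lambda>_. - 1) (k - int j) (omega f))"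
    by (rule vop_factor[OF d' N])
  also have "\<dots> = (\<Sum>j\<le>N. hconst (q ^ (2 * j)) * (hsym (int j) * bern (k - int j) (omega f)))"
    unfolding cre_geometric bern_def by (simp only: power_mult mult.assoc)
  finally show ?thesis .
qed

lemma schur_fock_eq: "is_partition \<kappa> \<Longrightarrow> schur_fock \<kappa> m = Poly_Mapping.single m (spart \<kappa> :: 'a::field_char_0 heis_sym)"
  by (simp add: schur_fock_def schur_sym_eq)

text \<open>Straightening followed by the Pieri rule. For sign 0 the value of
  \<open>tuple_part\<close> is meaningless, and the factor 0 removes it.\<close>

lemma hsym_bern_spart:
  assumes \<mu>: "is_partition \<mu>" and k: "- int (length \<mu>) \<le> a"
  shows "hsym (int j) * bern a (spart \<mu>) = hconst (of_int (tuple_sgn (juxtapose a \<mu>))) *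
    (\<Sum>\<kappa> | is_partition \<kappa> \<and> horizontal_strip j \<kappa> (tuple_part (juxtapose a \<mu>)). spart \<kappa> :: 'a::field_char_0 heis_sym)"
proof (cases "tuple_sgn (juxtapose a \<mu>) = 0")
  case False
  let ?\<pi> = "tuple_part (juxtapose a \<mu>)"
  have \<pi>: "is_partition ?\<pi>"
    by (rule bern_straighten(2)[OF \<mu> k False])
  have "{\<kappa>. is_partition \<kappa> \<and> hstrip \<kappa> ?\<pi> \<and> sum_list \<kappa> = sum_list ?\<pi> + j} = {\<kappa>. is_partition \<kappa> \<and> horizontal_strip j \<kappa> ?\<pi>}"
    using horizontal_strip_iff[OF _ \<pi>] by auto
  then have "hsym (int j) * spart ?\<pi> = (\<Sum>\<kappa> | is_partition \<kappa> \<and> horizontal_strip j \<kappa> ?\<pi>. spart \<kappa> :: 'a heis_sym)"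
    using pieri[OF \<pi>, of j, where ?'a = 'a] by simp
  then show ?thesis
    unfolding bern_straighten(1)[OF \<mu> k] by (subst mult.left_commute) (simp only:)
qed (simp add: bern_straighten(1)[OF \<mu> k])

text \<open>The terms with \<open>k - j < -l(\<mu>)\<close> vanish.\<close>

lemma sum_hsym_bern:
  fixes c :: "int \<Rightarrow> 'a::field_char_0"
  assumes \<mu>: "is_partition \<mu>" and N: "k + int (length \<mu>) \<le> int N"
  shows "(\<Sum>j\<le>N. hconst (c (int j)) * (hsym (int j) * bern (k - int j) (spart \<mu>))) =
    (\<Sum>j = 0..int (length \<mu>) + k. hconst (c j * of_int (tuple_sgn (juxtapose (k - j) \<mu>))) *
      (\<Sum>\<kappa> | is_partition \<kappa> \<and> horizontal_strip (nat j) \<kappa> (tuple_part (juxtapose (k - j) \<mu>)). spart \<kappa>))"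
proof -
  have "(\<Sum>j\<le>N. hconst (c (int j)) * (hsym (int j) * bern (k - int j) (spart \<mu>))) =
      (\<Sum>j = 0..int N. hconst (c j) * (hsym j * bern (k - j) (spart \<mu>)))"
    by (rule sum.reindex_bij_witness[of _ nat int]) auto
  also have "\<dots> = (\<Sum>j = 0..int (length \<mu>) + k. hconst (c j) * (hsym j * bern (k - j) (spart \<mu>)))"
  proof (intro sum.mono_neutral_right ballI)
    fix j assume "j \<in> {0..int N} - {0..int (length \<mu>) + k}"
    then have "k - j < - int (length \<mu>)"
      by auto
    then show "hconst (c j) * (hsym j * bern (k - j) (spart \<mu>)) = 0"
      by (simp add: bern_very_negative)
  qed (use N in auto)
  also have "\<dots> = (\<Sum>j = 0..int (length \<mu>) + k. hconst (c j * of_int (tuple_sgn (juxtapose (k - j) \<mu>))) *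
      (\<Sum>\<kappa> | is_partition \<kappa> \<and> horizontal_strip (nat j) \<kappa> (tuple_part (juxtapose (k - j) \<mu>)). spart \<kappa>))"
  proof (intro sum.cong refl)
    fix j assume j: "j \<in> {0..int (length \<mu>) + k}"
    then have "- int (length \<mu>) \<le> k - j" "j = int (nat j)"
      by auto
    then show "hconst (c j) * (hsym j * bern (k - j) (spart \<mu>)) =
        hconst (c j * of_int (tuple_sgn (juxtapose (k - j) \<mu>))) *
        (\<Sum>\<kappa> | is_partition \<kappa> \<and> horizontal_strip (nat j) \<kappa> (tuple_part (juxtapose (k - j) \<mu>)). spart \<kappa>)"
      using hsym_bern_spart[OF \<mu>, of "k - j" "nat j", where ?'a = 'a] by (simp add: hconst_mult mult.assoc)
  qed
  finally show ?thesis .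
qed

lemma X_plus_schur:
  fixes q :: "'a::field_char_0"
  assumes alg: "\<not> algebraic q" and \<mu>: "is_partition \<mu>"
  shows "X_plus q i n (schur_fock \<mu> m) =
    (\<Sum>j = 0..int (length \<mu>) - 2 * m - n - 1 - i.
      fock_scale (q powi (- 2 * m - n - 1 - i - 2 * j) * of_int (tuple_sgn (juxtapose (- 2 * m - n - 1 - i - j) \<mu>)))
        (\<Sum>\<kappa> | is_partition \<kappa> \<and> horizontal_strip (nat j) \<kappa> (tuple_part (juxtapose (- 2 * m - n - 1 - i - j) \<mu>)).
          schur_fock \<kappa> (m + 1)))"
proof -
  let ?k = "- 2 * m - n - 1 - i"
  obtain d where d: "hwt (\<lambda>w. w \<le> int d) (spart \<mu> :: 'a heis_sym)"
    using hwt_bounded by blast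
  \<comment> \<open>The two summands meet the two lower bounds on N: that of
    \<open>vop_plus_bern\<close>, from the weight, and that of \<open>sum_hsym_bern\<close>, from
    the length.\<close>
  let ?N = "nat (?k + int d) + nat (?k + int (length \<mu>))"
  have q: "q \<noteq> 0"
    by (rule not_algebraic_imp_nonzero(1)[OF alg])
  have k: "- n - 1 - (2 * m + i) = ?k" "int (length \<mu>) - 2 * m - n - 1 - i = int (length \<mu>) + ?k"
    by simp_all
  have "X_plus q i n (schur_fock \<mu> m) = Poly_Mapping.single (m + 1) (vop (crP q) (anP q) ?k (spart \<mu>))"
    unfolding schur_fock_eq[OF \<mu>] X_plus_single[OF alg] k ..
  also have "vop (crP q) (anP q) ?k (spart \<mu>) =
      (\<Sum>j\<le>?N. hconst (q powi (?k - 2 * int j)) * (hsym (int j) * bern (?k - int j) (spart \<mu>)))"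
    by (rule vop_plus_bern[OF q d]) simp
  also have "\<dots> = (\<Sum>j = 0..int (length \<mu>) + ?k. hconst (q powi (?k - 2 * j) * of_int (tuple_sgn (juxtapose (?k - j) \<mu>))) *
      (\<Sum>\<kappa> | is_partition \<kappa> \<and> horizontal_strip (nat j) \<kappa> (tuple_part (juxtapose (?k - j) \<mu>)). spart \<kappa>))"
    by (rule sum_hsym_bern[OF \<mu>]) simp
  also have "Poly_Mapping.single (m + 1) \<dots> =
      (\<Sum>j = 0..int (length \<mu>) + ?k. fock_scale (q powi (?k - 2 * j) * of_int (tuple_sgn (juxtapose (?k - j) \<mu>)))
        (\<Sum>\<kappa> | is_partition \<kappa> \<and> horizontal_strip (nat j) \<kappa> (tuple_part (juxtapose (?k - j) \<mu>)). schur_fock \<kappa> (m + 1)))"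
    unfolding single_sum fock_scale_single[symmetric]
    by (intro sum.cong refl arg_cong[where f = "fock_scale _"]) (simp add: schur_fock_eq)
  finally show ?thesis
    unfolding k(2) .
qed

lemma X_minus_schur:
  fixes q :: "'a::field_char_0"
  assumes alg: "\<not> algebraic q" and \<mu>: "is_partition \<mu>"
  shows "X_minus q i n (schur_fock \<mu> m) =
    fock_scale ((- 1) powi (n + 1 + i))
      (\<Sum>j = 0..int (first_part \<mu>) + 2 * m - n - 1 + i.
        fock_scale (q powi (2 * j) * of_int (tuple_sgn (juxtapose (2 * m - n - 1 - j + i) (conjugate \<mu>))))
          (\<Sum>\<kappa> | is_partition \<kappa> \<and>
               vertical_strip (nat j) \<kappa> (conjugate (tuple_part (juxtapose (2 * m - n - 1 - j + i) (conjugate \<mu>)))).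
            schur_fock \<kappa> (m - 1)))"
proof -
  let ?k = "2 * m - n - 1 + i" and ?\<mu> = "conjugate \<mu>"
  let ?\<pi> = "\<lambda>j. tuple_part (juxtapose (?k - j) ?\<mu>)" and ?c = "\<lambda>j. q powi (2 * j) * of_int (tuple_sgn (juxtapose (?k - j) ?\<mu>))"
  note conj = conjugate_props[OF \<mu>]
  obtain d where d: "hwt (\<lambda>w. w \<le> int d) (spart \<mu> :: 'a heis_sym)"
    using hwt_bounded by blast
  let ?N = "nat (?k + int d) + nat (?k + int (length ?\<mu>))"
  have k: "- n - 1 + (2 * m + i) = ?k" "int (first_part \<mu>) + 2 * m - n - 1 + i = int (length ?\<mu>) + ?k"
    "2 * m - n - 1 - j + i = ?k - j" for j
    by (simp_all add: length_conjugate)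
  \<comment> \<open>The exponents 2m - n - 1 + i and n + 1 + i have the same parity.\<close>
  have sgn: "(- 1 :: 'a) powi ?k = (- 1) powi (n + 1 + i)"
    by (simp add: power_int_minus_left)
  have om: "omega (spart \<mu>) = (spart ?\<mu> :: 'a heis_sym)"
    using omega_spart[OF conj(1)] by (simp only: conj(3))
  have "omega (vop (crM q) (\<lambda>_. 1) ?k (spart \<mu>)) =
      hconst ((- 1) powi ?k) * (\<Sum>j\<le>?N. hconst (q powi (2 * int j)) * (hsym (int j) * bern (?k - int j) (spart ?\<mu>)))"
    using vop_minus_bern[OF d, of ?k ?N q] by (simp add: om power_int_def nat_mult_distrib)
  also have "(\<Sum>j\<le>?N. hconst (q powi (2 * int j)) * (hsym (int j) * bern (?k - int j) (spart ?\<mu>))) =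
      (\<Sum>j = 0..int (length ?\<mu>) + ?k. hconst (?c j) * (\<Sum>\<kappa> | is_partition \<kappa> \<and> horizontal_strip (nat j) \<kappa> (?\<pi> j). spart \<kappa>))"
    by (rule sum_hsym_bern[OF conj(1)]) simp
  finally have om_vop: "omega (vop (crM q) (\<lambda>_. 1) ?k (spart \<mu>)) = hconst ((- 1) powi ?k) *
      (\<Sum>j = 0..int (length ?\<mu>) + ?k. hconst (?c j) * (\<Sum>\<kappa> | is_partition \<kappa> \<and> horizontal_strip (nat j) \<kappa> (?\<pi> j). spart \<kappa>))" .
  \<comment> \<open>\<open>omega\<close> is an involution, so applying it once more recovers X^-; it
    fixes scalars and acts on the Schur functions in the sum.\<close>
  have "vop (crM q) (\<lambda>_. 1) ?k (spart \<mu>) = omega (hconst ((- 1) powi ?k) *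
      (\<Sum>j = 0..int (length ?\<mu>) + ?k. hconst (?c j) * (\<Sum>\<kappa> | is_partition \<kappa> \<and> horizontal_strip (nat j) \<kappa> (?\<pi> j). spart \<kappa>)))"
    by (rule arg_cong[OF om_vop, of omega, unfolded omega_omega])
  also have "\<dots> = hconst ((- 1) powi ?k) *
      (\<Sum>j = 0..int (length ?\<mu>) + ?k. hconst (?c j) * (\<Sum>\<kappa> | is_partition \<kappa> \<and> horizontal_strip (nat j) \<kappa> (?\<pi> j). omega (spart \<kappa>)))"
    by (simp only: omega_mult omega_hconst hlinear_sum[OF omega_linear])
  also have "(\<Sum>j = 0..int (length ?\<mu>) + ?k. hconst (?c j) * (\<Sum>\<kappa> | is_partition \<kappa> \<and> horizontal_strip (nat j) \<kappa> (?\<pi> j). omega (spart \<kappa>))) =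
      (\<Sum>j = 0..int (length ?\<mu>) + ?k. hconst (?c j) * (\<Sum>\<kappa> | is_partition \<kappa> \<and> vertical_strip (nat j) \<kappa> (conjugate (?\<pi> j)). spart \<kappa> :: 'a heis_sym))"
  proof (rule sum.cong[OF refl])
    fix j assume "j \<in> {0..int (length ?\<mu>) + ?k}"
    then have a: "- int (length ?\<mu>) \<le> ?k - j"
      by auto
    show "hconst (?c j) * (\<Sum>\<kappa> | is_partition \<kappa> \<and> horizontal_strip (nat j) \<kappa> (?\<pi> j). omega (spart \<kappa>)) =
        hconst (?c j) * (\<Sum>\<kappa> | is_partition \<kappa> \<and> vertical_strip (nat j) \<kappa> (conjugate (?\<pi> j)). spart \<kappa> :: 'a heis_sym)"
    proof (cases "tuple_sgn (juxtapose (?k - j) ?\<mu>) = 0")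
      case False
      have \<pi>: "is_partition (?\<pi> j)"
        by (rule bern_straighten(2)[OF conj(1) a False])
      note cp = conjugate_props[OF \<pi>]
      \<comment> \<open>Transposition maps the horizontal strips over the straightened partition
        bijectively to the vertical strips over its conjugate.\<close>
      have "(\<Sum>\<kappa> | is_partition \<kappa> \<and> horizontal_strip (nat j) \<kappa> (?\<pi> j). omega (spart \<kappa>)) =
          (\<Sum>\<kappa> | is_partition \<kappa> \<and> vertical_strip (nat j) \<kappa> (conjugate (?\<pi> j)). spart \<kappa> :: 'a heis_sym)"
      proof (rule sum.reindex_bij_witness[of _ conjugate conjugate])
        fix \<kappa> assume \<kappa>: "\<kappa> \<in> {\<kappa>. is_partition \<kappa> \<and> horizontal_strip (nat j) \<kappa> (?\<pi> j)}"
        then have p: "is_partition \<kappa>" by simp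
        note ck = conjugate_props[OF p]
        show "conjugate (conjugate \<kappa>) = \<kappa>"
          by (rule ck(3))
        have "vertical_strip (nat j) (conjugate \<kappa>) (conjugate (?\<pi> j))"
          using \<kappa> strip_conjugate[OF ck(1) cp(1), of "nat j"] by (simp add: ck(3) cp(3))
        then show "conjugate \<kappa> \<in> {\<kappa>. is_partition \<kappa> \<and> vertical_strip (nat j) \<kappa> (conjugate (?\<pi> j))}"
          using ck(1) by simp
        show "spart (conjugate \<kappa>) = (omega (spart \<kappa>) :: 'a heis_sym)"
          using omega_spart[OF ck(1), where ?'a = 'a] by (simp only: ck(3))
      next
        fix \<kappa> assume \<kappa>: "\<kappa> \<in> {\<kappa>. is_partition \<kappa> \<and> vertical_strip (nat j) \<kappa> (conjugate (?\<pi> j))}"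
        then have p: "is_partition \<kappa>" by simp
        note ck = conjugate_props[OF p]
        show "conjugate (conjugate \<kappa>) = \<kappa>"
          by (rule ck(3))
        have "horizontal_strip (nat j) (conjugate \<kappa>) (?\<pi> j)"
          using \<kappa> strip_conjugate[OF p cp(1), of "nat j"] by (simp add: cp(3))
        then show "conjugate \<kappa> \<in> {\<kappa>. is_partition \<kappa> \<and> horizontal_strip (nat j) \<kappa> (?\<pi> j)}"
          using ck(1) by simp
      qed
      then show ?thesis
        by (simp only:)
    qed simp
  qed
  finally have vop: "vop (crM q) (\<lambda>_. 1) ?k (spart \<mu>) = hconst ((- 1) powi ?k) *
      (\<Sum>j = 0..int (length ?\<mu>) + ?k. hconst (?c j) * (\<Sum>\<kappa> | is_partition \<kappa> \<and> vertical_strip (nat j) \<kappa> (conjugate (?\<pi> j)). spart \<kappa>))" .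
  have "X_minus q i n (schur_fock \<mu> m) = Poly_Mapping.single (m - 1) (vop (crM q) (\<lambda>_. 1) ?k (spart \<mu>))"
    unfolding schur_fock_eq[OF \<mu>] X_minus_single[OF alg] k(1) ..
  also have "\<dots> = fock_scale ((- 1) powi ?k)
      (\<Sum>j = 0..int (length ?\<mu>) + ?k. fock_scale (?c j)
        (\<Sum>\<kappa> | is_partition \<kappa> \<and> vertical_strip (nat j) \<kappa> (conjugate (?\<pi> j)). schur_fock \<kappa> (m - 1)))"
    unfolding vop fock_scale_single[symmetric] single_sum
    by (intro sum.cong refl arg_cong[where f = "fock_scale _"]) (simp add: schur_fock_eq)
  finally show ?thesis
    unfolding k(2,3) sgn .
qed

theorem theorem3p2:
  fixes q q_half :: "'a::field_char_0" and i :: int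
  assumes "q_half\<^sup>2 = q" and "\<not> algebraic q" and "i \<in> {0, 1}"
  shows "Uq_sl2_hat_module fock_scale q (fock_e q i) (fock_f q i) (fock_K q i) (fock_Kinv q i)
           (q_grading q i 1) (q_grading q i (- 1)) \<and>
    (\<forall>(n::int) (m::int) \<mu>. is_partition \<mu> \<longrightarrow>
      X_plus q i n (schur_fock \<mu> m) =
        (\<Sum>j = 0..int (length \<mu>) - 2 * m - n - 1 - i.
          fock_scale (q powi (- 2 * m - n - 1 - i - 2 * j) *
              of_int (tuple_sgn (juxtapose (- 2 * m - n - 1 - i - j) \<mu>)))
            (\<Sum>\<kappa> | is_partition \<kappa> \<and>
                 horizontal_strip (nat j) \<kappa> (tuple_part (juxtapose (- 2 * m - n - 1 - i - j) \<mu>)).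
              schur_fock \<kappa> (m + 1))) \<and>
      X_minus q i n (schur_fock \<mu> m) =
        fock_scale ((- 1) powi (n + 1 + i))
          (\<Sum>j = 0..int (first_part \<mu>) + 2 * m - n - 1 + i.
            fock_scale (q powi (2 * j) *
                of_int (tuple_sgn (juxtapose (2 * m - n - 1 - j + i) (conjugate \<mu>))))
              (\<Sum>\<kappa> | is_partition \<kappa> \<and>
                   vertical_strip (nat j) \<kappa>
                     (conjugate (tuple_part (juxtapose (2 * m - n - 1 - j + i) (conjugate \<mu>)))).
                schur_fock \<kappa> (m - 1))))"
  using vertex_module.fock_module[OF vertex_module.intro[OF assms(2)]] X_plus_schur[OF assms(2)]
    X_minus_schur[OF assms(2)]
  by blast

end
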